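(* Let $R$ and $R'$ be two PS's such that $\mathcal{P}^{\mathsf f}(R)=\mathcal{P}^{\mathsf f}(R')$. If $\llbracket R\rrbracket=\llbracket R'\rrbracket$, then $R\equiv R'$.
   Context: **Types and labels.** Types: $\mathbb{T}::=1\mid\bot\mid(\mathbb{T}\otimes\mathbb{T})\mid(\mathbb{T}\wp\mathbb{T})\mid{!}\mathbb{T}\mid{?}\mathbb{T}$. Labels: $\{\otimes,\wp,1,\bot,!,?,\circ\}$. **Ground-structures.** A ground-structure is $\mathcal{G}=(\mathcal{W},\mathcal{P},l,t,\mathcal{L},\mathsf{T})$ where: $\mathcal{P}$ is a finite set (ports); $l$ maps $\mathcal{P}$ to labels; $\mathcal{W}\subseteq\{p\in\mathcal{P}: l(p)\neq\circ\}$ (wires); $t:\mathcal{W}\to\{p\in\mathcal{P}: l(p)\notin\{1,\bot,!,\circ\}\}$ is such that every port $p$ with $l(p)\in\{\otimes,\wp\}$ has exactly two premises (a premise of $p$ is a $w\in\mathcal{W}$ with $t(w)=p$); $\mathcal{L}\subseteq\{w\in\mathcal{W}: l(t(w))\in\{\otimes,\wp\}\}$ contains exactly one premise (the left one) of each port labelled $\otimes$ or $\wp$; $\mathsf{T}:\mathcal{P}\to\mathbb{T}$ satisfies: $\mathsf{T}(p)=l(p)$ if $l(p)\in\{1,\bot\}$; $\mathsf{T}(p)=(\mathsf{T}(w_1)\otimes\mathsf{T}(w_2))$ (resp. $(\mathsf{T}(w_1)\wp\mathsf{T}(w_2))$) if $l(p)=\otimes$ (resp. $\wp$), with $w_1$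 the left premise and $w_2$ the other premise of $p$; $\mathsf{T}(p)={!}C$ for some $C$ if $l(p)={!}$; if $l(p)\in\{?,\circ\}$, then $\mathsf{T}(p)={?}C$ for some $C$ such that $\mathsf{T}(w)=C$ for all premises $w$ of $p$. The conclusions of $\mathcal{G}$ are the elements of $\mathcal{P}\setminus\mathcal{W}$. **$\circ$-PS's and PS's.** By induction on $d\in\mathbb{N}$, a $\circ$-PS of depth $d$ is $S=(\mathcal{G},\mathcal{B}_0,B,b)$ where: $\mathcal{G}$ is a ground-structure none of whose ports is a finite sequence; $\mathcal{B}_0$ is the set of all $!$-labelled ports of $\mathcal{G}$ (the boxes at depth $0$); $B$ assigns to each $o\in\mathcal{B}_0$ a $\circ$-PS $B(o)$ of depth $<d$ and, if $d>0$, some $B(o)$ has depth $d-1$; $b$ assigns to each $o\in\mathcal{B}_0$ a function $b(o)$ from the conclusions of $B(o)$ to $\{o\}\cup\{p: l(p)\in\{?,\circ\}\}$ such that every $\circ$-labelled port of $\mathcal{G}$ lies in the image of some $b(o)$, and for each $o\in\mathcal{B}_0$: (i) $b(o)$ restricted to the $\circ$-labelled ports of $B(o)$ is the identity, and no $\circ$-labelled port is mapped to a $!$-labelled port; (ii) $o\in\mathrm{im}(b(o))$; (iii) $\mathsf{T}_{\mathcal{G}}(b(o)(p))=\mathsf{T}_{B(o)}(p)$ for every $\circ$-labelled port $p$ of $B(o)$; (iv) $\mathsf{T}_{\mathcal{G}}(b(o)(p))\in\{{?}\mathsf{T}_{B(o)}(p),{!}\mathsf{T}_{B(o)}(p)\}$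 for every conclusion $p$ of $B(o)$ not labelled $\circ$. (Labels, types, ports, conclusions of $S$ are those of its ground-structure.) Write $\mathcal{P}_0(S)$, $\mathcal{W}_0(S)$, $\mathcal{P}^{\mathsf f}(S)$ for the ports, wires and conclusions of $\mathcal{G}$, $\mathcal{B}_0(S)=\mathcal{B}_0$, $B_S=B$, $b_S=b$, $\mathsf{T}_S=\mathsf{T}$; $\mathcal{P}^{\mathsf f}_\circ(S)$ is the set of $\circ$-labelled ports (they are all conclusions) and $\mathcal{P}^{\mathsf f}_\bullet(S)=\mathcal{P}^{\mathsf f}(S)\setminus\mathcal{P}^{\mathsf f}_\circ(S)$. A PS is a $\circ$-PS $R$ with $\mathcal{P}^{\mathsf f}_\circ(R)=\emptyset$. (There are no axioms, no cuts and no correctness criterion.) **Isomorphism.** An isomorphism of ground-structures is a bijection of ports preserving and reflecting $\mathcal{W},l,t,\mathcal{L},\mathsf{T}$. By induction on depth, $\varphi:R\simeq R'$ means $\varphi=(\varphi_{\mathcal{G}},(\varphi_o)_{o\in\mathcal{B}_0(R)})$, with $\varphi_{\mathcal{G}}$ an isomorphism of the ground-structures of $R$ and $R'$, $\varphi_{\mathcal{G}}(\mathcal{B}_0(R))=\mathcal{B}_0(R')$, and for every $o\in\mathcal{B}_0(R)$: $\varphi_o:B_R(o)\simeq B_{R'}(\varphi_{\mathcal{G}}(o))$ and $b_{R'}(\varphi_{\mathcal{G}}(o))((\varphi_o)_{\mathcal{G}}(q))=\varphi_{\mathcal{G}}(b_R(o)(q))$ for all $q\in\mathcal{P}^{\mathsf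 f}(B_R(o))$. Write $R\equiv R'$ if there is $\varphi:R\simeq R'$ with $\varphi_{\mathcal{G}}(p)=p$ for every $p\in\mathcal{P}^{\mathsf f}(R)$. **Interpretation.** $\llbracket 1\rrbracket=\llbracket\bot\rrbracket=\{\ast\}$; $\llbracket C_1\otimes C_2\rrbracket=\llbracket C_1\wp C_2\rrbracket=\llbracket C_1\rrbracket\times\llbracket C_2\rrbracket$; $\llbracket{!}C\rrbracket=\llbracket{?}C\rrbracket$ is the set of finite multisets of elements of $\llbracket C\rrbracket$. By induction on depth, an experiment of a $\circ$-PS $R$ is a triple $e=(R,e_{\mathcal P},e_{\mathcal B})$, with $e_{\mathcal P}(p)\in\llbracket\mathsf{T}_R(p)\rrbracket$ for each $p\in\mathcal{P}_0(R)$ and $e_{\mathcal B}(o)$ a finite multiset of experiments of $B_R(o)$ for each $o\in\mathcal{B}_0(R)$, such that: if $p$ is labelled $\otimes$ or $\wp$ with left premise $w_1$ and other premise $w_2$, then $e_{\mathcal P}(p)=(e_{\mathcal P}(w_1),e_{\mathcal P}(w_2))$; if $p$ is labelled $!,?$ or $\circ$, then $$e_{\mathcal P}(p)=\sum_{w:\,t(w)=p}[e_{\mathcal P}(w)]+\sum_{o\in\mathcal{B}_0(R)}\sum_{e'}e_{\mathcal B}(o)(e')\cdot\Big(\sum_{\substack{q\in\mathcal{P}^{\mathsf f}_\bullet(B_R(o))\\ b_R(o)(q)=p}}[e'_{\mathcal P}(q)]+\sum_{\substack{q\in\mathcal{P}^{\mathsf f}_\circ(B_R(o))\\ b_R(o)(q)=p}}e'_{\mathcal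 P}(q)\Big),$$ where $e'$ ranges over the support of $e_{\mathcal B}(o)$, $e_{\mathcal B}(o)(e')$ is the multiplicity of $e'$, and sums are sums of multisets. Finally $\llbracket R\rrbracket=\{e_{\mathcal P}|_{\mathcal{P}^{\mathsf f}(R)} : e\text{ an experiment of }R\}$.
   Formalization: Added hypothesis: the common conclusions of R and R' carry the same types in both. Without it the claim fails (a single port labelled 1 versus the same port labelled ⊥ have equal interpretations), and R ≡ R' implies it. *)

theory Defs
  imports "HOL-Library.Multiset" "HOL-Library.FuncSet"
begin

section \<open>Types, labels and ground-structures\<close>

datatype mell_type =
    TOne
  | TBot
  | TTensor mell_type mell_type
  | TPar mell_type mell_type
  | TBang mell_type
  | TQuest mell_type

datatype label = LTensor | LPar | LOne | LBot | LBang | LQuest | LCirc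

text \<open>
  Only the behaviour of \<open>lab\<close> and \<open>ptype\<close> on \<open>ports\<close>, and of \<open>tgt\<close> on \<open>wires\<close>, is meaningful;
  no notion below depends on the values elsewhere.
\<close>

record 'p ground =
  wires :: "'p set"
  ports :: "'p set"
  lab   :: "'p \<Rightarrow> label"
  tgt   :: "'p \<Rightarrow> 'p"
  lefts :: "'p set"
  ptype   :: "'p \<Rightarrow> mell_type"

definition premises_of :: "'p ground \<Rightarrow> 'p \<Rightarrow> 'p set" where
  "premises_of G p = {w \<in> wires G. tgt G w = p}"

definition left_premises :: "'p ground \<Rightarrow> 'p \<Rightarrow> 'p set" where
  "left_premises G p = premises_of G p \<inter> lefts G"

definition right_premises :: "'p ground \<Rightarrow> 'p \<Rightarrow> 'p set" where
  "right_premises G p = premises_of G p - lefts G"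

text \<open>
  For a port labelled \<open>LTensor\<close> or \<open>LPar\<close> the two cardinality conditions make
  \<open>left_premises\<close> and \<open>right_premises\<close> singletons, so that the quantifiers over \<open>w1\<close>, \<open>w2\<close>
  range over exactly one pair.
\<close>

definition ground_structure :: "'p ground \<Rightarrow> bool" where
  "ground_structure G \<longleftrightarrow>
     finite (ports G) \<and>
     wires G \<subseteq> {p \<in> ports G. lab G p \<noteq> LCirc} \<and>
     tgt G ` wires G \<subseteq> {p \<in> ports G. lab G p \<notin> {LOne, LBot, LBang, LCirc}} \<and>
     (\<forall>p\<in>ports G. lab G p \<in> {LTensor, LPar} \<longrightarrow> card (premises_of G p) = 2) \<and>
     lefts G \<subseteq> {w \<in> wires G. lab G (tgt G w) \<in> {LTensor, LPar}} \<and>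
     (\<forall>p\<in>ports G. lab G p \<in> {LTensor, LPar} \<longrightarrow> card (left_premises G p) = 1) \<and>
     (\<forall>p\<in>ports G. lab G p = LOne \<longrightarrow> ptype G p = TOne) \<and>
     (\<forall>p\<in>ports G. lab G p = LBot \<longrightarrow> ptype G p = TBot) \<and>
     (\<forall>p\<in>ports G. lab G p = LTensor \<longrightarrow>
        (\<forall>w1\<in>left_premises G p. \<forall>w2\<in>right_premises G p.
           ptype G p = TTensor (ptype G w1) (ptype G w2))) \<and>
     (\<forall>p\<in>ports G. lab G p = LPar \<longrightarrow>
        (\<forall>w1\<in>left_premises G p. \<forall>w2\<in>right_premises G p.
           ptype G p = TPar (ptype G w1) (ptype G w2))) \<and>
     (\<forall>p\<in>ports G. lab G p = LBang \<longrightarrow> (\<exists>C. ptype G p = TBang C)) \<and>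
     (\<forall>p\<in>ports G. lab G p \<in> {LQuest, LCirc} \<longrightarrow>
        (\<exists>C. ptype G p = TQuest C \<and> (\<forall>w\<in>premises_of G p. ptype G w = C)))"


section \<open>Proof-structures with boxes\<close>

text \<open>
  The set of boxes at depth 0 is determined by the ground-structure and therefore recovered
  as \<open>boxes\<close> rather than stored as a component of \<open>CPS\<close>. Ports are taken from an arbitrary
  type \<open>'p\<close>. The convention that no port is a finite sequence, which only serves to keep ports
  apart from sequences of ports, needs no counterpart, since \<open>'p\<close> and \<open>'p list\<close> are distinct
  types.
\<close>

datatype 'p cps =
  CPS (ground_of: "'p ground") (box_content: "'p \<Rightarrow> 'p cps option") (box_map: "'p \<Rightarrow> 'p \<Rightarrow> 'p")

definition boxes :: "'p cps \<Rightarrow> 'p set" where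
  "boxes R = {p \<in> ports (ground_of R). lab (ground_of R) p = LBang}"

definition box_at :: "'p cps \<Rightarrow> 'p \<Rightarrow> 'p cps" where
  "box_at R a = the (box_content R a)"

definition conclusions :: "'p cps \<Rightarrow> 'p set" where
  "conclusions R = ports (ground_of R) - wires (ground_of R)"

definition circ_ports :: "'p cps \<Rightarrow> 'p set" where
  "circ_ports R = {p \<in> ports (ground_of R). lab (ground_of R) p = LCirc}"

definition bullet_conclusions :: "'p cps \<Rightarrow> 'p set" where
  "bullet_conclusions R = conclusions R - circ_ports R"

definition box_conditions :: "'p cps \<Rightarrow> bool" where
  "box_conditions R \<longleftrightarrow> (let G = ground_of R; b = box_map R in
     circ_ports R \<subseteq> (\<Union>a\<in>boxes R. b a ` conclusions (box_at R a)) \<and>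
     (\<forall>a\<in>boxes R.
        b a ` conclusions (box_at R a)
          \<subseteq> {a} \<union> {p \<in> ports G. lab G p \<in> {LQuest, LCirc}} \<and>
        (\<forall>q\<in>circ_ports (box_at R a). b a q = q \<and> lab G (b a q) \<noteq> LBang) \<and>
        a \<in> b a ` conclusions (box_at R a) \<and>
        (\<forall>q\<in>circ_ports (box_at R a). ptype G (b a q) = ptype (ground_of (box_at R a)) q) \<and>
        (\<forall>q\<in>bullet_conclusions (box_at R a).
           ptype G (b a q) \<in> {TQuest (ptype (ground_of (box_at R a)) q),
                            TBang (ptype (ground_of (box_at R a)) q)})))"

inductive circ_PS :: "nat \<Rightarrow> 'p cps \<Rightarrow> bool" where
  "\<lbrakk> ground_structure (ground_of R);
     dom (box_content R) = boxes R;
     \<And>a. a \<in> boxes R \<Longrightarrow> \<exists>d'<d. circ_PS d' (box_at R a);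
     d > 0 \<Longrightarrow> \<exists>a\<in>boxes R. circ_PS (d - 1) (box_at R a);
     box_conditions R \<rbrakk>
   \<Longrightarrow> circ_PS d R"

definition PS :: "'p cps \<Rightarrow> bool" where
  "PS R \<longleftrightarrow> (\<exists>d. circ_PS d R) \<and> circ_ports R = {}"


section \<open>Isomorphism\<close>

definition ground_iso :: "('p \<Rightarrow> 'p) \<Rightarrow> 'p ground \<Rightarrow> 'p ground \<Rightarrow> bool" where
  "ground_iso f G G' \<longleftrightarrow>
     bij_betw f (ports G) (ports G') \<and>
     (\<forall>p\<in>ports G. f p \<in> wires G' \<longleftrightarrow> p \<in> wires G) \<and>
     (\<forall>p\<in>ports G. lab G' (f p) = lab G p) \<and>
     (\<forall>w\<in>wires G. tgt G' (f w) = f (tgt G w)) \<and>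
     (\<forall>p\<in>ports G. f p \<in> lefts G' \<longleftrightarrow> p \<in> lefts G) \<and>
     (\<forall>p\<in>ports G. ptype G' (f p) = ptype G p)"

datatype 'p ps_iso = PS_Iso (ground_map: "'p \<Rightarrow> 'p") (box_iso: "'p \<Rightarrow> 'p ps_iso option")

inductive is_iso :: "'p ps_iso \<Rightarrow> 'p cps \<Rightarrow> 'p cps \<Rightarrow> bool" where
  "\<lbrakk> ground_iso (ground_map \<phi>) (ground_of R) (ground_of R');
     ground_map \<phi> ` boxes R = boxes R';
     dom (box_iso \<phi>) = boxes R;
     \<And>a. a \<in> boxes R \<Longrightarrow> is_iso (the (box_iso \<phi> a)) (box_at R a) (box_at R' (ground_map \<phi> a));
     \<And>a q. a \<in> boxes R \<Longrightarrow> q \<in> conclusions (box_at R a) \<Longrightarrow>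
       box_map R' (ground_map \<phi> a) (ground_map (the (box_iso \<phi> a)) q)
         = ground_map \<phi> (box_map R a q) \<rbrakk>
   \<Longrightarrow> is_iso \<phi> R R'"

definition ps_equiv :: "'p cps \<Rightarrow> 'p cps \<Rightarrow> bool" (infix "\<equiv>\<^sub>P\<^sub>S" 50) where
  "R \<equiv>\<^sub>P\<^sub>S R' \<longleftrightarrow> (\<exists>\<phi>. is_iso \<phi> R R' \<and> (\<forall>p\<in>conclusions R. ground_map \<phi> p = p))"


section \<open>Relational interpretation\<close>

datatype val = Star | VPair val val | Bag (elems: "val multiset")

primrec type_sem :: "mell_type \<Rightarrow> val set" where
  "type_sem TOne = {Star}"
| "type_sem TBot = {Star}"
| "type_sem (TTensor C D) = {VPair x y | x y. x \<in> type_sem C \<and> y \<in> type_sem D}"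
| "type_sem (TPar C D) = {VPair x y | x y. x \<in> type_sem C \<and> y \<in> type_sem D}"
| "type_sem (TBang C) = {Bag m | m. set_mset m \<subseteq> type_sem C}"
| "type_sem (TQuest C) = {Bag m | m. set_mset m \<subseteq> type_sem C}"

text \<open>
  The structure of which an experiment is an experiment is an index of the predicate
  \<open>is_experiment\<close> rather than a component of the experiment.
\<close>

datatype 'p ps_experiment =
  Exp (port_val: "'p \<Rightarrow> val") (box_exps: "'p \<Rightarrow> 'p ps_experiment multiset")

definition box_contribution :: "'p cps \<Rightarrow> 'p \<Rightarrow> 'p ps_experiment \<Rightarrow> 'p \<Rightarrow> val multiset" where
  "box_contribution R a e' p =
     (\<Sum>q\<in>{q \<in> bullet_conclusions (box_at R a). box_map R a q = p}. {#port_val e' q#}) +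
     (\<Sum>q\<in>{q \<in> circ_ports (box_at R a). box_map R a q = p}. elems (port_val e' q))"

inductive is_experiment :: "'p cps \<Rightarrow> 'p ps_experiment \<Rightarrow> bool" where
  "\<lbrakk> \<And>p. p \<in> ports (ground_of R) \<Longrightarrow> port_val e p \<in> type_sem (ptype (ground_of R) p);
     \<And>a e'. a \<in> boxes R \<Longrightarrow> e' \<in># box_exps e a \<Longrightarrow> is_experiment (box_at R a) e';
     \<And>p w1 w2. p \<in> ports (ground_of R) \<Longrightarrow> lab (ground_of R) p \<in> {LTensor, LPar} \<Longrightarrow>
       w1 \<in> left_premises (ground_of R) p \<Longrightarrow> w2 \<in> right_premises (ground_of R) p \<Longrightarrow>
       port_val e p = VPair (port_val e w1) (port_val e w2);
     \<And>p. p \<in> ports (ground_of R) \<Longrightarrow> lab (ground_of R) p \<in> {LBang, LQuest, LCirc} \<Longrightarrow>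
       port_val e p =
         Bag ((\<Sum>w\<in>premises_of (ground_of R) p. {#port_val e w#}) +
              (\<Sum>a\<in>boxes R. \<Sum>e'\<in>#box_exps e a. box_contribution R a e' p)) \<rbrakk>
   \<Longrightarrow> is_experiment R e"

definition interp :: "'p cps \<Rightarrow> ('p \<Rightarrow> val) set" where
  "interp R = {restrict (port_val e) (conclusions R) | e. is_experiment R e}"


section \<open>Interpretations do not determine the types of the conclusions\<close>

text \<open>
  As \<open>type_sem TOne = type_sem TBot\<close> (and likewise for tensor and par, and for the two
  exponentials), equality of interpretations only characterises structures whose common
  conclusions carry the same types: a single port labelled \<open>LOne\<close> and a single port labelled
  \<open>LBot\<close> are already indistinguishable. Agreement of the types of the conclusions is in turn
  necessary for \<open>R \<equiv>\<^sub>P\<^sub>S R'\<close>.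
\<close>

lemma ps_equiv_imp_same_types:
  assumes "R \<equiv>\<^sub>P\<^sub>S R'" and "p \<in> conclusions R"
  shows "ptype (ground_of R) p = ptype (ground_of R') p"
proof -
  obtain \<phi> where \<phi>: "is_iso \<phi> R R'" "ground_map \<phi> p = p"
    using assms unfolding ps_equiv_def by blast
  from \<phi>(1) have "ground_iso (ground_map \<phi>) (ground_of R) (ground_of R')"
    by (rule is_iso.cases) blast
  then have "ptype (ground_of R') (ground_map \<phi> p) = ptype (ground_of R) p"
    using assms(2) unfolding ground_iso_def conclusions_def by blast
  then show ?thesis using \<phi>(2) by simp
qed

definition single_port :: "'p \<Rightarrow> label \<Rightarrow> mell_type \<Rightarrow> 'p cps" where
  "single_port p l T =
     CPS \<lparr>wires = {}, ports = {p}, lab = (\<lambda>_. l), tgt = id, lefts = {}, ptype = (\<lambda>_. T)\<rparr>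
       (\<lambda>_. None) (\<lambda>_. id)"

lemma interp_forgets_types:
  fixes p :: 'p
  defines "R \<equiv> single_port p LOne TOne" and "R' \<equiv> single_port p LBot TBot"
  shows "PS R" and "PS R'" and "conclusions R = conclusions R'"
    and "interp R = interp R'" and "\<not> R \<equiv>\<^sub>P\<^sub>S R'"
proof -
  note d = R_def R'_def single_port_def boxes_def circ_ports_def conclusions_def
  have "circ_PS 0 R" "circ_PS 0 R'"
    by (rule circ_PS.intros;
        simp add: d ground_structure_def premises_of_def box_conditions_def)+
  then show "PS R" "PS R'" by (auto simp: PS_def d)
  show c: "conclusions R = conclusions R'" by (simp add: d)
  have "is_experiment R e \<longleftrightarrow> is_experiment R' e" for e
    by (simp only: is_experiment.simps[of R e] is_experiment.simps[of R' e]) (simp add: d)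
  then show "interp R = interp R'" by (simp add: interp_def c)
  show "\<not> R \<equiv>\<^sub>P\<^sub>S R'"
    using ps_equiv_imp_same_types[of R R' p] by (auto simp: d)
qed

end

theory Submission
  imports Defs "HOL-Library.Countable" "HOL-Computational_Algebra.Primes"
begin

text \<open>
  Since there are neither axioms nor cuts, a point of \<open>interp R\<close> is the same thing as a finite typed
  forest, obtained from \<open>R\<close> by replacing every box, from the outside inwards, with some number of
  copies of its content. If two structures have the same interpretation, they have such an
  unfolding in common, and it remains to fold it back in a way that only depends on the forest.

  Fix a prime \<open>k\<close> larger than both structures. The number of children of a \<open>!\<close>-node is its number of
  copies times a factor smaller than \<open>k\<close>, so both have the same multiplicity of \<open>k\<close>, the rank of the
  node. Among the unfoldings whose ranks are positive and pairwise distinct, take one with the least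
  number of nodes. Both conditions are visible on the forest; hence the forest is also a minimal
  unfolding of the other structure. Minimality forces every box of rank \<open>j\<close> to have exactly \<open>k ^ j\<close>
  copies, and inner boxes to have larger ranks than the boxes around them.

  Now close the boxes by decreasing rank. When the box of rank \<open>j\<close> is due, its \<open>k ^ j\<close> copies contain
  closed boxes only and are isomorphic, they are attached to the rest only at the nodes with at
  least \<open>k ^ j\<close> children, and the rest has fewer than \<open>k ^ j\<close> nodes. Counting the connected components
  of each isomorphism class modulo \<open>k ^ j\<close> shows that the result of closing the box is
  determined up to isomorphism.
\<close>


subsection \<open>Values of typed forests\<close>

text \<open>The obstacle is that no correctness criterion is imposed: the content of a box may be
  disconnected, and pieces of it may be isomorphic to pieces of its surroundings. The copies of a
  box therefore cannot be located in a forest; only the total number of pieces of each kind can be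
  recovered. The factor in the number of children of a \<open>!\<close>-node counts the conclusions
  of the content that the box map sends to the box itself; it is positive and at most the size of
  the structure. The smallness of the rest is a matter of scales: opening the box of rank
  \<open>j\<close> replaces a content of fewer than \<open>k\<close> nodes by \<open>k ^ j\<close>
  copies of it, so by induction on the rank a bound \<open>k ^ j\<close> becomes
  \<open>k ^ (j + 1)\<close>. Exact powers and ranks that increase inwards cannot be read off a
  forest, whereas a least number of nodes can, because competitors on one side transfer to the
  other. The nodes with very many children are kept fixed pointwise by every isomorphism of pieces;
  otherwise the isomorphisms chosen for the single pieces would not fit together.\<close>

lemma bij_betw_fibres:
  assumes "finite A" "finite B"
    and "\<And>c. card {x \<in> A. f x = c} = card {y \<in> B. g y = c}"
  shows "\<exists>h. bij_betw h A B \<and> (\<forall>x\<in>A. g (h x) = f x)"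
proof -
  have "\<exists>h. bij_betw h {x \<in> A. f x = c} {y \<in> B. g y = c}" for c
    using assms by (intro finite_same_card_bij) auto
  then obtain h where h: "\<And>c. bij_betw (h c) {x \<in> A. f x = c} {y \<in> B. g y = c}"
    by metis
  define k where "k x = h (f x) x" for x
  have k: "k x \<in> B \<and> g (k x) = f x" if "x \<in> A" for x
    using bij_betw_apply[OF h[of "f x"], of x] that by (auto simp: k_def)
  have "inj_on k A"
  proof (rule inj_onI)
    fix x y assume xy: "x \<in> A" "y \<in> A" "k x = k y"
    then have "f x = f y" using k by metis
    then show "x = y"
      using xy bij_betw_imp_inj_on[OF h[of "f x"]] by (auto simp: k_def inj_on_def)
  qed
  moreover have "B \<subseteq> k ` A"
  proof
    fix y assume "y \<in> B"
    then have "y \<in> h (g y) ` {x \<in> A. f x = g y}"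
      using bij_betw_imp_surj_on[OF h[of "g y"]] by auto
    then obtain x where "x \<in> A" "f x = g y" "h (g y) x = y" by auto
    then show "y \<in> k ` A" by (auto simp: k_def intro!: image_eqI[of _ _ x])
  qed
  ultimately show ?thesis
    using k by (intro exI[of _ k]) (auto simp: bij_betw_def)
qed

lemma count_image_mset_set:
  assumes "finite A"
  shows "count (image_mset f (mset_set A)) c = card {x \<in> A. f x = c}"
proof -
  have "count (image_mset f (mset_set A)) c = sum (count (mset_set A)) (f -` {c} \<inter> A)"
    using assms by (simp add: count_image_mset)
  also have "\<dots> = sum (\<lambda>_. 1) (f -` {c} \<inter> A)"
    using assms by (intro sum.cong) auto
  also have "\<dots> = card {x \<in> A. f x = c}"
    by (simp add: vimage_def Int_def conj_commute)
  finally show ?thesis .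
qed

lemma image_mset_eq_bij_betw:
  assumes "finite A" "finite B"
    and "image_mset f (mset_set A) = image_mset g (mset_set B)"
  shows "\<exists>h. bij_betw h A B \<and> (\<forall>x\<in>A. g (h x) = f x)"
proof (rule bij_betw_fibres[OF assms(1,2)])
  fix c
  show "card {x \<in> A. f x = c} = card {y \<in> B. g y = c}"
    using assms(3) count_image_mset_set[OF assms(1)] count_image_mset_set[OF assms(2)] by metis
qed

text \<open>The recursion follows the type instead of the forest, so that it asks for no
  well-foundedness of \<open>ch\<close>. On a typed forest it stays in step with the nodes, because
  a child carries exactly the component type at which it is evaluated.\<close>

primrec forest_val :: "('n \<Rightarrow> 'n set) \<Rightarrow> ('n \<Rightarrow> bool) \<Rightarrow> mell_type \<Rightarrow> 'n \<Rightarrow> val" where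
  "forest_val ch lf TOne x = Star"
| "forest_val ch lf TBot x = Star"
| "forest_val ch lf (TTensor C D) x =
     VPair (forest_val ch lf C (THE y. y \<in> ch x \<and> lf y)) (forest_val ch lf D (THE y. y \<in> ch x \<and> \<not> lf y))"
| "forest_val ch lf (TPar C D) x =
     VPair (forest_val ch lf C (THE y. y \<in> ch x \<and> lf y)) (forest_val ch lf D (THE y. y \<in> ch x \<and> \<not> lf y))"
| "forest_val ch lf (TBang C) x = Bag (image_mset (forest_val ch lf C) (mset_set (ch x)))"
| "forest_val ch lf (TQuest C) x = Bag (image_mset (forest_val ch lf C) (mset_set (ch x)))"

lemma forest_val_in_type_sem: "forest_val ch lf C x \<in> type_sem C"
  by (induction C arbitrary: x) auto

text \<open>\<open>par x = Inr r\<close> marks a root and records the name \<open>r\<close> of the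
  exit below it. \<open>grow\<close> takes the place of acyclicity: types shrink from a node to its
  children. Left flags are forced to be false where they have no meaning, so that isomorphisms can
  preserve them everywhere.\<close>

locale typed_forest =
  fixes V :: "'n set" and par :: "'n \<Rightarrow> 'n + 'r" and ty :: "'n \<Rightarrow> mell_type" and lf :: "'n \<Rightarrow> bool"
  assumes fin: "finite V"
    and par_in: "x \<in> V \<Longrightarrow> par x = Inl y \<Longrightarrow> y \<in> V"
    and grow: "x \<in> V \<Longrightarrow> par x = Inl y \<Longrightarrow> size (ty x) < size (ty y)"
    and root_lf: "x \<in> V \<Longrightarrow> par x = Inr r \<Longrightarrow> \<not> lf x"
    and unit_ch: "y \<in> V \<Longrightarrow> ty y \<in> {TOne, TBot} \<Longrightarrow> {x \<in> V. par x = Inl y} = {}"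
    and mult_ch: "y \<in> V \<Longrightarrow> ty y \<in> {TTensor C D, TPar C D} \<Longrightarrow>
      \<exists>l r. {x \<in> V. par x = Inl y} = {l, r} \<and> lf l \<and> \<not> lf r \<and> ty l = C \<and> ty r = D"
    and expo_ch: "y \<in> V \<Longrightarrow> ty y \<in> {TBang C, TQuest C} \<Longrightarrow> x \<in> V \<Longrightarrow> par x = Inl y \<Longrightarrow>
      ty x = C \<and> \<not> lf x"
begin

definition "ch x = {y \<in> V. par y = Inl x}"

definition "nval x = forest_val ch lf (ty x) x"

text \<open>Types grow towards the roots and their sizes are bounded on a finite forest, so the
  distance to the maximal size decreases along \<open>par\<close>.\<close>

lemma top_down_induct [consumes 1, case_names root child]:
  assumes "x \<in> V"
    and root: "\<And>x r. x \<in> V \<Longrightarrow> par x = Inr r \<Longrightarrow> P x"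
    and child: "\<And>x y. x \<in> V \<Longrightarrow> par x = Inl y \<Longrightarrow> P y \<Longrightarrow> P x"
  shows "P x"
  using assms(1)
proof (induction "Max ((size \<circ> ty) ` V) - size (ty x)" arbitrary: x rule: less_induct)
  case less
  show ?case
  proof (cases "par x")
    case (Inl y)
    then have y: "y \<in> V" "size (ty x) < size (ty y)" using par_in grow less.prems by auto
    moreover have "size (ty y) \<le> Max ((size \<circ> ty) ` V)" using y fin by auto
    ultimately show ?thesis using child[OF less.prems Inl] less.hyps[of y] by auto
  qed (use root less.prems in auto)
qed

end

lemma (in typed_forest) forest_val_mult:
  assumes "y \<in> V" "ty y \<in> {TTensor C D, TPar C D}" "ch y = {l, r}" "lf l" "\<not> lf r"
    "ty l = C" "ty r = D"
  shows "nval y = VPair (nval l) (nval r)"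
proof -
  have "(THE z. z \<in> ch y \<and> lf z) = l" "(THE z. z \<in> ch y \<and> \<not> lf z) = r"
    using assms by (auto intro!: the_equality)
  then show ?thesis using assms by (auto simp: nval_def)
qed

lemma (in typed_forest) forest_val_expo:
  assumes "y \<in> V" "ty y \<in> {TBang C, TQuest C}"
  shows "nval y = Bag (image_mset nval (mset_set (ch y)))"
proof -
  have "ty x = C" if "x \<in> ch y" for x using expo_ch[OF assms] that by (auto simp: ch_def)
  moreover have "finite (ch y)" using fin by (auto simp: ch_def)
  ultimately have "image_mset nval (mset_set (ch y)) = image_mset (forest_val ch lf C) (mset_set (ch y))"
    by (intro image_mset_cong) (auto simp: nval_def)
  then show ?thesis using assms by (auto simp: nval_def)
qed

text \<open>Values are compared at the roots only; all deeper agreement is derived from there. Root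
  names identify the roots on each side.\<close>

locale two_typed_forests = A: typed_forest V par ty lf + A': typed_forest V' par' ty' lf'
  for V :: "'n set" and par :: "'n \<Rightarrow> 'n + 'r" and ty lf
  and V' :: "'m set" and par' :: "'m \<Rightarrow> 'm + 'r" and ty' lf' +
  assumes roots: "x \<in> V \<Longrightarrow> par x = Inr r \<Longrightarrow>
      \<exists>x'\<in>V'. par' x' = Inr r \<and> ty' x' = ty x \<and> A'.nval x' = A.nval x"
    and roots': "x' \<in> V' \<Longrightarrow> par' x' = Inr r \<Longrightarrow> \<exists>x\<in>V. par x = Inr r"
    and root_inj: "x \<in> V \<Longrightarrow> y \<in> V \<Longrightarrow> par x = Inr r \<Longrightarrow> par y = Inr r \<Longrightarrow> x = y"
    and root_inj': "x' \<in> V' \<Longrightarrow> y' \<in> V' \<Longrightarrow> par' x' = Inr r \<Longrightarrow> par' y' = Inr r \<Longrightarrow> x' = y'"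
begin

text \<open>Type and flag are included because values forget them: the two units share the value
  \<open>Star\<close>, and likewise the two multiplicatives and the two exponentials have the same
  values.\<close>

definition match :: "'n \<Rightarrow> 'm \<Rightarrow> bool" where
  "match x x' \<longleftrightarrow> x \<in> V \<and> x' \<in> V' \<and> ty' x' = ty x \<and> lf' x' = lf x \<and> A'.nval x' = A.nval x"

text \<open>Equal values have equal components. At an exponential this is only an equality of
  multisets, so the bijection involves a choice among children of equal value, and the resulting
  isomorphism is not canonical.\<close>

lemma children_bij:
  assumes "match x x'"
  shows "\<exists>h. bij_betw h (A.ch x) (A'.ch x') \<and> (\<forall>y\<in>A.ch x. match y (h y))"
proof -
  have x: "x \<in> V" "x' \<in> V'" "ty' x' = ty x" "A'.nval x' = A.nval x"
    using assms by (auto simp: match_def)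
  have fin: "finite (A.ch x)" "finite (A'.ch x')"
    using A.fin A'.fin by (auto simp: A.ch_def A'.ch_def)
  have mult: ?thesis if t: "ty x \<in> {TTensor C D, TPar C D}" for C D
  proof -
    have t': "ty' x' \<in> {TTensor C D, TPar C D}" using t x(3) by simp
    obtain l r where lr: "A.ch x = {l, r}" "lf l" "\<not> lf r" "ty l = C" "ty r = D"
      using A.mult_ch[OF x(1) t] by (auto simp: A.ch_def)
    obtain l' r' where lr': "A'.ch x' = {l', r'}" "lf' l'" "\<not> lf' r'" "ty' l' = C" "ty' r' = D"
      using A'.mult_ch[OF x(2) t'] by (auto simp: A'.ch_def)
    have ne: "l \<noteq> r" "l' \<noteq> r'" using lr lr' by auto
    have "A.nval l = A'.nval l'" "A.nval r = A'.nval r'"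
      using x(4) A.forest_val_mult[OF x(1) t lr] A'.forest_val_mult[OF x(2) t' lr'] by auto
    moreover have "l \<in> V" "r \<in> V" "l' \<in> V'" "r' \<in> V'" using lr(1) lr'(1) by (auto simp: A.ch_def A'.ch_def)
    ultimately show ?thesis
      using ne lr lr' by (intro exI[of _ "\<lambda>z. if z = l then l' else r'"]) (auto simp: bij_betw_def inj_on_def match_def)
  qed
  have expo: ?thesis if t: "ty x \<in> {TBang C, TQuest C}" for C
  proof -
    have t': "ty' x' \<in> {TBang C, TQuest C}" using t x(3) by simp
    have "image_mset A.nval (mset_set (A.ch x)) = image_mset A'.nval (mset_set (A'.ch x'))"
      using x(4) A.forest_val_expo[OF x(1) t] A'.forest_val_expo[OF x(2) t'] by simp
    from image_mset_eq_bij_betw[OF fin this] obtain h where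
      h: "bij_betw h (A.ch x) (A'.ch x')" "\<forall>y\<in>A.ch x. A'.nval (h y) = A.nval y" by blast
    have "match y (h y)" if y: "y \<in> A.ch x" for y
      using A.expo_ch[OF x(1) t, of y] A'.expo_ch[OF x(2) t', of "h y"] y h(2) bij_betw_apply[OF h(1) y]
      by (simp add: match_def A.ch_def A'.ch_def)
    then show ?thesis using h(1) by auto
  qed
  have unit: ?thesis if t: "ty x \<in> {TOne, TBot}"
  proof -
    have "A.ch x = {}" "A'.ch x' = {}"
      using A.unit_ch[OF x(1) t] A'.unit_ch[of x'] x t by (auto simp: A.ch_def A'.ch_def)
    then show ?thesis by (auto simp: bij_betw_def)
  qed
  show ?thesis using mult expo unit by (cases "ty x") simp_all
qed

definition child_map :: "'n \<Rightarrow> 'm \<Rightarrow> 'n \<Rightarrow> 'm" where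
  "child_map x x' = (SOME h. bij_betw h (A.ch x) (A'.ch x') \<and> (\<forall>y\<in>A.ch x. match y (h y)))"

lemma child_map:
  assumes "match x x'"
  shows "bij_betw (child_map x x') (A.ch x) (A'.ch x')"
    and "y \<in> A.ch x \<Longrightarrow> match y (child_map x x' y)"
  using someI_ex[OF children_bij[OF assms]] by (auto simp: child_map_def)

text \<open>The bijection is built from the roots towards the leaves as a relation, since the images
  of the children depend on the image of their parent. The lemmas that follow show that this
  relation is the graph of a bijection.\<close>

inductive corr :: "'n \<Rightarrow> 'm \<Rightarrow> bool" where
  corr_root: "x \<in> V \<Longrightarrow> x' \<in> V' \<Longrightarrow> par x = Inr r \<Longrightarrow> par' x' = Inr r \<Longrightarrow> corr x x'"
| corr_child: "corr x x' \<Longrightarrow> y \<in> V \<Longrightarrow> par y = Inl x \<Longrightarrow> corr y (child_map x x' y)"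

lemma corr_match: "corr x x' \<Longrightarrow> match x x'"
proof (induction rule: corr.induct)
  case (corr_root x x' r)
  then show ?case
    using roots[of x r] root_inj'[of x' _ r] A.root_lf[of x r] A'.root_lf[of x' r] unfolding match_def by metis
next
  case (corr_child x x' y)
  then show ?case by (intro child_map(2)) (auto simp: A.ch_def)
qed

lemma corr_child_par:
  assumes "corr x x'" "y \<in> V" "par y = Inl x"
  shows "child_map x x' y \<in> V' \<and> par' (child_map x x' y) = Inl x'"
  using bij_betw_apply[OF child_map(1)[OF corr_match[OF assms(1)]], of y] assms(2,3)
  by (auto simp: A.ch_def A'.ch_def)

lemma corr_fun: "corr x x' \<Longrightarrow> corr x x'' \<Longrightarrow> x'' = x'"
proof (induction arbitrary: x'' rule: corr.induct)
  case (corr_root x x' r)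
  note r = corr_root.hyps
  from corr_root.prems show ?case
  proof cases
    case (corr_root s)
    then show ?thesis using r root_inj'[of x'' x' r] by simp
  qed (use r in simp)
next
  case (corr_child x x' y)
  note IH = corr_child.IH and r = corr_child.hyps
  from corr_child.prems show ?case
  proof cases
    case (corr_child z z')
    then show ?thesis using r IH[of z'] by simp
  qed (use r in simp)
qed

text \<open>Two sources of one node have parents with a common image, and these coincide by
  induction; then the injectivity of the child map at this parent decides.\<close>

lemma corr_inj: "corr x x' \<Longrightarrow> corr y x' \<Longrightarrow> y = x"
proof (induction arbitrary: y rule: corr.induct)
  case (corr_root x x' r)
  note r = corr_root.hyps
  from corr_root.prems show ?case
  proof cases
    case (corr_root s)
    then have "s = r" using r by simp
    then show ?thesis using root_inj[of y x r] corr_root r by simp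
  next
    case (corr_child z z')
    then show ?thesis using corr_child_par[of z z' y] r by simp
  qed
next
  case (corr_child x x' z)
  note IH = corr_child.IH and r = corr_child.hyps
  have par: "par' (child_map x x' z) = Inl x'" using r corr_child_par by blast
  from corr_child.prems show ?case
  proof cases
    case (corr_child w w')
    have "w' = x'" using corr_child_par[OF corr_child(2-4)] par corr_child(1) by simp
    then have w: "w = x" using corr_child IH by simp
    have "inj_on (child_map x x') (A.ch x)"
      using child_map(1)[OF corr_match[OF r(1)]] by (simp add: bij_betw_def)
    moreover have "y \<in> A.ch x" "z \<in> A.ch x" using corr_child w r by (auto simp: A.ch_def)
    ultimately show ?thesis using corr_child(1) w \<open>w' = x'\<close> by (simp add: inj_on_def)
  qed (use par in simp)
qed

lemma corr_total: "x \<in> V \<Longrightarrow> \<exists>x'. corr x x'"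
proof (induction x rule: A.top_down_induct)
  case (root x r)
  then obtain x' where "x' \<in> V'" "par' x' = Inr r" using roots[of x r] by auto
  then have "corr x x'" using corr_root[of x x' r] root by simp
  then show ?case ..
next
  case (child x y)
  then obtain y' where "corr y y'" by auto
  then have "corr x (child_map y y' x)" using corr_child[of y y' x] child by simp
  then show ?case ..
qed

lemma corr_surj: "x' \<in> V' \<Longrightarrow> \<exists>x. corr x x'"
proof (induction x' rule: A'.top_down_induct)
  case (root x' r)
  then obtain x where "x \<in> V" "par x = Inr r" using roots'[of x' r] by auto
  then have "corr x x'" using corr_root[of x x' r] root by simp
  then show ?case ..
next
  case (child x' y')
  then obtain y where y: "corr y y'" by auto
  have "x' \<in> A'.ch y'" using child by (auto simp: A'.ch_def)
  then have "x' \<in> child_map y y' ` A.ch y"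
    using bij_betw_imp_surj_on[OF child_map(1)[OF corr_match[OF y]]] by simp
  then obtain x where x: "x \<in> A.ch y" "child_map y y' x = x'" by auto
  then have "corr x x'" using corr_child[OF y, of x] by (auto simp: A.ch_def)
  then show ?case ..
qed

theorem forest_iso:
  "\<exists>h. bij_betw h V V' \<and> (\<forall>x\<in>V. ty' (h x) = ty x \<and> lf' (h x) = lf x \<and> par' (h x) = map_sum h id (par x))"
proof -
  define h where "h x = (THE x'. corr x x')" for x
  have h: "corr x (h x)" if "x \<in> V" for x
  proof -
    from corr_total[OF that] obtain x' where "corr x x'" ..
    then show ?thesis unfolding h_def by (rule theI) (rule corr_fun[OF \<open>corr x x'\<close>])
  qed
  have "inj_on h V"
  proof (rule inj_onI)
    fix x y assume "x \<in> V" "y \<in> V" "h x = h y"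
    then show "x = y" using corr_inj[of y "h x" x] h[of x] h[of y] by simp
  qed
  moreover have m: "match x (h x)" if "x \<in> V" for x using corr_match[OF h[OF that]] .
  moreover have "h ` V \<subseteq> V'" using m by (auto simp: match_def)
  moreover have "V' \<subseteq> h ` V"
  proof
    fix x' assume "x' \<in> V'"
    from corr_surj[OF this] obtain x where x: "corr x x'" ..
    then have "x \<in> V" using corr_match[OF x] by (simp add: match_def)
    then have "h x = x'" using h[of x] corr_fun[OF x] by simp
    then show "x' \<in> h ` V" using \<open>x \<in> V\<close> by blast
  qed
  moreover have "par' (h x) = map_sum h id (par x)" if "x \<in> V" for x
    using h[OF that]
  proof cases
    case (corr_root r)
    then show ?thesis by simp
  next
    case (corr_child y y')
    then have "y \<in> V" using corr_match[of y y'] by (simp add: match_def)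
    then have "y' = h y" using h[of y] corr_fun[of y "h y" y'] corr_child by simp
    then show ?thesis using corr_child corr_child_par[of y y' x] by simp
  qed
  ultimately have "bij_betw h V V' \<and> (\<forall>x\<in>V. ty' (h x) = ty x \<and> lf' (h x) = lf x \<and> par' (h x) = map_sum h id (par x))"
    by (simp add: bij_betw_def match_def subset_antisym)
  then show ?thesis by (rule exI[of _ h])
qed

end


subsection \<open>Cancelling isomorphic copies\<close>

text \<open>\<open>E\<close> is a family of binary relations indexed by \<open>'e\<close>, and
  \<open>B\<close> is the boundary along which pieces are glued. The pieces are the connected
  components that remain after the removal of \<open>B\<close>.\<close>

locale gluing =
  fixes V :: "'n set" and E :: "'e \<Rightarrow> 'n \<Rightarrow> 'n \<Rightarrow> bool" and L :: "'n \<Rightarrow> 'l" and B :: "'n set"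
  assumes fin: "finite V" and B_sub: "B \<subseteq> V"
begin

definition adj :: "('n \<times> 'n) set" where
  "adj = {(x, y). x \<in> V - B \<and> y \<in> V - B \<and> (\<exists>e. E e x y \<or> E e y x)}"

definition comp :: "'n \<Rightarrow> 'n set" where
  "comp x = adj\<^sup>* `` {x}"

definition comps :: "'n set set" where
  "comps = comp ` (V - B)"

text \<open>Edges to the boundary are compared element by element, as if every member of
  \<open>B\<close> had a name of its own. This is what lets isomorphisms of different components be
  joined to one map that is the identity on \<open>B\<close>.\<close>

definition rel_iso :: "'n set \<Rightarrow> 'n set \<Rightarrow> ('n \<Rightarrow> 'n) \<Rightarrow> bool" where
  "rel_iso X Y g \<longleftrightarrow> bij_betw g X Y \<and> (\<forall>x\<in>X. L (g x) = L x) \<and>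
     (\<forall>e. \<forall>x\<in>X. \<forall>y\<in>X. E e (g x) (g y) = E e x y) \<and>
     (\<forall>e. \<forall>x\<in>X. \<forall>b\<in>B. E e (g x) b = E e x b \<and> E e b (g x) = E e b x)"

lemma rel_isoI:
  assumes "bij_betw g X Y" "\<And>x. x \<in> X \<Longrightarrow> L (g x) = L x"
    and "\<And>e x y. x \<in> X \<Longrightarrow> y \<in> X \<Longrightarrow> E e (g x) (g y) = E e x y"
    and "\<And>e x b. x \<in> X \<Longrightarrow> b \<in> B \<Longrightarrow> E e (g x) b = E e x b"
    and "\<And>e x b. x \<in> X \<Longrightarrow> b \<in> B \<Longrightarrow> E e b (g x) = E e b x"
  shows "rel_iso X Y g"
  using assms by (simp add: rel_iso_def)

lemma rel_isoD:
  assumes "rel_iso X Y g"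
  shows "bij_betw g X Y" and "x \<in> X \<Longrightarrow> g x \<in> Y" and "x \<in> X \<Longrightarrow> L (g x) = L x"
    and "x \<in> X \<Longrightarrow> y \<in> X \<Longrightarrow> E e (g x) (g y) = E e x y"
    and "x \<in> X \<Longrightarrow> b \<in> B \<Longrightarrow> E e (g x) b = E e x b"
    and "x \<in> X \<Longrightarrow> b \<in> B \<Longrightarrow> E e b (g x) = E e b x"
  using assms bij_betw_apply[of g X Y x] by (auto simp add: rel_iso_def)

lemma rel_iso_id: "rel_iso X X id"
  by (simp add: rel_iso_def)

lemma rel_iso_comp:
  assumes "rel_iso X Y g" "rel_iso Y Z h" shows "rel_iso X Z (h \<circ> g)"
  by (rule rel_isoI)
    (simp_all add: rel_isoD[OF assms(1)] rel_isoD[OF assms(2)] bij_betw_trans[OF rel_isoD(1) rel_isoD(1), OF assms])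

lemma rel_iso_inv:
  assumes "rel_iso X Y g" shows "rel_iso Y X (inv_into X g)"
proof (rule rel_isoI)
  note g = rel_isoD[OF assms]
  have *: "g (inv_into X g y) = y" "inv_into X g y \<in> X" if "y \<in> Y" for y
    using bij_betw_inv_into_right[OF g(1) that] bij_betw_apply[OF bij_betw_inv_into[OF g(1)] that] by auto
  show "bij_betw (inv_into X g) Y X" using g(1) by (rule bij_betw_inv_into)
  show "L (inv_into X g x) = L x" if "x \<in> Y" for x
    using g(3)[OF *(2)[OF that]] *(1)[OF that] by simp
  show "E e (inv_into X g x) (inv_into X g y) = E e x y" if "x \<in> Y" "y \<in> Y" for e x y
    using g(4)[OF *(2)[OF that(1)] *(2)[OF that(2)]] *(1)[OF that(1)] *(1)[OF that(2)] by simp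
  show "E e (inv_into X g x) b = E e x b" if "x \<in> Y" "b \<in> B" for e x b
    using g(5)[OF *(2)[OF that(1)] that(2)] *(1)[OF that(1)] by simp
  show "E e b (inv_into X g x) = E e b x" if "x \<in> Y" "b \<in> B" for e x b
    using g(6)[OF *(2)[OF that(1)] that(2)] *(1)[OF that(1)] by simp
qed

lemma rel_iso_restrict:
  assumes "rel_iso X Y g" "X' \<subseteq> X" shows "rel_iso X' (g ` X') g"
proof (rule rel_isoI)
  show "bij_betw g X' (g ` X')"
    using bij_betw_subset[OF rel_isoD(1)[OF assms(1)] assms(2)] by blast
qed (use assms(2) in \<open>simp_all add: rel_isoD[OF assms(1)] subsetD\<close>)

text \<open>Turns isomorphism into an equality, so that components can be counted by class.\<close>

definition iso_class :: "'n set \<Rightarrow> 'n set set" where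
  "iso_class X = {Y. \<exists>g. rel_iso X Y g}"

lemma iso_class_eq_iff: "iso_class X = iso_class Y \<longleftrightarrow> (\<exists>g. rel_iso X Y g)"
proof
  assume "iso_class X = iso_class Y"
  then have "Y \<in> iso_class X" using rel_iso_id unfolding iso_class_def by blast
  then show "\<exists>g. rel_iso X Y g" by (simp add: iso_class_def)
next
  assume "\<exists>g. rel_iso X Y g"
  then obtain g where "rel_iso X Y g" by blast
  then show "iso_class X = iso_class Y"
    unfolding iso_class_def
    using rel_iso_comp[of Y X _ _] rel_iso_comp[of X Y g] rel_iso_inv[of X Y g] by blast
qed

lemma sym_adj: "sym adj" by (auto simp: adj_def sym_def)

lemma comp_eq: "y \<in> comp x \<Longrightarrow> comp y = comp x"
  using symD[OF sym_rtrancl[OF sym_adj], of x y] unfolding comp_def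
  by (auto intro: rtrancl_trans[of y x] rtrancl_trans[of x y])

lemma self_in_comp: "x \<in> comp x" by (simp add: comp_def)

lemma comp_closed:
  assumes "x \<in> S" "S \<subseteq> V - B" "\<And>y z. y \<in> S \<Longrightarrow> (y, z) \<in> adj \<Longrightarrow> z \<in> S"
  shows "comp x \<subseteq> S"
proof
  fix y assume "y \<in> comp x"
  then have "(x, y) \<in> adj\<^sup>*" by (simp add: comp_def)
  then show "y \<in> S" by induction (use assms in auto)
qed

lemma comp_sub: "x \<in> V - B \<Longrightarrow> comp x \<subseteq> V - B"
  by (rule comp_closed) (auto simp: adj_def)

lemma comps_sub: "X \<in> comps \<Longrightarrow> X \<subseteq> V - B"
  using comp_sub by (auto simp: comps_def)

lemma comps_disjoint: "X \<in> comps \<Longrightarrow> Y \<in> comps \<Longrightarrow> x \<in> X \<Longrightarrow> x \<in> Y \<Longrightarrow> X = Y"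
  unfolding comps_def using comp_eq[of x] by auto

lemma comps_nonempty: "X \<in> comps \<Longrightarrow> X \<noteq> {}"
  using self_in_comp by (auto simp: comps_def)

lemma finite_comps: "finite comps" using fin by (simp add: comps_def)

lemma comp_image:
  assumes g: "rel_iso S S' g" and S: "S \<subseteq> V - B" "S' \<subseteq> V - B"
    and cl: "\<And>y z. y \<in> S \<Longrightarrow> (y, z) \<in> adj \<Longrightarrow> z \<in> S" 
    and x: "x \<in> S"
  shows "g ` comp x \<subseteq> comp (g x)"
proof
  fix y assume "y \<in> g ` comp x"
  then obtain z where z: "y = g z" "(x, z) \<in> adj\<^sup>*" by (auto simp: comp_def)
  from z(2) have "z \<in> S \<and> (g x, g z) \<in> adj\<^sup>*"
  proof (induction)
    case (step u w)
    then have u: "u \<in> S" "w \<in> S" "(g x, g u) \<in> adj\<^sup>*" using cl by auto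
    moreover have "(g u, g w) \<in> adj"
      using u step.hyps(2) S(2) rel_isoD(2)[OF g, of u] rel_isoD(2)[OF g, of w] rel_isoD(4)[OF g]
      by (auto simp: adj_def)
    ultimately show ?case by auto
  qed (use x in auto)
  then show "y \<in> comp (g x)" using z by (simp add: comp_def)
qed

text \<open>A relative isomorphism preserves adjacency, so it maps a component into a component; the
  converse inclusion is the same argument for the inverse map.\<close>

lemma comp_image_eq:
  assumes g: "rel_iso S S' g" and S: "S \<subseteq> V - B" "S' \<subseteq> V - B"
    and cl: "\<And>y z. y \<in> S \<Longrightarrow> (y, z) \<in> adj \<Longrightarrow> z \<in> S" 
    and cl': "\<And>y z. y \<in> S' \<Longrightarrow> (y, z) \<in> adj \<Longrightarrow> z \<in> S'"
    and x: "x \<in> S"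
  shows "g ` comp x = comp (g x)"
proof
  show "g ` comp x \<subseteq> comp (g x)" using assms by (intro comp_image)
  have bij: "bij_betw g S S'" using g by (simp add: rel_iso_def)
  let ?h = "inv_into S g"
  have gx: "g x \<in> S'" using bij x by (rule bij_betw_apply)
  have "?h ` comp (g x) \<subseteq> comp (?h (g x))"
    by (rule comp_image[OF rel_iso_inv[OF g] S(2,1) cl' gx])
  then have h: "?h ` comp (g x) \<subseteq> comp x"
    using bij_betw_inv_into_left[OF bij x] by simp
  have "comp (g x) \<subseteq> S'" by (rule comp_closed[OF gx S(2)]) (rule cl')
  then have "y = g (?h y)" if "y \<in> comp (g x)" for y
    using bij_betw_inv_into_right[OF bij] that by auto
  then show "comp (g x) \<subseteq> g ` comp x" using h by blast
qed

text \<open>\<open>G\<close> is the rest, boundary included, and \<open>C 0\<close>, ...,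
  \<open>C (n - 1)\<close> are the copies, which touch nothing but themselves and the boundary. The
  bound \<open>card G < n\<close> turns the share of the rest into a remainder modulo
  \<open>n\<close>.\<close>

definition decomp :: "nat \<Rightarrow> 'n set \<Rightarrow> (nat \<Rightarrow> 'n set) \<Rightarrow> bool" where
  "decomp n G C \<longleftrightarrow> B \<subseteq> G \<and> V = G \<union> (\<Union>i<n. C i) \<and> (\<forall>i<n. G \<inter> C i = {}) \<and>
     (\<forall>i<n. \<forall>j<n. i \<noteq> j \<longrightarrow> C i \<inter> C j = {}) \<and> card G < n \<and>
     (\<forall>i<n. \<forall>e. \<forall>x\<in>C i. \<forall>y\<in>V. E e x y \<or> E e y x \<longrightarrow> y \<in> C i \<union> B) \<and>
     (\<forall>i<n. \<exists>g. rel_iso (C 0) (C i) g)"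

lemma add_mult_less_cancel:
  fixes a b c d n :: nat
  assumes "a + n * c = b + n * d" "a < n" "b < n"
  shows "a = b" "c = d"
proof -
  have "(a + n * c) mod n = (b + n * d) mod n" using assms(1) by simp
  then show "a = b" using assms(2,3) by simp
  then show "c = d" using assms by simp
qed

lemma decompD:
  assumes "decomp n G C"
  shows "B \<subseteq> G" and "V = G \<union> (\<Union>i<n. C i)" and "i < n \<Longrightarrow> G \<inter> C i = {}"
    and "i < n \<Longrightarrow> j < n \<Longrightarrow> i \<noteq> j \<Longrightarrow> C i \<inter> C j = {}"
    and "i < n \<Longrightarrow> x \<in> C i \<Longrightarrow> y \<in> V \<Longrightarrow> E e x y \<or> E e y x \<Longrightarrow> y \<in> C i \<union> B"
    and "i < n \<Longrightarrow> \<exists>g. rel_iso (C 0) (C i) g" and "card G < n"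
  using assms unfolding decomp_def by (elim conjE; blast)+

lemma decomp_copy_sub: "decomp n G C \<Longrightarrow> i < n \<Longrightarrow> C i \<subseteq> V - B"
  using decompD(1)[of n G C] decompD(2)[of n G C] decompD(3)[of n G C i] by blast

lemma decomp_copy_adj:
  assumes "decomp n G C" "i < n" "y \<in> C i" "(y, z) \<in> adj"
  shows "z \<in> C i"
proof -
  obtain e where "z \<in> V - B" "E e y z \<or> E e z y" using assms(4) by (auto simp: adj_def)
  then show ?thesis using decompD(5)[OF assms(1-3), of z e] by blast
qed

lemma decomp_rest_adj:
  assumes "decomp n G C" "y \<in> G - B" "(y, z) \<in> adj"
  shows "z \<in> G - B"
proof (rule ccontr)
  assume "z \<notin> G - B"
  moreover have "z \<in> V - B" using assms(3) by (simp add: adj_def)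
  ultimately obtain i where i: "i < n" "z \<in> C i" using decompD(2)[OF assms(1)] by blast
  then have "y \<in> C i" using decomp_copy_adj[OF assms(1) i] symD[OF sym_adj assms(3)] by blast
  then show False using decompD(3)[OF assms(1) i(1)] assms(2) by blast
qed

lemma decomp_comp_rest:
  assumes "decomp n G C" "x \<in> G - B" shows "comp x \<subseteq> G - B"
  using assms(2)
proof (rule comp_closed)
  show "G - B \<subseteq> V - B" using decompD(2)[OF assms(1)] by blast
qed (rule decomp_rest_adj[OF assms(1)])

lemma decomp_comp_copy:
  assumes "decomp n G C" "i < n" "x \<in> C i" shows "comp x \<subseteq> C i"
  by (rule comp_closed[OF assms(3) decomp_copy_sub[OF assms(1,2)] decomp_copy_adj[OF assms(1,2)]])

text \<open>No component meets two copies, or a copy and the rest, because the only edges leaving a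
  copy lead into \<open>B\<close>, which is removed. The copies contribute equally as they are
  isomorphic relative to \<open>B\<close>. The components inside \<open>G\<close> are disjoint and
  nonempty, so there are fewer than \<open>n\<close> of them.\<close>

lemma decomp_counts:
  assumes D: "decomp n G C"
  shows "card {X \<in> comps. iso_class X = c}
    = card {X \<in> comps. X \<subseteq> G \<and> iso_class X = c} + n * card {X \<in> comps. X \<subseteq> C 0 \<and> iso_class X = c}"
    and "card {X \<in> comps. X \<subseteq> G \<and> iso_class X = c} < n"
proof -
  note V = decompD(2)[OF D] and BG = decompD(1)[OF D] and GC = decompD(3)[OF D]
    and CC = decompD(4)[OF D] and iso = decompD(6)[OF D] and card = decompD(7)[OF D]
    and CV = decomp_copy_sub[OF D] and Ccl = decomp_copy_adj[OF D]
  have cover: "X \<subseteq> G \<or> (\<exists>i<n. X \<subseteq> C i)" if X: "X \<in> comps" for X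
  proof -
    obtain x where x: "X = comp x" "x \<in> V - B" using X by (auto simp: comps_def)
    show ?thesis
    proof (cases "x \<in> G")
      case True
      then show ?thesis using x decomp_comp_rest[OF D, of x] by blast
    next
      case False
      then obtain i where "i < n" "x \<in> C i" using x V by blast
      then show ?thesis using x decomp_comp_copy[OF D] by blast
    qed
  qed
  define K where "K i = {X \<in> comps. X \<subseteq> C i \<and> iso_class X = c}" for i
  define KG where "KG = {X \<in> comps. X \<subseteq> G \<and> iso_class X = c}"
  have finK: "finite (K i)" "finite KG" for i using finite_comps by (auto simp: K_def KG_def)
  have eq: "{X \<in> comps. iso_class X = c} = KG \<union> (\<Union>i<n. K i)"
    using cover by (auto simp: K_def KG_def)
  have dGK: "KG \<inter> K i = {}" if "i < n" for i
    using GC[OF that] comps_nonempty unfolding K_def KG_def by blast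
  have dKK: "K i \<inter> K j = {}" if "i < n" "j < n" "i \<noteq> j" for i j
    using CC[OF that] comps_nonempty unfolding K_def by blast
  have cardK: "card (K i) = card (K 0)" if i: "i < n" for i
  proof -
    obtain g where g: "rel_iso (C 0) (C i) g" using iso i by blast
    have n0: "0 < n" using i by simp
    have bij: "bij_betw g (C 0) (C i)" using g by (simp add: rel_iso_def)
    have "g ` X \<in> K i" if "X \<in> K 0" for X
    proof -
      have X: "X \<in> comps" "X \<subseteq> C 0" "iso_class X = c" using that by (auto simp: K_def)
      then obtain x where x: "X = comp x" "x \<in> C 0" using self_in_comp by (auto simp: comps_def)
      have "g ` X = comp (g x)"
        unfolding x(1) by (rule comp_image_eq[OF g CV CV Ccl Ccl x(2)]) (use i n0 in auto)
      moreover have "g x \<in> V - B" using bij_betw_apply[OF bij x(2)] CV[OF i] by auto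
      moreover have "iso_class (g ` X) = c"
        using X rel_iso_restrict[OF g X(2)] iso_class_eq_iff by metis
      ultimately show ?thesis using X bij_betw_imp_surj_on[OF bij] unfolding K_def comps_def by blast
    qed
    moreover have "inv_into (C 0) g ` X \<in> K 0" if "X \<in> K i" for X
    proof -
      have g': "rel_iso (C i) (C 0) (inv_into (C 0) g)" by (rule rel_iso_inv[OF g])
      have bij': "bij_betw (inv_into (C 0) g) (C i) (C 0)" using g' by (simp add: rel_iso_def)
      have X: "X \<in> comps" "X \<subseteq> C i" "iso_class X = c" using that by (auto simp: K_def)
      then obtain x where x: "X = comp x" "x \<in> C i" using self_in_comp by (auto simp: comps_def)
      have "inv_into (C 0) g ` X = comp (inv_into (C 0) g x)"
        unfolding x(1) by (rule comp_image_eq[OF g' CV CV Ccl Ccl x(2)]) (use i n0 in auto)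
      moreover have "inv_into (C 0) g x \<in> V - B" using bij_betw_apply[OF bij' x(2)] CV[OF n0] by auto
      moreover have "iso_class (inv_into (C 0) g ` X) = c"
        using X rel_iso_restrict[OF g' X(2)] iso_class_eq_iff by metis
      ultimately show ?thesis using X bij_betw_imp_surj_on[OF bij'] unfolding K_def comps_def by blast
    qed
    moreover have "inv_into (C 0) g ` g ` X = X" if "X \<in> K 0" for X
      using that bij by (auto simp: K_def inv_into_image_cancel bij_betw_def)
    moreover have "g ` inv_into (C 0) g ` X = X" if "X \<in> K i" for X
      using that bij by (auto simp: K_def image_inv_into_cancel bij_betw_def)
    ultimately have "bij_betw (image g) (K 0) (K i)"
      by (intro bij_betw_byWitness[where f' = "image (inv_into (C 0) g)"]) auto
    then show ?thesis by (simp add: bij_betw_same_card)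
  qed
  have "card (\<Union>i<n. K i) = (\<Sum>i<n. card (K i))"
    using dKK finK by (intro card_UN_disjoint) auto
  also have "\<dots> = (\<Sum>i<n. card (K 0))" by (rule sum.cong[OF refl]) (rule cardK, simp)
  also have "\<dots> = n * card (K 0)" by simp
  finally have "card {X \<in> comps. iso_class X = c} = card KG + n * card (K 0)"
    unfolding eq using dGK finK by (subst card_Un_disjoint) auto
  then show "card {X \<in> comps. iso_class X = c}
    = card {X \<in> comps. X \<subseteq> G \<and> iso_class X = c} + n * card {X \<in> comps. X \<subseteq> C 0 \<and> iso_class X = c}"
    by (simp add: KG_def K_def)
  \<comment> \<open>Picking a member of each component injects the components of the rest into
    \<open>G\<close>.\<close>
  have "inj_on (\<lambda>X. SOME x. x \<in> X) KG"
  proof (rule inj_onI)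
    fix X Y assume XY: "X \<in> KG" "Y \<in> KG" "(SOME x. x \<in> X) = (SOME x. x \<in> Y)"
    have "X \<in> comps" "Y \<in> comps" using XY by (auto simp: KG_def)
    moreover from this have "(SOME x. x \<in> X) \<in> X" "(SOME x. x \<in> Y) \<in> Y"
      using comps_nonempty by (simp_all add: some_in_eq)
    ultimately show "X = Y" using XY(3) comps_disjoint[of X Y "SOME x. x \<in> X"] by simp
  qed
  moreover have "(\<lambda>X. SOME x. x \<in> X) ` KG \<subseteq> G"
    using comps_nonempty unfolding KG_def by (auto simp: some_in_eq dest: subsetD)
  moreover have "finite G" using fin V by auto
  ultimately have "card KG \<le> card G" by (rule card_inj_on_le)
  then show "card {X \<in> comps. X \<subseteq> G \<and> iso_class X = c} < n" using card by (simp add: KG_def)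
qed

text \<open>Two decompositions of one set \<open>V\<close> into equally many copies express the same
  component counts, with remainders below \<open>n\<close>; so quotients and remainders agree class
  by class. The map is assembled from isomorphisms of matched components and the identity on
  \<open>B\<close>.\<close>

theorem cancel_copies:
  assumes D: "decomp n G C" and D': "decomp n G' C'"
  shows "\<exists>h. bij_betw h (G \<union> C 0) (G' \<union> C' 0) \<and> h ` G = G' \<and> h ` C 0 = C' 0 \<and> (\<forall>b\<in>B. h b = b) \<and>
    (\<forall>x\<in>G \<union> C 0. L (h x) = L x) \<and> (\<forall>e. \<forall>x\<in>G \<union> C 0. \<forall>y\<in>G \<union> C 0. E e (h x) (h y) = E e x y)"
proof -
  define K where "K S = {X \<in> comps. X \<subseteq> S}" for S
  have finK: "finite (K S)" for S using finite_comps by (simp add: K_def)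
  have "card {X \<in> K G. iso_class X = c} = card {X \<in> K G'. iso_class X = c} \<and>
    card {X \<in> K (C 0). iso_class X = c} = card {X \<in> K (C' 0). iso_class X = c}" for c
  proof -
    let ?g = "card {X \<in> comps. X \<subseteq> G \<and> iso_class X = c}"
    let ?g' = "card {X \<in> comps. X \<subseteq> G' \<and> iso_class X = c}"
    let ?c = "card {X \<in> comps. X \<subseteq> C 0 \<and> iso_class X = c}"
    let ?c' = "card {X \<in> comps. X \<subseteq> C' 0 \<and> iso_class X = c}"
    have "?g + n * ?c = ?g' + n * ?c'" "?g < n" "?g' < n"
      using decomp_counts(1)[OF D, of c] decomp_counts(1)[OF D', of c]
        decomp_counts(2)[OF D, of c] decomp_counts(2)[OF D', of c] by linarith+
    then have "?g = ?g'" "?c = ?c'" by (rule add_mult_less_cancel)+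
    then show ?thesis by (simp add: K_def conj_assoc)
  qed
  then obtain f1 f2 where f1: "bij_betw f1 (K G) (K G')" "\<forall>X\<in>K G. iso_class (f1 X) = iso_class X"
    and f2: "bij_betw f2 (K (C 0)) (K (C' 0))" "\<forall>X\<in>K (C 0). iso_class (f2 X) = iso_class X"
    using bij_betw_fibres[OF finK finK, of G iso_class G' iso_class]
      bij_betw_fibres[OF finK finK, of "C 0" iso_class "C' 0" iso_class] by blast
  have n0: "0 < n" using decompD(7)[OF D] by simp
  have GV: "G \<subseteq> V" "G' \<subseteq> V" using decompD(2)[OF D] decompD(2)[OF D'] by blast+
  have KGC: "K G \<inter> K (C 0) = {}" "K G' \<inter> K (C' 0) = {}"
    using decompD(3)[OF D n0] decompD(3)[OF D' n0] comps_nonempty unfolding K_def by blast+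
  define f where "f X = (if X \<in> K G then f1 X else f2 X)" for X
  have f: "bij_betw f (K G \<union> K (C 0)) (K G' \<union> K (C' 0))"
  proof (rule bij_betw_combine[OF _ _ KGC(2)])
    show "bij_betw f (K G) (K G')"
      using f1(1) by (rule bij_betw_cong[THEN iffD1, rotated]) (simp add: f_def)
    show "bij_betw f (K (C 0)) (K (C' 0))"
      using f2(1) by (rule bij_betw_cong[THEN iffD1, rotated]) (use KGC(1) in \<open>auto simp: f_def\<close>)
  qed
  have fG: "f X \<in> K G'" if "X \<in> K G" for X
    using bij_betw_apply[OF f1(1) that] that by (simp add: f_def)
  have fC: "f X \<in> K (C' 0)" if "X \<in> K (C 0)" for X
    using bij_betw_apply[OF f2(1) that] that KGC(1) by (auto simp: f_def)
  have "iso_class X = iso_class (f X)" if "X \<in> K G \<union> K (C 0)" for X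
    using that f1(2) f2(2) KGC by (auto simp: f_def)
  then have "\<exists>g. rel_iso X (f X) g" if "X \<in> K G \<union> K (C 0)" for X
    using that iso_class_eq_iff[of X "f X"] by simp
  then obtain g where g: "\<And>X. X \<in> K G \<union> K (C 0) \<Longrightarrow> rel_iso X (f X) (g X)" by metis
  define h where "h x = (if x \<in> B then x else g (comp x) x)" for x
  have comp_K: "comp x \<in> K (if x \<in> G then G else C 0)" if "x \<in> G \<union> C 0" "x \<notin> B" for x
  proof (cases "x \<in> G")
    case True
    then show ?thesis
      using that decomp_comp_rest[OF D, of x] GV by (auto simp: K_def comps_def)
  next
    case False
    then show ?thesis
      using that decomp_comp_copy[OF D n0, of x] decomp_copy_sub[OF D n0] by (auto simp: K_def comps_def)
  qed
  have h_iso: "rel_iso (comp x) (f (comp x)) (g (comp x))" if "x \<in> G \<union> C 0" "x \<notin> B" for x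
    using g[of "comp x"] comp_K[OF that] by (auto split: if_splits)
  have h_in: "h x \<in> f (comp x)" if "x \<in> G \<union> C 0" "x \<notin> B" for x
    using h_iso[OF that] self_in_comp[of x] that(2) bij_betw_apply unfolding rel_iso_def h_def by fastforce
  have f_comp: "f (comp x) \<in> comps" if "x \<in> G \<union> C 0" "x \<notin> B" for x
    using comp_K[OF that] fG fC by (auto simp: K_def split: if_splits)
  have hG: "h x \<in> G'" if "x \<in> G" for x
  proof (cases "x \<in> B")
    case False
    then show ?thesis using h_in[of x] comp_K[of x] fG[of "comp x"] that by (auto simp: K_def)
  qed (use decompD(1)[OF D'] in \<open>auto simp: h_def\<close>)
  have C0B: "x \<notin> B" "x \<notin> G" if "x \<in> C 0" for x
    using that decomp_copy_sub[OF D n0] decompD(3)[OF D n0] by blast+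
  have hC: "h x \<in> C' 0" if "x \<in> C 0" for x
    using h_in[of x] comp_K[of x] fC[of "comp x"] that C0B[OF that] by (auto simp: K_def)
  have hB: "h x \<in> B \<longleftrightarrow> x \<in> B" if "x \<in> G \<union> C 0" for x
    using that h_in[of x] f_comp[of x] comps_sub[of "f (comp x)"] by (auto simp: h_def)
  \<comment> \<open>Different components have disjoint images, because \<open>f\<close> is injective
    and its values are components.\<close>
  have same: "comp x = comp y" if "x \<in> G \<union> C 0" "x \<notin> B" "y \<in> G \<union> C 0" "y \<notin> B"
      "z \<in> f (comp x)" "z \<in> f (comp y)" for x y z
  proof -
    have "f (comp x) = f (comp y)" using comps_disjoint[OF f_comp f_comp that(5,6)] that by blast
    moreover have "comp x \<in> K G \<union> K (C 0)" "comp y \<in> K G \<union> K (C 0)"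
      using comp_K[OF that(1,2)] comp_K[OF that(3,4)] by (auto split: if_splits)
    ultimately show ?thesis using f by (auto simp: bij_betw_def inj_on_def)
  qed
  have "inj_on h (G \<union> C 0)"
  proof (rule inj_onI)
    fix x y assume xy: "x \<in> G \<union> C 0" "y \<in> G \<union> C 0" "h x = h y"
    show "x = y"
    proof (cases "x \<in> B")
      case True
      then show ?thesis using xy hB[of x] hB[of y] by (simp add: h_def)
    next
      case False
      then have "y \<notin> B" using xy hB[of x] hB[of y] by simp
      then have "comp x = comp y" using same[of x y "h x"] h_in[of x] h_in[of y] xy False by simp
      moreover have "inj_on (g (comp x)) (comp x)"
        using h_iso[OF xy(1) False] by (simp add: rel_iso_def bij_betw_def)
      ultimately show ?thesis
        using xy(3) False \<open>y \<notin> B\<close> self_in_comp[of x] self_in_comp[of y] by (auto simp: h_def inj_on_def)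
    qed
  qed
  moreover have surj: "\<exists>x\<in>S. h x = z" if S: "S = G \<and> z \<in> G' - B \<or> S = C 0 \<and> z \<in> C' 0" for S z
  proof -
    have S_eq: "comp z \<in> f ` K S"
    proof (cases "S = G \<and> z \<in> G' - B")
      case True
      then have "comp z \<in> K G'"
        using decomp_comp_rest[OF D', of z] GV by (auto simp: K_def comps_def)
      then have "comp z \<in> f1 ` K G" using bij_betw_imp_surj_on[OF f1(1)] by simp
      then obtain X where "X \<in> K G" "f1 X = comp z" by auto
      then show ?thesis using True by (auto simp: f_def intro!: image_eqI[of _ _ X])
    next
      case False
      then have *: "S = C 0" "z \<in> C' 0" using S by auto
      then have "comp z \<in> K (C' 0)"
        using decomp_comp_copy[OF D' n0, of z] decomp_copy_sub[OF D' n0] by (auto simp: K_def comps_def)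
      then have "comp z \<in> f2 ` K (C 0)" using bij_betw_imp_surj_on[OF f2(1)] by simp
      then obtain X where "X \<in> K (C 0)" "f2 X = comp z" by auto
      then show ?thesis using * KGC(1) by (auto simp: f_def intro!: image_eqI[of _ _ X])
    qed
    then obtain X where X: "X \<in> K S" "f X = comp z" by auto
    have "rel_iso X (f X) (g X)" using g[of X] X(1) S by auto
    then have "g X ` X = comp z" using X(2) by (simp add: rel_iso_def bij_betw_def)
    then obtain x where x: "x \<in> X" "g X x = z" using self_in_comp[of z] by (metis imageE)
    moreover have "X = comp x" using X(1) x(1) comp_eq unfolding K_def comps_def by blast
    moreover have "x \<notin> B" using X(1) x(1) comps_sub unfolding K_def by blast
    ultimately show ?thesis using X(1) by (auto simp: h_def K_def intro!: bexI[of _ x])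
  qed
  have imG: "h ` G = G'"
  proof
    show "h ` G \<subseteq> G'" using hG by blast
    show "G' \<subseteq> h ` G"
    proof
      fix z assume z: "z \<in> G'"
      show "z \<in> h ` G"
      proof (cases "z \<in> B")
        case True
        then have "z \<in> G" "h z = z" using decompD(1)[OF D] by (auto simp: h_def)
        then show ?thesis by (metis imageI)
      next
        case False
        then show ?thesis using surj[of G z] z by auto
      qed
    qed
  qed
  have imC: "h ` C 0 = C' 0"
    using hC surj[of "C 0"] by (auto simp: image_iff)
  have hL: "L (h x) = L x" if "x \<in> G \<union> C 0" for x
    using h_iso[OF that] self_in_comp[of x] by (auto simp: h_def rel_iso_def)
  \<comment> \<open>Edges that meet \<open>B\<close> are controlled by \<open>rel_iso\<close> one
    boundary node at a time, edges inside a component by its isomorphism; between different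
    components there are no edges on either side.\<close>
  have hE: "E e (h x) (h y) = E e x y" if xy: "x \<in> G \<union> C 0" "y \<in> G \<union> C 0" for e x y
  proof (cases "x \<in> B \<or> y \<in> B")
    case True
    then show ?thesis
      using h_iso[OF xy(1)] h_iso[OF xy(2)] self_in_comp[of x] self_in_comp[of y]
      by (auto simp: h_def rel_iso_def)
  next
    case False
    show ?thesis
    proof (cases "comp x = comp y")
      case True
      then show ?thesis
        using False h_iso[OF xy(1)] self_in_comp[of x] self_in_comp[of y] by (auto simp: h_def rel_iso_def)
    next
      case comp: False
      have V: "x \<in> V - B" "y \<in> V - B" "h x \<in> V - B" "h y \<in> V - B"
        using False xy GV decomp_copy_sub[OF D n0] h_in[of x] h_in[of y] f_comp[of x] f_comp[of y]
          comps_sub[of "f (comp x)"] comps_sub[of "f (comp y)"] by auto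
      have "\<not> E e x y"
      proof
        assume "E e x y"
        then have "y \<in> comp x" using V by (auto simp: comp_def adj_def)
        then show False using comp comp_eq by blast
      qed
      moreover have "\<not> E e (h x) (h y)"
      proof
        assume "E e (h x) (h y)"
        then have "h y \<in> comp (h x)" using V by (auto simp: comp_def adj_def)
        moreover obtain w where "f (comp x) = comp w" using f_comp[of x] xy False by (auto simp: comps_def)
        then have "comp (h x) = f (comp x)" using h_in[of x] comp_eq[of "h x" w] xy False by simp
        ultimately show False using same[of x y "h y"] h_in[of y] xy False comp by simp
      qed
      ultimately show ?thesis by simp
    qed
  qed
  have "bij_betw h (G \<union> C 0) (G' \<union> C' 0)"
    using \<open>inj_on h (G \<union> C 0)\<close> imG imC by (simp add: bij_betw_def image_Un)
  then show ?thesis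
    using imG imC hL hE by (intro exI[of _ h]) (simp add: h_def)
qed

end


subsection \<open>Unfoldings of proof-structures\<close>

lemma image_mset_as_sum: "finite A \<Longrightarrow> image_mset f (mset_set A) = (\<Sum>x\<in>A. {#f x#})"
  by (induction A rule: finite_induct) auto

text \<open>The value of a node depends only on its descendants. It therefore suffices that children
  sets correspond exactly; the other nodes of the larger forest are invisible.\<close>

lemma typed_forest_embedding:
  assumes "typed_forest V par ty lf" "typed_forest V' par' ty' lf'"
    and inj: "inj g" and V: "g ` V' \<subseteq> V"
    and ch: "\<And>y. y \<in> V' \<Longrightarrow> {x \<in> V. par x = Inl (g y)} = g ` {x \<in> V'. par' x = Inl y}"
    and ty: "\<And>y. y \<in> V' \<Longrightarrow> ty (g y) = ty' y" and lf: "\<And>y. y \<in> V' \<Longrightarrow> lf (g y) = lf' y"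
    and "y \<in> V'"
  shows "typed_forest.nval V par ty lf (g y) = typed_forest.nval V' par' ty' lf' y"
proof -
  interpret A: typed_forest V par ty lf by fact
  interpret A': typed_forest V' par' ty' lf' by fact
  have ch': "A.ch (g y) = g ` A'.ch y" if "y \<in> V'" for y
    using ch[OF that] by (simp add: A.ch_def A'.ch_def)
  have ch_in: "x \<in> V'" if "x \<in> A'.ch y" for x y using that by (simp add: A'.ch_def)
  show ?thesis using \<open>y \<in> V'\<close>
  proof (induction "size (ty' y)" arbitrary: y rule: less_induct)
    case less
    have gy: "g y \<in> V" "ty (g y) = ty' y" using less.prems V ty by auto
    have sm: "size (ty' x) < size (ty' y)" if "x \<in> A'.ch y" for x
      using that A'.grow[of x y] by (simp add: A'.ch_def)
    have IH: "A.nval (g x) = A'.nval x" if "x \<in> A'.ch y" for x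
      using less.hyps[OF sm[OF that] ch_in[OF that]] .
    have mult: "A.nval (g y) = A'.nval y" if t: "ty' y \<in> {TTensor C D, TPar C D}" for C D
    proof -
      obtain l r where lr: "A'.ch y = {l, r}" "lf' l" "\<not> lf' r" "ty' l = C" "ty' r = D"
        using A'.mult_ch[OF less.prems t] by (auto simp: A'.ch_def)
      have "l \<in> V'" "r \<in> V'" using lr(1) ch_in by auto
      then have "A.nval (g y) = VPair (A.nval (g l)) (A.nval (g r))"
        using lr gy t ch'[OF less.prems] lf ty by (intro A.forest_val_mult[of _ C D]) auto
      also have "\<dots> = VPair (A'.nval l) (A'.nval r)" using IH lr(1) by simp
      also have "\<dots> = A'.nval y" using A'.forest_val_mult[OF less.prems t lr] by simp
      finally show ?thesis .
    qed
    have expo: "A.nval (g y) = A'.nval y" if t: "ty' y \<in> {TBang C, TQuest C}" for C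
    proof -
      have "A.nval (g y) = Bag (image_mset A.nval (mset_set (g ` A'.ch y)))"
        using A.forest_val_expo[OF gy(1)] gy(2) t ch'[OF less.prems] by simp
      also have "mset_set (g ` A'.ch y) = image_mset g (mset_set (A'.ch y))"
        using inj by (intro image_mset_mset_set[symmetric] inj_on_subset[OF inj]) auto
      also have "image_mset A.nval (image_mset g (mset_set (A'.ch y))) = image_mset A'.nval (mset_set (A'.ch y))"
        using IH A'.fin by (auto simp: A'.ch_def image_mset.compositionality intro!: image_mset_cong)
      also have "Bag \<dots> = A'.nval y" using A'.forest_val_expo[OF less.prems t] by simp
      finally show ?thesis .
    qed
    show ?case
      using mult expo gy by (cases "ty' y") (auto simp: A.nval_def A'.nval_def)
  qed
qed

text \<open>
  A node of an unfolding is a port together with the boxes that lead to it, each with the index of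
  the chosen copy. Ports labelled \<open>LCirc\<close> are not nodes: they are passed through when computing
  the parent of a node, which is \<open>Inr q\<close> if the edge leaves the structure through its
  conclusion \<open>q\<close>.
\<close>

type_synonym 'p node = "('p \<times> nat) list \<times> 'p"

text \<open>For every box, a shape lists the shapes of the copies of its content; the length of the
  list is the number of copies. Lists instead of multisets give the copies names.\<close>

datatype 'p shape = Shape (copies: "'p \<Rightarrow> 'p shape list")

definition inner_ports :: "'p cps \<Rightarrow> 'p set" where
  "inner_ports R = ports (ground_of R) - circ_ports R"

fun at :: "'p cps \<Rightarrow> ('p \<times> nat) list \<Rightarrow> 'p cps" where
  "at R [] = R"
| "at R ((a, i) # \<pi>) = at (box_at R a) \<pi>"

fun shape_at :: "'p shape \<Rightarrow> ('p \<times> nat) list \<Rightarrow> 'p shape" where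
  "shape_at t [] = t"
| "shape_at t ((a, i) # \<pi>) = shape_at (copies t a ! i) \<pi>"

fun valid_path :: "'p cps \<Rightarrow> 'p shape \<Rightarrow> ('p \<times> nat) list \<Rightarrow> bool" where
  "valid_path R t [] \<longleftrightarrow> True"
| "valid_path R t ((a, i) # \<pi>) \<longleftrightarrow>
     a \<in> boxes R \<and> i < length (copies t a) \<and> valid_path (box_at R a) (copies t a ! i) \<pi>"

definition nodes :: "'p cps \<Rightarrow> 'p shape \<Rightarrow> 'p node set" where
  "nodes R t = {(\<pi>, p). valid_path R t \<pi> \<and> p \<in> inner_ports (at R \<pi>)}"

definition exit :: "'p cps \<Rightarrow> 'p \<Rightarrow> 'p node + 'p" where
  "exit R q = (if lab (ground_of R) q = LCirc then Inr q else Inl ([], q))"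

definition shift :: "'p \<Rightarrow> nat \<Rightarrow> 'p node \<Rightarrow> 'p node" where
  "shift a i x = ((a, i) # fst x, snd x)"

fun path_parent :: "'p cps \<Rightarrow> ('p \<times> nat) list \<Rightarrow> 'p \<Rightarrow> 'p node + 'p" where
  "path_parent R [] p =
     (if p \<in> wires (ground_of R) then Inl ([], tgt (ground_of R) p) else Inr p)"
| "path_parent R ((a, i) # \<pi>) p =
     (case path_parent (box_at R a) \<pi> p of Inl y \<Rightarrow> Inl (shift a i y) | Inr q \<Rightarrow> exit R (box_map R a q))"

definition parent :: "'p cps \<Rightarrow> 'p node \<Rightarrow> 'p node + 'p" where
  "parent R x = path_parent R (fst x) (snd x)"

definition node_type :: "'p cps \<Rightarrow> 'p node \<Rightarrow> mell_type" where
  "node_type R x = ptype (ground_of (at R (fst x))) (snd x)"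

definition node_lab :: "'p cps \<Rightarrow> 'p node \<Rightarrow> label" where
  "node_lab R x = lab (ground_of (at R (fst x))) (snd x)"

definition is_left :: "'p cps \<Rightarrow> 'p node \<Rightarrow> bool" where
  "is_left R x \<longleftrightarrow> snd x \<in> lefts (ground_of (at R (fst x)))"

definition children :: "'p cps \<Rightarrow> 'p shape \<Rightarrow> 'p node \<Rightarrow> 'p node set" where
  "children R t x = {y \<in> nodes R t. parent R y = Inl x}"

definition node_val :: "'p cps \<Rightarrow> 'p shape \<Rightarrow> 'p node \<Rightarrow> val" where
  "node_val R t x = forest_val (children R t) (is_left R) (node_type R x) x"

section \<open>Well-formed structures and the typed forest of an unfolding\<close>

definition wf_ps :: "'p cps \<Rightarrow> bool" where
  "wf_ps R \<longleftrightarrow> (\<exists>d. circ_PS d R)"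

lemma wf_psD:
  assumes "wf_ps R"
  shows "ground_structure (ground_of R)" and "box_conditions R"
    and "a \<in> boxes R \<Longrightarrow> wf_ps (box_at R a)"
proof -
  obtain d where "circ_PS d R" using assms by (auto simp: wf_ps_def)
  then have "ground_structure (ground_of R) \<and> box_conditions R \<and> (\<forall>a\<in>boxes R. wf_ps (box_at R a))"
    by cases (auto simp: wf_ps_def)
  then show "ground_structure (ground_of R)" and "box_conditions R"
    and "a \<in> boxes R \<Longrightarrow> wf_ps (box_at R a)" by blast+
qed

lemma wf_ps_induct [consumes 1, case_names content]:
  assumes "wf_ps R"
    and step: "\<And>R. wf_ps R \<Longrightarrow> (\<And>a. a \<in> boxes R \<Longrightarrow> P (box_at R a)) \<Longrightarrow> P R"
  shows "P R"
proof -
  obtain d where "circ_PS d R" using assms(1) by (auto simp: wf_ps_def)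
  then show ?thesis
  proof (induction d arbitrary: R rule: less_induct)
    case (less d)
    have "P (box_at R a)" if a: "a \<in> boxes R" for a
    proof -
      obtain d' where "d' < d" "circ_PS d' (box_at R a)"
        using less.prems a by cases blast
      then show ?thesis by (rule less.IH)
    qed
    moreover have "wf_ps R" using less.prems by (auto simp: wf_ps_def)
    ultimately show ?case using step by simp
  qed
qed

lemma ground_ofD:
  assumes "wf_ps R"
  defines "G \<equiv> ground_of R"
  shows "finite (ports G)"
    and "w \<in> wires G \<Longrightarrow> w \<in> ports G \<and> lab G w \<noteq> LCirc"
    and "w \<in> wires G \<Longrightarrow> tgt G w \<in> ports G \<and> lab G (tgt G w) \<in> {LTensor, LPar, LQuest}"
    and "w \<in> lefts G \<Longrightarrow> w \<in> wires G \<and> lab G (tgt G w) \<in> {LTensor, LPar}"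
    and "p \<in> ports G \<Longrightarrow> lab G p \<in> {LTensor, LPar} \<Longrightarrow> \<exists>l r. premises_of G p = {l, r} \<and>
      left_premises G p = {l} \<and> right_premises G p = {r}"
    and "p \<in> ports G \<Longrightarrow> lab G p = LOne \<Longrightarrow> ptype G p = TOne"
    and "p \<in> ports G \<Longrightarrow> lab G p = LBot \<Longrightarrow> ptype G p = TBot"
    and "p \<in> ports G \<Longrightarrow> lab G p = LTensor \<Longrightarrow> w1 \<in> left_premises G p \<Longrightarrow> w2 \<in> right_premises G p \<Longrightarrow>
      ptype G p = TTensor (ptype G w1) (ptype G w2)"
    and "p \<in> ports G \<Longrightarrow> lab G p = LPar \<Longrightarrow> w1 \<in> left_premises G p \<Longrightarrow> w2 \<in> right_premises G p \<Longrightarrow>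
      ptype G p = TPar (ptype G w1) (ptype G w2)"
    and "p \<in> ports G \<Longrightarrow> lab G p = LBang \<Longrightarrow> \<exists>C. ptype G p = TBang C"
    and "p \<in> ports G \<Longrightarrow> lab G p \<in> {LQuest, LCirc} \<Longrightarrow> \<exists>C. ptype G p = TQuest C"
    and "p \<in> ports G \<Longrightarrow> lab G p \<in> {LQuest, LCirc} \<Longrightarrow> w \<in> premises_of G p \<Longrightarrow>
      ptype G p = TQuest (ptype G w)"
proof -
  have G: "ground_structure G" using wf_psD(1)[OF assms(1)] by (simp add: G_def)
  show "finite (ports G)" using G by (simp add: ground_structure_def)
  show "w \<in> wires G \<Longrightarrow> w \<in> ports G \<and> lab G w \<noteq> LCirc" using G by (auto simp: ground_structure_def)
  show "w \<in> wires G \<Longrightarrow> tgt G w \<in> ports G \<and> lab G (tgt G w) \<in> {LTensor, LPar, LQuest}"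
    using G by (cases "lab G (tgt G w)") (auto simp: ground_structure_def)
  show "w \<in> lefts G \<Longrightarrow> w \<in> wires G \<and> lab G (tgt G w) \<in> {LTensor, LPar}"
    using G by (auto simp: ground_structure_def)
  show "p \<in> ports G \<Longrightarrow> lab G p = LOne \<Longrightarrow> ptype G p = TOne"
    "p \<in> ports G \<Longrightarrow> lab G p = LBot \<Longrightarrow> ptype G p = TBot"
    "p \<in> ports G \<Longrightarrow> lab G p = LTensor \<Longrightarrow> w1 \<in> left_premises G p \<Longrightarrow> w2 \<in> right_premises G p \<Longrightarrow>
      ptype G p = TTensor (ptype G w1) (ptype G w2)"
    "p \<in> ports G \<Longrightarrow> lab G p = LPar \<Longrightarrow> w1 \<in> left_premises G p \<Longrightarrow> w2 \<in> right_premises G p \<Longrightarrow>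
      ptype G p = TPar (ptype G w1) (ptype G w2)"
    "p \<in> ports G \<Longrightarrow> lab G p = LBang \<Longrightarrow> \<exists>C. ptype G p = TBang C"
    "p \<in> ports G \<Longrightarrow> lab G p \<in> {LQuest, LCirc} \<Longrightarrow> \<exists>C. ptype G p = TQuest C"
    using G by (auto simp: ground_structure_def)
  show "p \<in> ports G \<Longrightarrow> lab G p \<in> {LQuest, LCirc} \<Longrightarrow> w \<in> premises_of G p \<Longrightarrow>
      ptype G p = TQuest (ptype G w)"
    using G by (auto simp: ground_structure_def)
  assume p: "p \<in> ports G" "lab G p \<in> {LTensor, LPar}"
  then have "card (premises_of G p) = 2" "card (left_premises G p) = 1"
    using G unfolding ground_structure_def by blast+
  obtain l where l: "left_premises G p = {l}"
    using \<open>card (left_premises G p) = 1\<close> by (auto simp: card_1_singleton_iff)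
  obtain u v where uv: "premises_of G p = {u, v}" "u \<noteq> v"
    using \<open>card (premises_of G p) = 2\<close> by (auto simp: card_2_iff)
  define r where "r = (if l = u then v else u)"
  have "l \<in> premises_of G p" using l by (auto simp: left_premises_def)
  then have lr: "premises_of G p = {l, r}" "r \<noteq> l" using uv by (auto simp: r_def)
  then have "right_premises G p = {r}" using l unfolding left_premises_def right_premises_def by blast
  then show "\<exists>l r. premises_of G p = {l, r} \<and> left_premises G p = {l} \<and> right_premises G p = {r}"
    using l lr by blast
qed

lemma finite_boxes: "wf_ps R \<Longrightarrow> finite (boxes R)"
  using ground_ofD(1)[of R] by (simp add: boxes_def)

lemma circ_ports_sub: "wf_ps R \<Longrightarrow> circ_ports R \<subseteq> conclusions R"
  using ground_ofD(2)[of R] by (auto simp: circ_ports_def conclusions_def)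

lemma bullet_conclusions_eq: "wf_ps R \<Longrightarrow> bullet_conclusions R = inner_ports R - wires (ground_of R)"
  by (auto simp: bullet_conclusions_def conclusions_def inner_ports_def)

text \<open>A conclusion labelled \<open>LCirc\<close> keeps its name and never lands on a
  \<open>!\<close>-port, so the conclusion that is sent to the box itself is an ordinary one. Its
  existence makes contents nonempty and gives a \<open>!\<close>-node children as soon as it has
  copies.\<close>

lemma box_mapD:
  assumes R: "wf_ps R" and a: "a \<in> boxes R"
  defines "G \<equiv> ground_of R" and "b \<equiv> box_map R a" and "S \<equiv> box_at R a"
  shows "q \<in> conclusions S \<Longrightarrow> b q \<in> ports G \<and> (b q = a \<or> lab G (b q) \<in> {LQuest, LCirc})"
    and "q \<in> circ_ports S \<Longrightarrow> b q = q \<and> q \<in> ports G \<and> lab G q \<in> {LQuest, LCirc} \<and> ptype G q = ptype (ground_of S) q"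
    and "\<exists>q\<in>bullet_conclusions S. b q = a"
    and "q \<in> bullet_conclusions S \<Longrightarrow> ptype G (b q) \<in> {TQuest (ptype (ground_of S) q), TBang (ptype (ground_of S) q)}"
proof -
  have bc: "b ` conclusions S \<subseteq> {a} \<union> {p \<in> ports G. lab G p \<in> {LQuest, LCirc}}"
    "\<forall>q\<in>circ_ports S. b q = q \<and> lab G (b q) \<noteq> LBang" "a \<in> b ` conclusions S"
    "\<forall>q\<in>circ_ports S. ptype G (b q) = ptype (ground_of S) q"
    "\<forall>q\<in>bullet_conclusions S. ptype G (b q) \<in> {TQuest (ptype (ground_of S) q), TBang (ptype (ground_of S) q)}"
    using wf_psD(2)[OF R] a unfolding box_conditions_def Let_def G_def b_def S_def by blast+
  have aG: "a \<in> ports G" "lab G a = LBang" using a by (auto simp: boxes_def G_def)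
  show 1: "q \<in> conclusions S \<Longrightarrow> b q \<in> ports G \<and> (b q = a \<or> lab G (b q) \<in> {LQuest, LCirc})" for q
    using bc(1) aG by blast
  show 2: "q \<in> circ_ports S \<Longrightarrow> b q = q \<and> q \<in> ports G \<and> lab G q \<in> {LQuest, LCirc} \<and> ptype G q = ptype (ground_of S) q" for q
  proof -
    assume q: "q \<in> circ_ports S"
    have *: "b q = q" "lab G (b q) \<noteq> LBang" "ptype G (b q) = ptype (ground_of S) q" using bc(2,4) q by auto
    moreover have "q \<in> conclusions S" using circ_ports_sub[OF wf_psD(3)[OF R a]] q by (auto simp: S_def)
    moreover have "b q \<noteq> a" using *(2) aG(2) by metis
    ultimately show ?thesis using 1[of q] by simp
  qed
  obtain r where r: "r \<in> conclusions S" "b r = a" using bc(3) by blast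
  then have "r \<notin> circ_ports S" using bc(2) aG by auto
  then show "\<exists>q\<in>bullet_conclusions S. b q = a" using r by (auto simp: bullet_conclusions_def)
  show "q \<in> bullet_conclusions S \<Longrightarrow> ptype G (b q) \<in> {TQuest (ptype (ground_of S) q), TBang (ptype (ground_of S) q)}"
    using bc(5) by blast
qed

lemma circ_port_source:
  assumes "wf_ps R" "q \<in> circ_ports R"
  shows "\<exists>a\<in>boxes R. \<exists>q'\<in>conclusions (box_at R a). box_map R a q' = q"
  using wf_psD(2)[OF assms(1)] assms(2) unfolding box_conditions_def Let_def by blast

lemma inj_shift: "inj (shift a i)" by (auto simp: inj_def shift_def prod_eq_iff)

lemma shift_simps [simp]:
  "fst (shift a i x) = (a, i) # fst x" "snd (shift a i x) = snd x"
  "shift a i x = shift b j y \<longleftrightarrow> a = b \<and> i = j \<and> x = y" "shift a i x \<noteq> ([], p)" "([], p) \<noteq> shift a i x"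
  by (auto simp: shift_def prod_eq_iff)

lemma node_shift [simp]:
  "node_type R (shift a i x) = node_type (box_at R a) x"
  "node_lab R (shift a i x) = node_lab (box_at R a) x"
  "is_left R (shift a i x) = is_left (box_at R a) x"
  "parent R (shift a i x) =
    (case parent (box_at R a) x of Inl y \<Rightarrow> Inl (shift a i y) | Inr q \<Rightarrow> exit R (box_map R a q))"
  by (simp_all add: node_type_def node_lab_def is_left_def parent_def)

lemma node_root [simp]:
  "node_type R ([], p) = ptype (ground_of R) p"
  "node_lab R ([], p) = lab (ground_of R) p"
  "is_left R ([], p) \<longleftrightarrow> p \<in> lefts (ground_of R)"
  "parent R ([], p) = (if p \<in> wires (ground_of R) then Inl ([], tgt (ground_of R) p) else Inr p)"
  by (simp_all add: node_type_def node_lab_def is_left_def parent_def)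

lemma root_in_nodes [simp]: "([], p) \<in> nodes R t \<longleftrightarrow> p \<in> inner_ports R"
  by (simp add: nodes_def)

lemma shift_in_nodes [simp]:
  "shift a i x \<in> nodes R t \<longleftrightarrow> a \<in> boxes R \<and> i < length (copies t a) \<and> x \<in> nodes (box_at R a) (copies t a ! i)"
  by (cases x) (auto simp: nodes_def shift_def)

lemma node_cases:
  obtains p where "x = ([], p)" | a i y where "x = shift a i y"
proof (cases x)
  case (Pair \<pi> p)
  show ?thesis
  proof (cases \<pi>)
    case (Cons s \<rho>)
    then have "x = shift (fst s) (snd s) (\<rho>, p)" using Pair by (simp add: shift_def)
    then show ?thesis using that by blast
  qed (use that Pair in auto)
qed

lemma nodes_eq:
  "nodes R t = (\<lambda>p. ([], p)) ` inner_ports R \<union>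
     (\<Union>a\<in>boxes R. \<Union>i<length (copies t a). shift a i ` nodes (box_at R a) (copies t a ! i))"
proof (rule set_eqI)
  fix x show "x \<in> nodes R t \<longleftrightarrow> x \<in> (\<lambda>p. ([], p)) ` inner_ports R \<union>
     (\<Union>a\<in>boxes R. \<Union>i<length (copies t a). shift a i ` nodes (box_at R a) (copies t a ! i))"
    by (cases x rule: node_cases) auto
qed

lemma finite_nodes: "wf_ps R \<Longrightarrow> finite (nodes R t)"
proof (induction arbitrary: t rule: wf_ps_induct)
  case (content R)
  have "finite (inner_ports R)" using ground_ofD(1)[OF content.hyps] by (simp add: inner_ports_def)
  then show ?case using content finite_boxes[OF content.hyps] by (subst nodes_eq) auto
qed

lemma exit_eq_simps [simp]:
  "exit R q = Inl x \<longleftrightarrow> x = ([], q) \<and> lab (ground_of R) q \<noteq> LCirc"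
  "exit R q = Inr p \<longleftrightarrow> p = q \<and> lab (ground_of R) q = LCirc"
  by (auto simp: exit_def)

text \<open>An edge leaves \<open>R\<close> either at once, from an ordinary conclusion, or after
  leaving at least one box, and then only through a port labelled \<open>LCirc\<close>, since any
  other port would stop it.\<close>

lemma parent_Inr:
  assumes "wf_ps R" "x \<in> nodes R t" "parent R x = Inr q"
  shows "(x = ([], q) \<and> q \<in> bullet_conclusions R) \<or> (fst x \<noteq> [] \<and> q \<in> circ_ports R)"
  using assms
proof (induction arbitrary: t x q rule: wf_ps_induct)
  case (content R)
  show ?case
  proof (cases x rule: node_cases)
    case (1 p)
    then show ?thesis using content.prems bullet_conclusions_eq[OF content.hyps] by (auto split: if_splits)
  next
    case (2 a i y)
    then have a: "a \<in> boxes R" and y: "y \<in> nodes (box_at R a) (copies t a ! i)" using content.prems by auto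
    then obtain r where r: "parent (box_at R a) y = Inr r" "exit R (box_map R a r) = Inr q"
      using content.prems 2 by (auto split: sum.splits)
    have "r \<in> conclusions (box_at R a)"
      using content.IH[OF a y r(1)] circ_ports_sub[OF wf_psD(3)[OF content.hyps a]]
      by (auto simp: bullet_conclusions_def)
    then have "box_map R a r \<in> ports (ground_of R)" using box_mapD(1)[OF content.hyps a] by blast
    then show ?thesis using r(2) 2 by (auto simp: circ_ports_def)
  qed
qed

lemma parent_Inr_conclusion:
  assumes "wf_ps R" "x \<in> nodes R t" "parent R x = Inr q"
  shows "q \<in> conclusions R"
  using parent_Inr[OF assms] circ_ports_sub[OF assms(1)] by (auto simp: bullet_conclusions_def)

lemma parent_in_nodes:
  assumes "wf_ps R" "x \<in> nodes R t" "parent R x = Inl y"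
  shows "y \<in> nodes R t"
  using assms
proof (induction arbitrary: t x y rule: wf_ps_induct)
  case (content R)
  show ?case
  proof (cases x rule: node_cases)
    case (1 p)
    then show ?thesis
      using content.prems ground_ofD(3)[OF content.hyps, of p] by (auto simp: inner_ports_def circ_ports_def split: if_splits)
  next
    case (2 a i z)
    then have a: "a \<in> boxes R" and z: "z \<in> nodes (box_at R a) (copies t a ! i)" using content.prems by auto
    show ?thesis
    proof (cases "parent (box_at R a) z")
      case (Inl w)
      then show ?thesis using content.IH[OF a z Inl] 2 content.prems by auto
    next
      case (Inr r)
      then have "box_map R a r \<in> ports (ground_of R)"
        using box_mapD(1)[OF content.hyps a] parent_Inr_conclusion[OF wf_psD(3)[OF content.hyps a] z] by blast
      then show ?thesis using Inr 2 content.prems by (auto simp: inner_ports_def circ_ports_def)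
    qed
  qed
qed

text \<open>The exponential is added once, where the edge leaves an ordinary conclusion of a box;
  from one circle to the next the type is kept. A \<open>!\<close> is excluded because circle ports
  have a \<open>?\<close>-type.\<close>

lemma parent_Inr_type:
  assumes "wf_ps R" "x \<in> nodes R t" "parent R x = Inr q" "q \<in> circ_ports R"
  shows "ptype (ground_of R) q = TQuest (node_type R x)"
  using assms
proof (induction arbitrary: t x q rule: wf_ps_induct)
  case (content R)
  show ?case
  proof (cases x rule: node_cases)
    case (1 p)
    then show ?thesis using content.prems parent_Inr[OF content.hyps content.prems(1,2)]
      by (auto simp: bullet_conclusions_def)
  next
    case (2 a i y)
    then have a: "a \<in> boxes R" and y: "y \<in> nodes (box_at R a) (copies t a ! i)" using content.prems by auto
    then obtain r where r: "parent (box_at R a) y = Inr r" "box_map R a r = q"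
      using content.prems 2 by (auto split: sum.splits)
    show ?thesis
    proof (cases "r \<in> circ_ports (box_at R a)")
      case True
      then show ?thesis using content.IH[OF a y r(1)] box_mapD(2)[OF content.hyps a, of r] r(2) 2 by simp
    next
      case False
      then have "y = ([], r)" "r \<in> bullet_conclusions (box_at R a)"
        using parent_Inr[OF wf_psD(3)[OF content.hyps a] y r(1)] by auto
      moreover from this(2) have "ptype (ground_of R) q \<in> {TQuest (ptype (ground_of (box_at R a)) r), TBang (ptype (ground_of (box_at R a)) r)}"
        using box_mapD(4)[OF content.hyps a, of r] r(2) by simp
      moreover have "\<exists>C. ptype (ground_of R) q = TQuest C"
        using ground_ofD(11)[OF content.hyps, of q] content.prems(3) by (auto simp: circ_ports_def)
      ultimately show ?thesis using 2 by auto
    qed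
  qed
qed

lemma exit_type:
  assumes "wf_ps R" "a \<in> boxes R" "y \<in> nodes (box_at R a) t" "parent (box_at R a) y = Inr r"
  shows "ptype (ground_of R) (box_map R a r) \<in> {TQuest (node_type (box_at R a) y), TBang (node_type (box_at R a) y)}"
    and "box_map R a r = a \<or> lab (ground_of R) (box_map R a r) \<in> {LQuest, LCirc}"
    and "box_map R a r \<in> ports (ground_of R)"
proof -
  note wf = wf_psD(3)[OF assms(1,2)]
  show "ptype (ground_of R) (box_map R a r) \<in> {TQuest (node_type (box_at R a) y), TBang (node_type (box_at R a) y)}"
  proof (cases "r \<in> circ_ports (box_at R a)")
    case True
    then show ?thesis
      using box_mapD(2)[OF assms(1,2) True] parent_Inr_type[OF wf assms(3,4) True] by simp
  next
    case False
    then have "y = ([], r)" "r \<in> bullet_conclusions (box_at R a)"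
      using parent_Inr[OF wf assms(3,4)] by auto
    then show ?thesis using box_mapD(4)[OF assms(1,2), of r] by simp
  qed
  show "box_map R a r = a \<or> lab (ground_of R) (box_map R a r) \<in> {LQuest, LCirc}"
    "box_map R a r \<in> ports (ground_of R)"
    using box_mapD(1)[OF assms(1,2)] parent_Inr_conclusion[OF wf assms(3,4)] by blast+
qed

lemma children_shift:
  assumes "a \<in> boxes R" "i < length (copies t a)"
  shows "children R t (shift a i y) = shift a i ` children (box_at R a) (copies t a ! i) y"
proof (rule set_eqI)
  fix x show "x \<in> children R t (shift a i y) \<longleftrightarrow> x \<in> shift a i ` children (box_at R a) (copies t a ! i) y"
    by (cases x rule: node_cases) (use assms in \<open>auto simp: children_def split: sum.splits if_splits\<close>)
qed

definition doors :: "'p cps \<Rightarrow> 'p shape \<Rightarrow> 'p \<Rightarrow> nat \<Rightarrow> 'p \<Rightarrow> 'p node set" where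
  "doors R t a i p = {y \<in> nodes (box_at R a) (copies t a ! i).
     \<exists>q. parent (box_at R a) y = Inr q \<and> box_map R a q = p}"

definition box_nodes :: "'p cps \<Rightarrow> 'p shape \<Rightarrow> 'p \<Rightarrow> 'p node set" where
  "box_nodes R t p = (\<Union>a\<in>boxes R. \<Union>i<length (copies t a). shift a i ` doors R t a i p)"

lemma in_box_nodes_simps [simp]:
  "shift a i y \<in> box_nodes R t p \<longleftrightarrow> a \<in> boxes R \<and> i < length (copies t a) \<and> y \<in> doors R t a i p"
  "([], q) \<notin> box_nodes R t p"
  by (auto simp: box_nodes_def)

lemma children_root:
  assumes R: "wf_ps R" and p: "p \<in> inner_ports R"
  shows "children R t ([], p) = (\<lambda>w. ([], w)) ` premises_of (ground_of R) p \<union> box_nodes R t p"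
proof (rule set_eqI)
  fix x show "x \<in> children R t ([], p) \<longleftrightarrow>
    x \<in> (\<lambda>w. ([], w)) ` premises_of (ground_of R) p \<union> box_nodes R t p"
  proof (cases x rule: node_cases)
    case (1 q)
    then show ?thesis
      using ground_ofD(2)[OF R, of q] by (auto simp: children_def premises_of_def inner_ports_def circ_ports_def)
  next
    case (2 a i y)
    then show ?thesis
      using p by (auto simp: children_def doors_def inner_ports_def circ_ports_def split: sum.splits)
  qed
qed

lemma box_nodes_exponential:
  assumes "wf_ps R" "x \<in> box_nodes R t p"
  shows "p \<in> ports (ground_of R)" and "lab (ground_of R) p \<in> {LBang, LQuest, LCirc}"
    and "ptype (ground_of R) p \<in> {TBang (node_type R x), TQuest (node_type R x)}"
    and "parent R x = exit R p" and "x \<in> nodes R t" and "fst x \<noteq> []"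
proof -
  obtain a i y where y: "a \<in> boxes R" "i < length (copies t a)" "x = shift a i y" "y \<in> doors R t a i p"
    using assms(2) by (auto simp: box_nodes_def)
  then obtain q where q: "y \<in> nodes (box_at R a) (copies t a ! i)" "parent (box_at R a) y = Inr q" "box_map R a q = p"
    by (auto simp: doors_def)
  have "lab (ground_of R) a = LBang" using y(1) by (simp add: boxes_def)
  then show "p \<in> ports (ground_of R)" "lab (ground_of R) p \<in> {LBang, LQuest, LCirc}"
    "ptype (ground_of R) p \<in> {TBang (node_type R x), TQuest (node_type R x)}"
    "parent R x = exit R p" "x \<in> nodes R t" "fst x \<noteq> []"
    using exit_type[OF assms(1) y(1) q(1,2)] q y by auto
qed

lemma box_nodes_circ:
  assumes "wf_ps R" "p \<in> circ_ports R"
  shows "{x \<in> nodes R t. parent R x = Inr p} = box_nodes R t p"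
proof (rule set_eqI)
  fix x show "x \<in> {x \<in> nodes R t. parent R x = Inr p} \<longleftrightarrow> x \<in> box_nodes R t p"
  proof (cases x rule: node_cases)
    case (1 q)
    then show ?thesis using assms by (auto simp: inner_ports_def)
  next
    case (2 a i y)
    then show ?thesis
      using assms by (auto simp: doors_def circ_ports_def split: sum.splits)
  qed
qed

text \<open>Apart from circle ports, the label of a port is determined by its type, so isomorphisms
  of unfoldings have to preserve types only.\<close>

fun type_lab :: "mell_type \<Rightarrow> label" where
  "type_lab TOne = LOne"
| "type_lab TBot = LBot"
| "type_lab (TTensor C D) = LTensor"
| "type_lab (TPar C D) = LPar"
| "type_lab (TBang C) = LBang"
| "type_lab (TQuest C) = LQuest"

lemma lab_eq_type_lab:
  assumes R: "wf_ps R" and p: "p \<in> inner_ports R"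
  shows "lab (ground_of R) p = type_lab (ptype (ground_of R) p)"
proof -
  have P: "p \<in> ports (ground_of R)" "lab (ground_of R) p \<noteq> LCirc"
    using p by (auto simp: inner_ports_def circ_ports_def)
  show ?thesis
  proof (cases "lab (ground_of R) p \<in> {LTensor, LPar}")
    case True
    then obtain l r where "left_premises (ground_of R) p = {l}" "right_premises (ground_of R) p = {r}"
      using ground_ofD(5)[OF R P(1)] by blast
    then show ?thesis
      using True ground_ofD(8)[OF R P(1), of l r] ground_ofD(9)[OF R P(1), of l r] by auto
  next
    case False
    then show ?thesis
      using P(2) ground_ofD(6,7,10,11)[OF R P(1)] by (cases "lab (ground_of R) p") auto
  qed
qed

lemma premise_types:
  assumes "wf_ps R" "p \<in> ports (ground_of R)" "lab (ground_of R) p \<in> {LTensor, LPar}"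
    and "ptype (ground_of R) p \<in> {TTensor C D, TPar C D}"
    and "w1 \<in> left_premises (ground_of R) p" "w2 \<in> right_premises (ground_of R) p"
  shows "ptype (ground_of R) w1 = C" "ptype (ground_of R) w2 = D"
  using ground_ofD(8)[OF assms(1,2) _ assms(5,6)] ground_ofD(9)[OF assms(1,2) _ assms(5,6)] assms(3,4)
  by (cases "lab (ground_of R) p = LTensor"; simp)+

lemma node_lab_type:
  assumes "wf_ps R" "x \<in> nodes R t"
  shows "node_lab R x = type_lab (node_type R x)"
  using assms
proof (induction arbitrary: t x rule: wf_ps_induct)
  case (content R)
  show ?case
  proof (cases x rule: node_cases)
    case (1 p)
    then show ?thesis using lab_eq_type_lab[OF content.hyps] content.prems by simp
  next
    case (2 a i y)
    then show ?thesis using content.IH[of a y] content.prems by auto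
  qed
qed

text \<open>Box maps hit only ports with exponential labels, so the children of a multiplicative
  node are its two premises, in the same copy.\<close>

lemma mult_children:
  assumes "wf_ps R" "y \<in> nodes R t" "node_type R y \<in> {TTensor C D, TPar C D}"
  shows "\<exists>l r. children R t y = {l, r} \<and> is_left R l \<and> \<not> is_left R r \<and> node_type R l = C \<and> node_type R r = D"
  using assms
proof (induction arbitrary: t y rule: wf_ps_induct)
  case (content R)
  show ?case
  proof (cases y rule: node_cases)
    case (1 p)
    then have p: "p \<in> inner_ports R" "lab (ground_of R) p \<in> {LTensor, LPar}" "p \<in> ports (ground_of R)"
      "ptype (ground_of R) p \<in> {TTensor C D, TPar C D}"
      using content.prems lab_eq_type_lab[OF content.hyps, of p] by (auto simp: inner_ports_def)
    obtain l r where lr: "premises_of (ground_of R) p = {l, r}" "left_premises (ground_of R) p = {l}"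
        "right_premises (ground_of R) p = {r}"
      using ground_ofD(5)[OF content.hyps p(3,2)] by (elim exE conjE) (rule that; assumption)
    have "box_nodes R t p = {}"
      using box_nodes_exponential(2)[OF content.hyps, of _ t p] p(2) by auto
    then have "children R t y = {([], l), ([], r)}"
      using children_root[OF content.hyps p(1)] lr(1) 1 by auto
    moreover have "l \<in> lefts (ground_of R)" "r \<notin> lefts (ground_of R)"
      using lr by (auto simp: left_premises_def right_premises_def)
    moreover have "ptype (ground_of R) l = C" "ptype (ground_of R) r = D"
      using premise_types[OF content.hyps p(3,2,4), of l r] lr by auto
    ultimately have "children R t y = {([], l), ([], r)} \<and> is_left R ([], l) \<and> \<not> is_left R ([], r) \<and>
        node_type R ([], l) = C \<and> node_type R ([], r) = D"
      by simp
    then show ?thesis by (intro exI)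
  next
    case (2 a i z)
    then have a: "a \<in> boxes R" "i < length (copies t a)" "z \<in> nodes (box_at R a) (copies t a ! i)"
      "node_type (box_at R a) z \<in> {TTensor C D, TPar C D}" using content.prems by auto
    obtain l r where "children (box_at R a) (copies t a ! i) z = {l, r}" "is_left (box_at R a) l"
        "\<not> is_left (box_at R a) r" "node_type (box_at R a) l = C" "node_type (box_at R a) r = D"
      using content.IH[OF a(1,3,4)] by (elim exE conjE) (rule that; assumption)
    then have "children R t y = {shift a i l, shift a i r} \<and> is_left R (shift a i l) \<and> \<not> is_left R (shift a i r) \<and>
        node_type R (shift a i l) = C \<and> node_type R (shift a i r) = D"
      using children_shift[OF a(1,2)] 2 by simp
    then show ?thesis by (intro exI)
  qed
qed

lemma is_left_parent:
  assumes "wf_ps R" "x \<in> nodes R t" "is_left R x"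
  shows "\<exists>y. parent R x = Inl y \<and> node_lab R y \<in> {LTensor, LPar}"
  using assms
proof (induction arbitrary: t x rule: wf_ps_induct)
  case (content R)
  show ?case
  proof (cases x rule: node_cases)
    case (1 p)
    then show ?thesis using content.prems ground_ofD(4)[OF content.hyps, of p] by auto
  next
    case (2 a i y)
    then have "a \<in> boxes R" "y \<in> nodes (box_at R a) (copies t a ! i)" "is_left (box_at R a) y"
      using content.prems by auto
    then obtain z where "parent (box_at R a) y = Inl z" "node_lab (box_at R a) z \<in> {LTensor, LPar}"
      using content.IH by blast
    then show ?thesis using 2 by auto
  qed
qed

lemma other_children:
  assumes "wf_ps R" "y \<in> nodes R t" "node_lab R y \<notin> {LTensor, LPar}" "x \<in> children R t y"
  shows "node_type R y \<in> {TBang (node_type R x), TQuest (node_type R x)}"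
  using assms
proof (induction arbitrary: t x y rule: wf_ps_induct)
  case (content R)
  show ?case
  proof (cases y rule: node_cases)
    case (1 p)
    then have p: "p \<in> inner_ports R" "lab (ground_of R) p \<notin> {LTensor, LPar}" "p \<in> ports (ground_of R)"
      using content.prems by (auto simp: inner_ports_def)
    show ?thesis
    proof (cases "x \<in> box_nodes R t p")
      case True
      then show ?thesis using box_nodes_exponential(3)[OF content.hyps True] 1 by auto
    next
      case False
      then obtain w where w: "x = ([], w)" "w \<in> premises_of (ground_of R) p"
        using content.prems children_root[OF content.hyps p(1)] 1 by auto
      then have ww: "w \<in> wires (ground_of R)" "tgt (ground_of R) w = p" by (auto simp: premises_of_def)
      then have "lab (ground_of R) p = LQuest" using ground_ofD(3)[OF content.hyps ww(1)] p by auto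
      then show ?thesis using ground_ofD(12)[OF content.hyps p(3) _ w(2)] w 1 by simp
    qed
  next
    case (2 a i z)
    then have a: "a \<in> boxes R" "i < length (copies t a)" "z \<in> nodes (box_at R a) (copies t a ! i)"
      "node_lab (box_at R a) z \<notin> {LTensor, LPar}" using content.prems by auto
    obtain u where u: "x = shift a i u" "u \<in> children (box_at R a) (copies t a ! i) z"
      using content.prems 2 children_shift[OF a(1,2)] by auto
    then show ?thesis using content.IH[OF a(1,3,4) u(2)] 2 by simp
  qed
qed

lemma typed_forest_nodes:
  assumes R: "wf_ps R"
  shows "typed_forest (nodes R t) (parent R) (node_type R) (is_left R)"
proof
  note mult = mult_children[OF R, unfolded children_def]
  show "finite (nodes R t)" by (rule finite_nodes[OF R])
  show in_nodes: "y \<in> nodes R t" if "x \<in> nodes R t" "parent R x = Inl y" for x y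
    using parent_in_nodes[OF R that] .
  have child: "x \<in> children R t y" if "x \<in> nodes R t" "parent R x = Inl y" for x y
    using that by (simp add: children_def)
  show "size (node_type R x) < size (node_type R y)" if x: "x \<in> nodes R t" "parent R x = Inl y" for x y
  proof (cases "node_lab R y \<in> {LTensor, LPar}")
    case True
    then obtain C D where CD: "node_type R y \<in> {TTensor C D, TPar C D}"
      using node_lab_type[OF R in_nodes[OF x]] by (cases "node_type R y") auto
    then show ?thesis using mult_children[OF R in_nodes[OF x] CD] child[OF x] by auto
  next
    case False
    then show ?thesis using other_children[OF R in_nodes[OF x] False child[OF x]] by auto
  qed
  show "\<not> is_left R x" if "x \<in> nodes R t" "parent R x = Inr r" for x r
    using is_left_parent[OF R that(1)] that(2) by auto
  show "{x \<in> nodes R t. parent R x = Inl y} = {}" if y: "y \<in> nodes R t" "node_type R y \<in> {TOne, TBot}" for y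
  proof -
    have "node_lab R y \<notin> {LTensor, LPar}" using node_lab_type[OF R y(1)] y(2) by auto
    then have "children R t y = {}" using other_children[OF R y(1)] y(2) by fastforce
    then show ?thesis by (simp add: children_def)
  qed
  show "\<exists>l r. {x \<in> nodes R t. parent R x = Inl y} = {l, r} \<and> is_left R l \<and> \<not> is_left R r \<and>
      node_type R l = C \<and> node_type R r = D"
    if "y \<in> nodes R t" "node_type R y \<in> {TTensor C D, TPar C D}" for y C D
    using mult[OF that] .
  show "node_type R x = C \<and> \<not> is_left R x"
    if y: "y \<in> nodes R t" "node_type R y \<in> {TBang C, TQuest C}" and x: "x \<in> nodes R t" "parent R x = Inl y" for x y C
  proof -
    have "node_lab R y \<notin> {LTensor, LPar}" using node_lab_type[OF R y(1)] y(2) by auto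
    then show ?thesis
      using other_children[OF R y(1) _ child[OF x]] is_left_parent[OF R x(1)] y(2) x(2) by auto
  qed
qed

lemma
  assumes R: "wf_ps R"
  shows nval_eq: "typed_forest.nval (nodes R t) (parent R) (node_type R) (is_left R) = node_val R t"
    and ch_eq: "typed_forest.ch (nodes R t) (parent R) = children R t"
proof -
  interpret typed_forest "nodes R t" "parent R" "node_type R" "is_left R" by (rule typed_forest_nodes[OF R])
  show ch: "ch = children R t" by (intro ext) (simp add: ch_def children_def)
  show "nval = node_val R t" by (intro ext) (simp add: nval_def node_val_def ch)
qed

section \<open>Values of unfoldings compared with experiments\<close>

lemma node_val_mult:
  assumes R: "wf_ps R" and p: "p \<in> ports (ground_of R)" "lab (ground_of R) p \<in> {LTensor, LPar}"
    and w: "w1 \<in> left_premises (ground_of R) p" "w2 \<in> right_premises (ground_of R) p"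
  shows "node_val R t ([], p) = VPair (node_val R t ([], w1)) (node_val R t ([], w2))"
proof -
  have P: "p \<in> inner_ports R" using p by (auto simp: inner_ports_def circ_ports_def)
  then obtain C D where CD: "ptype (ground_of R) p \<in> {TTensor C D, TPar C D}"
    using lab_eq_type_lab[OF R P] p(2) by (cases "ptype (ground_of R) p") auto
  obtain l r where lr: "premises_of (ground_of R) p = {l, r}" "left_premises (ground_of R) p = {l}"
      "right_premises (ground_of R) p = {r}"
    using ground_ofD(5)[OF R p] by (elim exE conjE) (rule that; assumption)
  have "box_nodes R t p = {}" using box_nodes_exponential(2)[OF R, of _ t p] p(2) by auto
  then have ch: "children R t ([], p) = {([], w1), ([], w2)}"
    using children_root[OF R P] lr w by auto
  have left: "is_left R ([], w1)" "\<not> is_left R ([], w2)"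
    using w by (auto simp: left_premises_def right_premises_def)
  have ty: "node_type R ([], w1) = C" "node_type R ([], w2) = D"
    using premise_types[OF R p CD w] by auto
  show ?thesis
    using typed_forest.forest_val_mult[OF typed_forest_nodes[OF R], of "([], p)" t C D "([], w1)" "([], w2)"] P CD ch left ty
    by (simp add: nval_eq[OF R] ch_eq[OF R])
qed

lemma node_val_expo:
  assumes R: "wf_ps R" and p: "p \<in> ports (ground_of R)" "lab (ground_of R) p \<in> {LBang, LQuest}"
  shows "node_val R t ([], p) = Bag (\<Sum>x\<in>children R t ([], p). {#node_val R t x#})"
proof -
  have P: "p \<in> inner_ports R" using p by (auto simp: inner_ports_def circ_ports_def)
  then obtain C where C: "ptype (ground_of R) p \<in> {TBang C, TQuest C}"
    using lab_eq_type_lab[OF R P] p(2) by (cases "ptype (ground_of R) p") auto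
  have "finite (children R t ([], p))" using finite_nodes[OF R] by (simp add: children_def)
  then show ?thesis
    using typed_forest.forest_val_expo[OF typed_forest_nodes[OF R], of "([], p)" t C] P C
    by (simp add: nval_eq[OF R] ch_eq[OF R] image_mset_as_sum)
qed

lemma node_val_shift:
  assumes R: "wf_ps R" and a: "a \<in> boxes R" "i < length (copies t a)"
    and y: "y \<in> nodes (box_at R a) (copies t a ! i)"
  shows "node_val R t (shift a i y) = node_val (box_at R a) (copies t a ! i) y"
proof -
  note wf = wf_psD(3)[OF R a(1)]
  have "typed_forest.nval (nodes R t) (parent R) (node_type R) (is_left R) (shift a i y) =
    typed_forest.nval (nodes (box_at R a) (copies t a ! i)) (parent (box_at R a)) (node_type (box_at R a)) (is_left (box_at R a)) y"
    by (rule typed_forest_embedding[OF typed_forest_nodes[OF R] typed_forest_nodes[OF wf] inj_shift])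
      (use y a children_shift[OF a] in \<open>auto simp: children_def\<close>)
  then show ?thesis unfolding nval_eq[OF R] nval_eq[OF wf] .
qed

text \<open>At a circle port the experiment holds the bag of the values of all nodes whose edges
  leave through it. The rule for experiments merges this bag into the next port, just as
  \<open>path_parent\<close> lets the edges pass.\<close>

definition agrees :: "'p cps \<Rightarrow> 'p shape \<Rightarrow> 'p ps_experiment \<Rightarrow> bool" where
  "agrees R t e \<longleftrightarrow> (\<forall>p\<in>inner_ports R. port_val e p = node_val R t ([], p)) \<and>
     (\<forall>p\<in>circ_ports R. port_val e p = Bag (\<Sum>x\<in>{x \<in> nodes R t. parent R x = Inr p}. {#node_val R t x#}))"

text \<open>Agreement is demanded of the contents only; with the equations at the ports of
  \<open>R\<close> it forces agreement at \<open>R\<close> itself. Listing the multiset of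
  experiments pairs each of them with a copy.\<close>

definition contents_agree :: "'p cps \<Rightarrow> 'p shape \<Rightarrow> 'p ps_experiment \<Rightarrow> bool" where
  "contents_agree R t e \<longleftrightarrow> (\<forall>a\<in>boxes R. \<exists>es. box_exps e a = mset es \<and> length es = length (copies t a) \<and>
     (\<forall>i<length (copies t a). agrees (box_at R a) (copies t a ! i) (es ! i)))"

lemma bullet_conclusions_sub: "wf_ps R \<Longrightarrow> bullet_conclusions R \<subseteq> inner_ports R"
  using bullet_conclusions_eq by blast

text \<open>The two sums of a contribution are the two cases of \<open>parent_Inr\<close>: an
  ordinary conclusion is itself the node that leaves, while a circle port stands for all nodes that
  leave through it.\<close>

lemma box_contribution_eq:
  assumes R: "wf_ps R" and a: "a \<in> boxes R" "i < length (copies t a)"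
    and e: "agrees (box_at R a) (copies t a ! i) e'"
  shows "box_contribution R a e' p = (\<Sum>x\<in>shift a i ` doors R t a i p. {#node_val R t x#})"
proof -
  let ?S = "box_at R a" and ?t = "copies t a ! i"
  let ?v = "\<lambda>y. {#node_val ?S ?t y#}"
  note wf = wf_psD(3)[OF R a(1)]
  let ?Q = "{q \<in> bullet_conclusions ?S. box_map R a q = p}"
  let ?Z = "{q \<in> circ_ports ?S. box_map R a q = p}"
  let ?E = "\<lambda>q. {x \<in> nodes ?S ?t. parent ?S x = Inr q}"
  have sub: "bullet_conclusions ?S \<subseteq> inner_ports ?S" by (rule bullet_conclusions_sub[OF wf])
  have fin: "finite (nodes ?S ?t)" "finite ?Q" "finite ?Z"
    using finite_nodes[OF wf] ground_ofD(1)[OF wf]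
    by (auto simp: bullet_conclusions_def conclusions_def circ_ports_def)
  have doors: "doors R t a i p = (\<lambda>q. ([], q)) ` ?Q \<union> (\<Union>q\<in>?Z. ?E q)"
  proof (intro set_eqI iffI)
    fix y assume "y \<in> doors R t a i p"
    then obtain q where "y \<in> nodes ?S ?t" "parent ?S y = Inr q" "box_map R a q = p" by (auto simp: doors_def)
    then show "y \<in> (\<lambda>q. ([], q)) ` ?Q \<union> (\<Union>q\<in>?Z. ?E q)"
      using parent_Inr[OF wf, of y ?t q] by auto
  next
    fix y assume "y \<in> (\<lambda>q. ([], q)) ` ?Q \<union> (\<Union>q\<in>?Z. ?E q)"
    then show "y \<in> doors R t a i p"
      using sub bullet_conclusions_eq[OF wf] by (auto simp: doors_def)
  qed
  have "(\<Sum>x\<in>shift a i ` doors R t a i p. {#node_val R t x#}) = (\<Sum>y\<in>doors R t a i p. {#node_val R t (shift a i y)#})"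
    by (subst sum.reindex) (auto intro: inj_on_subset[OF inj_shift])
  also have "\<dots> = (\<Sum>y\<in>doors R t a i p. ?v y)"
    using node_val_shift[OF R a] by (intro sum.cong) (auto simp: doors_def)
  also have "\<dots> = (\<Sum>y\<in>(\<lambda>q. ([], q)) ` ?Q. ?v y) + (\<Sum>y\<in>(\<Union>q\<in>?Z. ?E q). ?v y)"
  proof -
    have "(\<lambda>q. ([], q)) ` ?Q \<inter> (\<Union>q\<in>?Z. ?E q) = {}"
      by (auto simp: bullet_conclusions_def split: if_splits)
    then show ?thesis unfolding doors using fin by (intro sum.union_disjoint) auto
  qed
  also have "(\<Sum>y\<in>(\<lambda>q. ([], q)) ` ?Q. ?v y) = (\<Sum>q\<in>?Q. {#port_val e' q#})"
    using e sub by (subst sum.reindex) (auto simp: inj_on_def agrees_def intro!: sum.cong)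
  also have "(\<Sum>y\<in>(\<Union>q\<in>?Z. ?E q). ?v y) = (\<Sum>q\<in>?Z. \<Sum>y\<in>?E q. ?v y)"
    using fin by (intro sum.UNION_disjoint) auto
  also have "\<dots> = (\<Sum>q\<in>?Z. elems (port_val e' q))"
    using e by (intro sum.cong) (auto simp: agrees_def)
  finally show ?thesis by (simp add: box_contribution_def)
qed

lemma finite_doors: "wf_ps R \<Longrightarrow> a \<in> boxes R \<Longrightarrow> finite (doors R t a i p)"
  unfolding doors_def by (rule finite_subset[OF _ finite_nodes[OF wf_psD(3)]]) auto

lemma contributions_eq:
  assumes R: "wf_ps R" and e: "contents_agree R t e"
  shows "(\<Sum>a\<in>boxes R. \<Sum>e'\<in>#box_exps e a. box_contribution R a e' p) =
    (\<Sum>x\<in>box_nodes R t p. {#node_val R t x#})"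
proof -
  let ?v = "\<lambda>y. {#node_val R t y#}"
  have "(\<Sum>e'\<in>#box_exps e a. box_contribution R a e' p) =
      (\<Sum>i<length (copies t a). \<Sum>x\<in>shift a i ` doors R t a i p. ?v x)" if a: "a \<in> boxes R" for a
  proof -
    obtain es where es: "box_exps e a = mset es" "length es = length (copies t a)"
        "\<forall>i<length (copies t a). agrees (box_at R a) (copies t a ! i) (es ! i)"
      using e a unfolding contents_agree_def by blast
    have "(\<Sum>e'\<in>#box_exps e a. box_contribution R a e' p) = sum_list (map (\<lambda>e'. box_contribution R a e' p) es)"
      by (simp add: es(1) flip: mset_map sum_mset_sum_list)
    also have "\<dots> = (\<Sum>i<length (copies t a). box_contribution R a (es ! i) p)"
      by (simp add: sum_list_sum_nth es(2) atLeast0LessThan)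
    also have "\<dots> = (\<Sum>i<length (copies t a). \<Sum>x\<in>shift a i ` doors R t a i p. ?v x)"
      using box_contribution_eq[OF R a] es(3) by (intro sum.cong) auto
    finally show ?thesis .
  qed
  then have "(\<Sum>a\<in>boxes R. \<Sum>e'\<in>#box_exps e a. box_contribution R a e' p) =
      (\<Sum>a\<in>boxes R. \<Sum>i<length (copies t a). \<Sum>x\<in>shift a i ` doors R t a i p. ?v x)"
    by simp
  also have "\<dots> = (\<Sum>a\<in>boxes R. \<Sum>x\<in>(\<Union>i<length (copies t a). shift a i ` doors R t a i p). ?v x)"
    using finite_doors[OF R] by (intro sum.cong refl sum.UNION_disjoint[symmetric]) auto
  also have "\<dots> = (\<Sum>x\<in>box_nodes R t p. ?v x)"
    unfolding box_nodes_def
    using finite_doors[OF R] finite_boxes[OF R] by (intro sum.UNION_disjoint[symmetric]) auto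
  finally show ?thesis .
qed

lemma premises_empty: "wf_ps R \<Longrightarrow> lab (ground_of R) p \<notin> {LTensor, LPar, LQuest} \<Longrightarrow> premises_of (ground_of R) p = {}"
  using ground_ofD(3)[of R] by (auto simp: premises_of_def)

lemma bag_eq:
  assumes R: "wf_ps R" and e: "contents_agree R t e" and p: "p \<in> ports (ground_of R)" "lab (ground_of R) p \<in> {LBang, LQuest}"
  shows "node_val R t ([], p) = Bag ((\<Sum>w\<in>premises_of (ground_of R) p. {#node_val R t ([], w)#}) +
    (\<Sum>a\<in>boxes R. \<Sum>e'\<in>#box_exps e a. box_contribution R a e' p))"
proof -
  have P: "p \<in> inner_ports R" using p by (auto simp: inner_ports_def circ_ports_def)
  have fin: "finite (box_nodes R t p)"
    using finite_doors[OF R] finite_boxes[OF R] by (simp add: box_nodes_def)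
  have finp: "finite (premises_of (ground_of R) p)"
    using ground_ofD(1)[OF R] ground_ofD(2)[OF R] by (auto simp: premises_of_def intro: finite_subset)
  have "(\<Sum>x\<in>children R t ([], p). {#node_val R t x#}) =
    (\<Sum>x\<in>(\<lambda>w. ([], w)) ` premises_of (ground_of R) p. {#node_val R t x#}) + (\<Sum>x\<in>box_nodes R t p. {#node_val R t x#})"
    unfolding children_root[OF R P] using fin finp by (intro sum.union_disjoint) auto
  also have "(\<Sum>x\<in>(\<lambda>w. ([], w)) ` premises_of (ground_of R) p. {#node_val R t x#}) =
      (\<Sum>w\<in>premises_of (ground_of R) p. {#node_val R t ([], w)#})"
    by (subst sum.reindex) (auto simp: inj_on_def)
  finally show ?thesis using node_val_expo[OF R p] contributions_eq[OF R e] by simp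
qed

lemma circ_eq:
  assumes R: "wf_ps R" and e: "contents_agree R t e" and p: "p \<in> circ_ports R"
  shows "(\<Sum>x\<in>{x \<in> nodes R t. parent R x = Inr p}. {#node_val R t x#}) =
    (\<Sum>w\<in>premises_of (ground_of R) p. {#port_val e w#}) +
    (\<Sum>a\<in>boxes R. \<Sum>e'\<in>#box_exps e a. box_contribution R a e' p)"
  using premises_empty[OF R, of p] p box_nodes_circ[OF R p] contributions_eq[OF R e]
  by (simp add: circ_ports_def)

text \<open>Without axioms and cuts the values at units are forced, and every other value is
  determined by the boxes and by the values at the premises, whose types are smaller.\<close>

lemma experiment_agrees:
  assumes R: "wf_ps R" and e: "is_experiment R e" and c: "contents_agree R t e"
  shows "agrees R t e"
  unfolding agrees_def
proof (intro conjI ballI)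
  let ?G = "ground_of R"
  have ex: "\<And>p. p \<in> ports ?G \<Longrightarrow> port_val e p \<in> type_sem (ptype ?G p)"
     "\<And>p w1 w2. p \<in> ports ?G \<Longrightarrow> lab ?G p \<in> {LTensor, LPar} \<Longrightarrow>
       w1 \<in> left_premises ?G p \<Longrightarrow> w2 \<in> right_premises ?G p \<Longrightarrow>
       port_val e p = VPair (port_val e w1) (port_val e w2)"
     "\<And>p. p \<in> ports ?G \<Longrightarrow> lab ?G p \<in> {LBang, LQuest, LCirc} \<Longrightarrow>
       port_val e p =
         Bag ((\<Sum>w\<in>premises_of ?G p. {#port_val e w#}) +
              (\<Sum>a\<in>boxes R. \<Sum>e'\<in>#box_exps e a. box_contribution R a e' p))"
    using e by (cases, blast)+
  show "port_val e p = Bag (\<Sum>x\<in>{x \<in> nodes R t. parent R x = Inr p}. {#node_val R t x#})"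
    if p: "p \<in> circ_ports R" for p
    using circ_eq[OF R c p] ex(3)[of p] p by (simp add: circ_ports_def)
  show "port_val e p = node_val R t ([], p)" if "p \<in> inner_ports R" for p
    using that
  proof (induction "size (ptype ?G p)" arbitrary: p rule: less_induct)
    case less
    then have p: "p \<in> ports ?G" "lab ?G p \<noteq> LCirc" by (auto simp: inner_ports_def circ_ports_def)
    have prem: "w \<in> inner_ports R" if "w \<in> premises_of ?G p" for w
      using that ground_ofD(2)[OF R, of w] by (auto simp: premises_of_def inner_ports_def circ_ports_def)
    have l: "lab ?G p = type_lab (ptype ?G p)" by (rule lab_eq_type_lab[OF R less.prems])
    consider "lab ?G p \<in> {LTensor, LPar}" | "lab ?G p \<in> {LBang, LQuest}" | "lab ?G p \<in> {LOne, LBot}"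
      using p by (cases "lab ?G p") auto
    then show ?case
    proof cases
      case 1
      obtain u v where uv: "premises_of ?G p = {u, v}" "left_premises ?G p = {u}" "right_premises ?G p = {v}"
        using ground_ofD(5)[OF R p(1) 1] by (elim exE conjE) (rule that; assumption)
      obtain C D where CD: "ptype ?G p \<in> {TTensor C D, TPar C D}"
        using 1 l by (cases "ptype ?G p") auto
      have "ptype ?G u = C" "ptype ?G v = D" using premise_types[OF R p(1) 1 CD, of u v] uv(2,3) by simp_all
      then have "size (ptype ?G u) < size (ptype ?G p)" "size (ptype ?G v) < size (ptype ?G p)" using CD by auto
      moreover have "u \<in> inner_ports R" "v \<in> inner_ports R" using prem uv(1) by simp_all
      ultimately have "port_val e u = node_val R t ([], u)" "port_val e v = node_val R t ([], v)"
        using less.hyps by simp_all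
      then show ?thesis
        using ex(2)[OF p(1) 1, of u v] node_val_mult[OF R p(1) 1, of u v t] uv by simp
    next
      case 2
      have "port_val e w = node_val R t ([], w)" if w: "w \<in> premises_of ?G p" for w
      proof -
        have "lab ?G p = LQuest" using premises_empty[OF R, of p] w 2 by auto
        then have "ptype ?G p = TQuest (ptype ?G w)" using ground_ofD(12)[OF R p(1) _ w] by simp
        then show ?thesis using less.hyps[of w] prem[OF w] by simp
      qed
      then show ?thesis using ex(3)[OF p(1)] 2 bag_eq[OF R c p(1) 2] by auto
    next
      case 3
      then have "ptype ?G p \<in> {TOne, TBot}" using l by (cases "ptype ?G p") auto
      then show ?thesis using ex(1)[OF p(1)] by (auto simp: node_val_def)
    qed
  qed
qed

lemma experiment_shape:
  assumes "wf_ps R" "is_experiment R e"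
  shows "\<exists>t. agrees R t e"
  using assms
proof (induction arbitrary: e rule: wf_ps_induct)
  case (content R)
  have sub: "is_experiment (box_at R a) e'" if "a \<in> boxes R" "e' \<in># box_exps e a" for a e'
    using content.prems that by cases blast
  have "\<exists>ts es. box_exps e a = mset es \<and> length es = length ts \<and>
      (\<forall>i<length ts. agrees (box_at R a) (ts ! i) (es ! i))" if a: "a \<in> boxes R" for a
  proof -
    obtain es where es: "box_exps e a = mset es" by (metis ex_mset)
    then have "\<forall>e'\<in>set es. \<exists>t. agrees (box_at R a) t e'" using content.IH[OF a] sub[OF a] by simp
    then obtain f where f: "\<forall>e'\<in>set es. agrees (box_at R a) (f e') e'" by metis
    show ?thesis using es f by (intro exI[of _ "map f es"] exI[of _ es]) simp
  qed
  then obtain ts where ts: "\<And>a. a \<in> boxes R \<Longrightarrow> \<exists>es. box_exps e a = mset es \<and> length es = length (ts a) \<and>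
      (\<forall>i<length (ts a). agrees (box_at R a) (ts a ! i) (es ! i))"
    by metis
  then have "contents_agree R (Shape ts) e" by (simp add: contents_agree_def)
  then show ?case using experiment_agrees[OF content.hyps content.prems] by blast
qed

lemma shape_experiment:
  assumes "wf_ps R"
  shows "\<exists>e. is_experiment R e \<and> agrees R t e"
  using assms
proof (induction arbitrary: t rule: wf_ps_induct)
  case (content R)
  note R = content.hyps
  let ?G = "ground_of R"
  obtain f where f: "\<And>a u. a \<in> boxes R \<Longrightarrow> is_experiment (box_at R a) (f a u) \<and> agrees (box_at R a) u (f a u)"
    using content.IH by metis
  define e where "e = Exp (\<lambda>p. if p \<in> circ_ports R then Bag (\<Sum>x\<in>{x \<in> nodes R t. parent R x = Inr p}. {#node_val R t x#})
      else node_val R t ([], p)) (\<lambda>a. mset (map (f a) (copies t a)))"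
  have pv: "port_val e p = node_val R t ([], p)" if "p \<notin> circ_ports R" for p
    using that by (simp add: e_def)
  have pvc: "port_val e p = Bag (\<Sum>x\<in>{x \<in> nodes R t. parent R x = Inr p}. {#node_val R t x#})" if "p \<in> circ_ports R" for p
    using that by (simp add: e_def)
  have be: "box_exps e a = mset (map (f a) (copies t a))" for a by (simp add: e_def)
  have c: "contents_agree R t e"
    unfolding contents_agree_def
  proof
    fix a assume a: "a \<in> boxes R"
    show "\<exists>es. box_exps e a = mset es \<and> length es = length (copies t a) \<and>
        (\<forall>i<length (copies t a). agrees (box_at R a) (copies t a ! i) (es ! i))"
      using f[OF a] by (intro exI[of _ "map (f a) (copies t a)"]) (simp add: be)
  qed
  have prem: "w \<notin> circ_ports R" if "w \<in> premises_of ?G p" for w p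
    using that ground_ofD(2)[OF R, of w] by (auto simp: premises_of_def circ_ports_def)
  have "is_experiment R e"
  proof
    fix p assume p: "p \<in> ports ?G"
    show "port_val e p \<in> type_sem (ptype ?G p)"
    proof (cases "p \<in> circ_ports R")
      case True
      have "node_val R t x \<in> type_sem C" if "x \<in> nodes R t" "parent R x = Inr p" "ptype ?G p = TQuest C" for x C
        using parent_Inr_type[OF R that(1,2) True] that(3) forest_val_in_type_sem[of _ _ "node_type R x" x]
        by (simp add: node_val_def)
      moreover obtain C where "ptype ?G p = TQuest C"
        using ground_ofD(11)[OF R p] True by (auto simp: circ_ports_def)
      moreover have "finite (nodes R t)" by (rule finite_nodes[OF R])
      ultimately show ?thesis using pvc[OF True] by (auto simp flip: image_mset_as_sum)
    next
      case False
      then show ?thesis using pv[OF False] by (simp add: node_val_def forest_val_in_type_sem)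
    qed
  next
    fix a e' assume "a \<in> boxes R" "e' \<in># box_exps e a"
    then show "is_experiment (box_at R a) e'" using f by (auto simp: be)
  next
    fix p w1 w2 assume "p \<in> ports ?G" "lab ?G p \<in> {LTensor, LPar}" "w1 \<in> left_premises ?G p" "w2 \<in> right_premises ?G p"
    moreover from this have "p \<notin> circ_ports R" "w1 \<notin> circ_ports R" "w2 \<notin> circ_ports R"
      using prem by (auto simp: circ_ports_def left_premises_def right_premises_def)
    ultimately show "port_val e p = VPair (port_val e w1) (port_val e w2)"
      using node_val_mult[OF R] pv by simp
  next
    fix p assume p: "p \<in> ports ?G" "lab ?G p \<in> {LBang, LQuest, LCirc}"
    have pr: "(\<Sum>w\<in>premises_of ?G p. {#port_val e w#}) = (\<Sum>w\<in>premises_of ?G p. {#node_val R t ([], w)#})"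
      using prem pv by (intro sum.cong) auto
    show "port_val e p = Bag ((\<Sum>w\<in>premises_of ?G p. {#port_val e w#}) +
      (\<Sum>a\<in>boxes R. \<Sum>e'\<in>#box_exps e a. box_contribution R a e' p))"
    proof (cases "p \<in> circ_ports R")
      case True
      then show ?thesis using pvc[OF True] circ_eq[OF R c True] by simp
    next
      case False
      then have "lab ?G p \<in> {LBang, LQuest}" using p by (auto simp: circ_ports_def)
      then show ?thesis using bag_eq[OF R c p(1)] pv[OF False] pr by simp
    qed
  qed
  then show ?case using experiment_agrees[OF R _ c] by blast
qed

theorem interp_eq:
  assumes "wf_ps R" "circ_ports R = {}"
  shows "interp R = {restrict (\<lambda>p. node_val R t ([], p)) (conclusions R) | t. True}"
proof -
  have c: "restrict (port_val e) (conclusions R) = restrict (\<lambda>p. node_val R t ([], p)) (conclusions R)"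
    if "agrees R t e" for t e
    using that assms(2) by (intro restrict_ext) (auto simp: agrees_def conclusions_def inner_ports_def)
  show ?thesis
  proof (intro set_eqI iffI)
    fix x assume "x \<in> interp R"
    then obtain e where e: "is_experiment R e" "x = restrict (port_val e) (conclusions R)" by (auto simp: interp_def)
    then obtain t where "agrees R t e" using experiment_shape[OF assms(1)] by blast
    then show "x \<in> {restrict (\<lambda>p. node_val R t ([], p)) (conclusions R) | t. True}" using c e by auto
  next
    fix x assume "x \<in> {restrict (\<lambda>p. node_val R t ([], p)) (conclusions R) | t. True}"
    then obtain t where t: "x = restrict (\<lambda>p. node_val R t ([], p)) (conclusions R)" by auto
    obtain e where "is_experiment R e" "agrees R t e" using shape_experiment[OF assms(1)] by blast
    then show "x \<in> interp R" using c[of t e] t by (auto simp: interp_def intro!: exI[of _ e])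
  qed
qed


subsection \<open>Minimal unfoldings\<close>

text \<open>The structure comes last because the recursion passes through a list of shapes:
  \<open>map weight\<close> yields functions, which are then applied to the content of the box. The
  equations \<open>weight_eq\<close> and \<open>expo_eq\<close> hide this form.\<close>

primrec weight :: "'p shape \<Rightarrow> 'p cps \<Rightarrow> nat" where
  "weight (Shape f) R = card (inner_ports R) +
     (\<Sum>a\<in>boxes R. sum_list (map (\<lambda>g. g (box_at R a)) (map weight (f a))))"

text \<open>These are the ranks of all \<open>!\<close>-nodes of the unfolding, computed from the
  numbers of copies; \<open>expo_sum\<close> expresses them as a sum over nodes.\<close>

primrec expo :: "nat \<Rightarrow> 'p shape \<Rightarrow> 'p cps \<Rightarrow> nat multiset" where
  "expo k (Shape f) R = (\<Sum>a\<in>boxes R. {#multiplicity k (length (f a))#} +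
     sum_list (map (\<lambda>g. g (box_at R a)) (map (expo k) (f a))))"

definition box_weight :: "'p cps \<Rightarrow> 'p \<Rightarrow> 'p shape list \<Rightarrow> nat" where
  "box_weight R a L = (\<Sum>s\<leftarrow>L. weight s (box_at R a))"

definition box_expo :: "nat \<Rightarrow> 'p cps \<Rightarrow> 'p \<Rightarrow> 'p shape list \<Rightarrow> nat multiset" where
  "box_expo k R a L = {#multiplicity k (length L)#} + (\<Sum>s\<leftarrow>L. expo k s (box_at R a))"

lemma weight_eq: "weight t R = card (inner_ports R) + (\<Sum>a\<in>boxes R. box_weight R a (copies t a))"
  by (cases t) (simp add: box_weight_def comp_def)

lemma expo_eq: "expo k t R = (\<Sum>a\<in>boxes R. box_expo k R a (copies t a))"
  by (cases t) (simp add: box_expo_def comp_def)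

declare weight.simps [simp del] expo.simps [simp del]

text \<open>The competitors are restricted by their ranks so that the property is inherited by the
  contents of boxes: replacing a single copy by a competitor leaves all other ranks alone. Since
  \<open>distinct_expo\<close> passes to smaller multisets, a global minimum among the shapes with
  distinct positive ranks has this property.\<close>

definition locally_minimal :: "nat \<Rightarrow> 'p cps \<Rightarrow> 'p shape \<Rightarrow> bool" where
  "locally_minimal k R t \<longleftrightarrow> (\<forall>u. expo k u R \<subseteq># expo k t R \<longrightarrow> weight t R \<le> weight u R)"

definition distinct_expo :: "nat \<Rightarrow> 'p cps \<Rightarrow> 'p shape \<Rightarrow> bool" where
  "distinct_expo k R t \<longleftrightarrow> (\<forall>j. count (expo k t R) j \<le> 1) \<and> 0 \<notin># expo k t R"

lemma distinct_expo_mono: "distinct_expo k R t \<Longrightarrow> expo k u S \<subseteq># expo k t R \<Longrightarrow> distinct_expo k S u"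
  unfolding distinct_expo_def by (meson le_trans mset_subset_eq_count mset_subset_eqD)

lemma locally_minimalD:
  assumes R: "wf_ps R" and t: "locally_minimal k R t" and a: "a \<in> boxes R"
    and L: "box_expo k R a L \<subseteq># box_expo k R a (copies t a)"
  shows "box_weight R a (copies t a) \<le> box_weight R a L"
proof -
  define u where "u = Shape ((copies t)(a := L))"
  note fin = finite_boxes[OF R]
  have "expo k u R = box_expo k R a L + (\<Sum>b\<in>boxes R - {a}. box_expo k R b (copies t b))"
    unfolding expo_eq sum.remove[OF fin a] by (simp add: u_def)
  moreover have "expo k t R = box_expo k R a (copies t a) + (\<Sum>b\<in>boxes R - {a}. box_expo k R b (copies t b))"
    unfolding expo_eq sum.remove[OF fin a] by simp
  ultimately have "expo k u R \<subseteq># expo k t R" using L by simp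
  then have "weight t R \<le> weight u R" using t by (simp add: locally_minimal_def)
  moreover have "weight u R = card (inner_ports R) + box_weight R a L + (\<Sum>b\<in>boxes R - {a}. box_weight R b (copies t b))"
    unfolding weight_eq sum.remove[OF fin a] by (simp add: u_def)
  moreover have "weight t R = card (inner_ports R) + box_weight R a (copies t a) + (\<Sum>b\<in>boxes R - {a}. box_weight R b (copies t b))"
    unfolding weight_eq sum.remove[OF fin a] by simp
  ultimately show ?thesis by simp
qed

lemma locally_minimal_copy:
  assumes R: "wf_ps R" and t: "locally_minimal k R t" and a: "a \<in> boxes R" and s: "s \<in> set (copies t a)"
  shows "locally_minimal k (box_at R a) s"
  unfolding locally_minimal_def
proof (intro allI impI)
  fix u assume u: "expo k u (box_at R a) \<subseteq># expo k s (box_at R a)"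
  obtain xs ys where xy: "copies t a = xs @ s # ys" using split_list[OF s] by blast
  have "box_expo k R a (xs @ u # ys) \<subseteq># box_expo k R a (copies t a)"
    using u by (simp add: box_expo_def xy)
  then have "box_weight R a (copies t a) \<le> box_weight R a (xs @ u # ys)"
    by (rule locally_minimalD[OF R t a])
  then show "weight s (box_at R a) \<le> weight u (box_at R a)" by (simp add: box_weight_def xy)
qed

lemma box_expo_sub: "wf_ps R \<Longrightarrow> a \<in> boxes R \<Longrightarrow> box_expo k R a (copies t a) \<subseteq># expo k t R"
  unfolding expo_eq by (simp add: sum.remove[OF finite_boxes])

lemma member_sum_list_sub:
  fixes f :: "'a \<Rightarrow> 'b multiset"
  shows "x \<in> set xs \<Longrightarrow> f x \<subseteq># (\<Sum>y\<leftarrow>xs. f y)"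
  by (induction xs) (auto intro: subset_mset.add_increasing subset_mset.add_increasing2)

lemma copy_expo_sub:
  assumes "wf_ps R" "a \<in> boxes R" "s \<in> set (copies t a)"
  shows "expo k s (box_at R a) \<subseteq># expo k t R"
proof -
  have "expo k s (box_at R a) \<subseteq># (\<Sum>s\<leftarrow>copies t a. expo k s (box_at R a))"
    using member_sum_list_sub[OF assms(3)] .
  also have "\<dots> \<subseteq># box_expo k R a (copies t a)" by (simp add: box_expo_def)
  also have "\<dots> \<subseteq># expo k t R" by (rule box_expo_sub[OF assms(1,2)])
  finally show ?thesis .
qed

lemma weight_content_pos:
  assumes "wf_ps R" "a \<in> boxes R"
  shows "weight s (box_at R a) > 0"
proof -
  note wf = wf_psD(3)[OF assms]
  obtain q where "q \<in> bullet_conclusions (box_at R a)" using box_mapD(3)[OF assms] by blast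
  then have "q \<in> inner_ports (box_at R a)" using bullet_conclusions_sub[OF wf] by blast
  moreover have "finite (inner_ports (box_at R a))" using ground_ofD(1)[OF wf] by (simp add: inner_ports_def)
  ultimately show ?thesis by (auto simp: weight_eq card_gt_0_iff)
qed

lemma weight_copy_less:
  assumes R: "wf_ps R" and b: "b \<in> boxes R" and s: "s \<in> set (copies t b)" and ne: "inner_ports R \<noteq> {}"
  shows "weight s (box_at R b) < weight t R"
proof -
  have "weight s (box_at R b) \<le> box_weight R b (copies t b)"
    unfolding box_weight_def using s by (intro member_le_sum_list) auto
  also have "\<dots> \<le> (\<Sum>a\<in>boxes R. box_weight R a (copies t a))"
    using finite_boxes[OF R] b by (intro member_le_sum) auto
  also have "\<dots> < weight t R"
    using ne ground_ofD(1)[OF R] by (simp add: weight_eq inner_ports_def card_gt_0_iff)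
  finally show ?thesis .
qed

text \<open>The number of copies is a multiple of \<open>k ^ j\<close> for the rank
  \<open>j\<close>. Keeping only \<open>k ^ j\<close> of them preserves the rank of the box and
  loses only ranks inside the discarded copies, each of which has at least one node.\<close>

lemma minimal_copies_power:
  assumes R: "wf_ps R" and t: "locally_minimal k R t" and d: "distinct_expo k R t" and k: "prime k" and a: "a \<in> boxes R"
  shows "length (copies t a) = k ^ multiplicity k (length (copies t a))"
proof (rule ccontr)
  let ?n = "length (copies t a)" and ?j = "multiplicity k (length (copies t a))"
  let ?w = "\<lambda>s. weight s (box_at R a)"
  assume ne: "?n \<noteq> k ^ ?j"
  have "?j \<in># expo k t R" using mset_subset_eqD[OF box_expo_sub[OF R a]] by (auto simp: box_expo_def)
  then have "?j \<noteq> 0" using d by (metis distinct_expo_def)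
  \<comment> \<open>\<open>multiplicity k 0\<close> is 0, so a positive rank excludes a box without
    copies.\<close>
  then have n0: "?n > 0" by (cases "copies t a") auto
  have "k ^ ?j dvd ?n" by (rule multiplicity_dvd)
  then have le: "k ^ ?j < ?n" using ne n0 by (metis dvd_imp_le le_neq_implies_less)
  define L where "L = take (k ^ ?j) (copies t a)"
  have len: "length L = k ^ ?j" using le by (simp add: L_def)
  have app: "copies t a = L @ drop (k ^ ?j) (copies t a)" by (simp add: L_def)
  have "multiplicity k (length L) = ?j" using k by (simp add: len prime_multiplicity_other)
  moreover have "(\<Sum>s\<leftarrow>L. expo k s (box_at R a)) \<subseteq># (\<Sum>s\<leftarrow>copies t a. expo k s (box_at R a))"
    by (subst app) (simp only: map_append sum_list_append, simp)
  ultimately have "box_expo k R a L \<subseteq># box_expo k R a (copies t a)" by (simp add: box_expo_def)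
  then have "box_weight R a (copies t a) \<le> box_weight R a L" by (rule locally_minimalD[OF R t a])
  moreover have "box_weight R a (copies t a) = box_weight R a L + box_weight R a (drop (k ^ ?j) (copies t a))"
    unfolding box_weight_def by (subst app) (simp only: map_append sum_list_append)
  moreover have "box_weight R a (drop (k ^ ?j) (copies t a)) > 0"
  proof -
    obtain s rest where "drop (k ^ ?j) (copies t a) = s # rest" using le by (metis Cons_nth_drop_Suc)
    then show ?thesis using weight_content_pos[OF R a, of s] by (simp add: box_weight_def)
  qed
  ultimately show False by simp
qed

text \<open>If an inner box \<open>b\<close> had fewer copies than the box \<open>a\<close> around it, then one could exchange
  the two numbers of copies: each superfluous copy of the content of \<open>a\<close> contains a copy of the
  content of \<open>b\<close>, and it is enough to keep the latter.\<close>

lemma minimal_copies_nested: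
  assumes R: "wf_ps R" and t: "locally_minimal k R t" and d: "distinct_expo k R t"
    and a: "a \<in> boxes R" and s: "s \<in> set (copies t a)" and b: "b \<in> boxes (box_at R a)"
  shows "length (copies t a) \<le> length (copies s b)"
proof (rule ccontr)
  let ?S = "box_at R a"
  let ?l = "length (copies s b)" and ?n = "length (copies t a)"
  assume lt: "\<not> ?n \<le> ?l"
  note wf = wf_psD(3)[OF R a]
  have pos: "copies u b \<noteq> []" if "u \<in> set (copies t a)" for u
  proof -
    have "multiplicity k (length (copies u b)) \<in># expo k u ?S"
      using mset_subset_eqD[OF box_expo_sub[OF wf b]] by (auto simp: box_expo_def)
    then have "multiplicity k (length (copies u b)) \<in># expo k t R"
      using mset_subset_eqD[OF copy_expo_sub[OF R a that]] by blast
    then have "multiplicity k (length (copies u b)) \<noteq> 0" using d by (metis distinct_expo_def)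
    then show ?thesis by auto
  qed
  obtain xs ys where xy: "copies t a = xs @ s # ys" using split_list[OF s] by blast
  define M where "M = xs @ ys"
  \<comment> \<open>Besides \<open>s\<close>, the \<open>?l - 1\<close> copies in \<open>M1\<close>
    are kept; the \<open>?n - ?l\<close> copies in \<open>M2\<close> are given up.\<close>
  define M1 where "M1 = take (?l - 1) M"
  define M2 where "M2 = drop (?l - 1) M"
  have M: "M = M1 @ M2" by (simp add: M1_def M2_def)
  have l: "?l > 0" using pos[OF s] by simp
  have lM: "length M = ?n - 1" by (simp add: M_def xy)
  have lens: "length M1 = ?l - 1" "length M2 = ?n - ?l"
    using lt l lM by (auto simp: M1_def M2_def)
  have M2: "u \<in> set (copies t a)" if "u \<in> set M2" for u
    using set_drop_subset[of "?l - 1" M] that by (auto simp: M2_def M_def xy)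
  define h where "h u = hd (copies u b)" for u
  have h: "h u \<in> set (copies u b)" if "u \<in> set M2" for u using pos[OF M2[OF that]] by (simp add: h_def)
  \<comment> \<open>\<open>s'\<close> has \<open>?l + (?n - ?l) = ?n\<close> copies of the content
    of \<open>b\<close>, while the content of \<open>a\<close> is left with \<open>?l\<close>
    copies; so the two ranks change places.\<close>
  define s' where "s' = Shape ((copies s)(b := copies s b @ map h M2))"
  define L where "L = s' # M1"
  have lenL: "length L = ?l" using lens l by (simp add: L_def)
  have lens': "length (copies s' b) = ?n" using lens lt by (simp add: s'_def)
  let ?e = "\<lambda>u. expo k u ?S" and ?w = "\<lambda>u. weight u ?S"
  let ?eb = "\<lambda>u. expo k u (box_at ?S b)" and ?wb = "\<lambda>u. weight u (box_at ?S b)"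
  have fin: "finite (boxes ?S)" by (rule finite_boxes[OF wf])
  have es': "?e s' + {#multiplicity k ?l#} = ?e s + {#multiplicity k ?n#} + (\<Sum>u\<leftarrow>M2. ?eb (h u))"
    unfolding expo_eq[of k s'] expo_eq[of k s] sum.remove[OF fin b]
    using lens' by (simp add: box_expo_def s'_def comp_def)
  have ws': "?w s' = ?w s + (\<Sum>u\<leftarrow>M2. ?wb (h u))"
    unfolding weight_eq[of s'] weight_eq[of s] sum.remove[OF fin b]
    by (simp add: box_weight_def s'_def comp_def)
  have sum_perm: "(\<Sum>u\<leftarrow>copies t a. f u) = f s + (\<Sum>u\<leftarrow>M1. f u) + (\<Sum>u\<leftarrow>M2. f u)"
    for f :: "'a shape \<Rightarrow> 'b::comm_monoid_add"
  proof -
    have "(\<Sum>u\<leftarrow>copies t a. f u) = f s + (\<Sum>u\<leftarrow>M. f u)" by (simp add: xy M_def ac_simps)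
    then show ?thesis by (simp add: M ac_simps)
  qed
  have e2: "(\<Sum>u\<leftarrow>M2. ?eb (h u)) \<subseteq># (\<Sum>u\<leftarrow>M2. ?e u)"
    using h copy_expo_sub[OF wf b] by (induction M2) (auto intro: subset_mset.add_mono)
  have "box_expo k R a L = {#multiplicity k ?l#} + (?e s' + (\<Sum>u\<leftarrow>M1. ?e u))"
    by (simp add: box_expo_def lenL) (simp add: L_def)
  also have "\<dots> = {#multiplicity k ?n#} + ?e s + (\<Sum>u\<leftarrow>M1. ?e u) + (\<Sum>u\<leftarrow>M2. ?eb (h u))"
    using es' by (simp add: ac_simps)
  also have "\<dots> \<subseteq># {#multiplicity k ?n#} + ?e s + (\<Sum>u\<leftarrow>M1. ?e u) + (\<Sum>u\<leftarrow>M2. ?e u)"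
    using e2 by (intro subset_mset.add_mono) auto
  also have "\<dots> = box_expo k R a (copies t a)"
    by (simp add: box_expo_def sum_perm ac_simps)
  finally have "box_weight R a (copies t a) \<le> box_weight R a L" by (rule locally_minimalD[OF R t a])
  moreover have "box_weight R a (copies t a) = ?w s + (\<Sum>u\<leftarrow>M1. ?w u) + (\<Sum>u\<leftarrow>M2. ?w u)"
    by (simp add: box_weight_def sum_perm)
  moreover have "box_weight R a L = ?w s + (\<Sum>u\<leftarrow>M2. ?wb (h u)) + (\<Sum>u\<leftarrow>M1. ?w u)"
    by (simp add: box_weight_def L_def ws')
  \<comment> \<open>Strict because \<open>M2\<close> is nonempty and each copy given up loses its
    ports at depth 0, of which there is at least one.\<close>
  moreover have "(\<Sum>u\<leftarrow>M2. ?wb (h u)) < (\<Sum>u\<leftarrow>M2. ?w u)"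
  proof -
    obtain q where "q \<in> bullet_conclusions ?S" using box_mapD(3)[OF R a] by blast
    then have ne: "inner_ports ?S \<noteq> {}" using bullet_conclusions_sub[OF wf] by blast
    have "M2 \<noteq> []" using lens lt by auto
    then show ?thesis
      using h weight_copy_less[OF wf b _ ne]
    proof (induction M2 rule: list_nonempty_induct)
      case (cons x xs)
      then show ?case by (auto intro: add_strict_mono)
    qed auto
  qed
  ultimately show False by simp
qed


section \<open>Numbers of copies and ranks at the nodes of an unfolding\<close>

definition ncopies :: "'p shape \<Rightarrow> 'p node \<Rightarrow> nat" where
  "ncopies t x = length (copies (shape_at t (fst x)) (snd x))"

definition bangs :: "'p cps \<Rightarrow> 'p shape \<Rightarrow> 'p node set" where
  "bangs R t = {x \<in> nodes R t. node_lab R x = LBang}"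

lemma ncopies_simps [simp]:
  "ncopies t ([], a) = length (copies t a)"
  "ncopies t (shift a i x) = ncopies (copies t a ! i) x"
  by (simp_all add: ncopies_def)

lemma in_bangs_simps [simp]:
  "([], a) \<in> bangs R t \<longleftrightarrow> a \<in> boxes R"
  "shift a i x \<in> bangs R t \<longleftrightarrow> a \<in> boxes R \<and> i < length (copies t a) \<and> x \<in> bangs (box_at R a) (copies t a ! i)"
  by (auto simp: bangs_def boxes_def inner_ports_def circ_ports_def)

lemma bangs_eq:
  "bangs R t = (\<lambda>a. ([], a)) ` boxes R \<union>
     (\<Union>a\<in>boxes R. \<Union>i<length (copies t a). shift a i ` bangs (box_at R a) (copies t a ! i))"
proof (rule set_eqI)
  fix x show "x \<in> bangs R t \<longleftrightarrow> x \<in> (\<lambda>a. ([], a)) ` boxes R \<union>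
     (\<Union>a\<in>boxes R. \<Union>i<length (copies t a). shift a i ` bangs (box_at R a) (copies t a ! i))"
    by (cases x rule: node_cases) auto
qed

lemma finite_bangs: "wf_ps R \<Longrightarrow> finite (bangs R t)"
  using finite_nodes[of R t] by (simp add: bangs_def)

lemma sum_shift_union:
  fixes f :: "'p node \<Rightarrow> 'm::comm_monoid_add"
  assumes "finite A" "finite B" "\<And>a i. a \<in> B \<Longrightarrow> finite (C a i)"
  shows "(\<Sum>x\<in>(\<lambda>a. ([], a)) ` A \<union> (\<Union>a\<in>B. \<Union>i<n a. shift a i ` C a i). f x) =
    (\<Sum>a\<in>A. f ([], a)) + (\<Sum>a\<in>B. \<Sum>i<n a. \<Sum>x\<in>C a i. f (shift a i x))"
proof -
  have "(\<Sum>x\<in>(\<lambda>a. ([], a)) ` A \<union> (\<Union>a\<in>B. \<Union>i<n a. shift a i ` C a i). f x) =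
      sum f ((\<lambda>a. ([], a)) ` A) + sum f (\<Union>a\<in>B. \<Union>i<n a. shift a i ` C a i)"
    using assms by (intro sum.union_disjoint) auto
  also have "sum f ((\<lambda>a. ([], a)) ` A) = (\<Sum>a\<in>A. f ([], a))"
    by (subst sum.reindex) (auto simp: inj_on_def)
  also have "sum f (\<Union>a\<in>B. \<Union>i<n a. shift a i ` C a i) = (\<Sum>a\<in>B. sum f (\<Union>i<n a. shift a i ` C a i))"
    using assms by (intro sum.UNION_disjoint) auto
  also have "\<dots> = (\<Sum>a\<in>B. \<Sum>i<n a. sum f (shift a i ` C a i))"
    using assms by (intro sum.cong refl sum.UNION_disjoint) auto
  also have "\<dots> = (\<Sum>a\<in>B. \<Sum>i<n a. \<Sum>x\<in>C a i. f (shift a i x))"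
    by (intro sum.cong refl sum.reindex_cong[of "shift _ _"] inj_on_subset[OF inj_shift]) auto
  finally show ?thesis .
qed

lemma sum_list_map_nth: "(\<Sum>s\<leftarrow>L. f s) = (\<Sum>i<length L. f (L ! i))"
  by (simp add: sum_list_sum_nth atLeast0LessThan)

lemma weight_card: "wf_ps R \<Longrightarrow> weight t R = card (nodes R t)"
proof (induction arbitrary: t rule: wf_ps_induct)
  case (content R)
  have fin: "finite (inner_ports R)" "finite (boxes R)" "\<And>a i. a \<in> boxes R \<Longrightarrow> finite (nodes (box_at R a) (copies t a ! i))"
    using ground_ofD(1)[OF content.hyps] finite_boxes[OF content.hyps] finite_nodes[OF wf_psD(3)[OF content.hyps]]
    by (auto simp: inner_ports_def)
  have "card (nodes R t) = (\<Sum>x\<in>nodes R t. 1)" by simp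
  also have "\<dots> = (\<Sum>a\<in>inner_ports R. 1) +
      (\<Sum>a\<in>boxes R. \<Sum>i<length (copies t a). \<Sum>x\<in>nodes (box_at R a) (copies t a ! i). 1)"
    by (subst nodes_eq) (rule sum_shift_union[OF fin])
  also have "\<dots> = card (inner_ports R) + (\<Sum>a\<in>boxes R. \<Sum>i<length (copies t a). card (nodes (box_at R a) (copies t a ! i)))"
    by simp
  also have "\<dots> = weight t R"
    by (subst weight_eq, unfold box_weight_def sum_list_map_nth, intro arg_cong2[where f = "(+)"] sum.cong refl) (simp add: content.IH)
  finally show ?case by simp
qed

lemma expo_sum: "wf_ps R \<Longrightarrow> expo k t R = (\<Sum>x\<in>bangs R t. {#multiplicity k (ncopies t x)#})"
proof (induction arbitrary: t rule: wf_ps_induct)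
  case (content R)
  have fin: "finite (boxes R)" "finite (boxes R)" "\<And>a i. a \<in> boxes R \<Longrightarrow> finite (bangs (box_at R a) (copies t a ! i))"
    using finite_boxes[OF content.hyps] finite_bangs[OF wf_psD(3)[OF content.hyps]] by auto
  have "(\<Sum>x\<in>bangs R t. {#multiplicity k (ncopies t x)#}) =
     (\<Sum>a\<in>boxes R. {#multiplicity k (ncopies t ([], a))#}) + (\<Sum>a\<in>boxes R. \<Sum>i<length (copies t a).
       \<Sum>x\<in>bangs (box_at R a) (copies t a ! i). {#multiplicity k (ncopies t (shift a i x))#})"
    by (subst bangs_eq) (rule sum_shift_union[OF fin])
  also have "\<dots> = (\<Sum>a\<in>boxes R. {#multiplicity k (length (copies t a))#}) +
     (\<Sum>a\<in>boxes R. \<Sum>i<length (copies t a). expo k (copies t a ! i) (box_at R a))"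
    using content.IH by simp
  also have "\<dots> = expo k t R"
    by (subst expo_eq, unfold box_expo_def sum_list_map_nth sum.distrib, rule refl)
  finally show ?case by simp
qed

lemma distinct_expo_iff:
  assumes "wf_ps R"
  shows "distinct_expo k R t \<longleftrightarrow> inj_on (\<lambda>x. multiplicity k (ncopies t x)) (bangs R t) \<and>
    (\<forall>x\<in>bangs R t. multiplicity k (ncopies t x) \<noteq> 0)"
proof -
  let ?X = "\<lambda>x. multiplicity k (ncopies t x)"
  have fin: "finite (bangs R t)" by (rule finite_bangs[OF assms])
  have e: "expo k t R = image_mset ?X (mset_set (bangs R t))"
    using expo_sum[OF assms] image_mset_as_sum[OF fin] by metis
  have "(\<forall>j. count (expo k t R) j \<le> 1) \<longleftrightarrow> (\<forall>j. card {x \<in> bangs R t. ?X x = j} \<le> 1)"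
    unfolding e count_image_mset_set[OF fin] ..
  also have "\<dots> \<longleftrightarrow> inj_on ?X (bangs R t)"
    using fin by (auto simp: card_le_Suc0_iff_eq inj_on_def)
  finally show ?thesis using fin by (auto simp: distinct_expo_def e)
qed

text \<open>Numbers of copies can be prescribed freely, since the prescription for a box mentions
  only the path to it, which is fixed before its content is unfolded. \<open>\<pi>\<close> is the
  path travelled so far and varies in the induction.\<close>

lemma exists_shape_ncopies:
  assumes "wf_ps R"
  shows "\<exists>t. \<forall>x\<in>bangs R t. ncopies t x = n (\<pi> @ fst x, snd x)"
  using assms
proof (induction arbitrary: \<pi> rule: wf_ps_induct)
  case (content R)
  have "\<forall>a i. \<exists>t. a \<in> boxes R \<longrightarrow> (\<forall>x\<in>bangs (box_at R a) t. ncopies t x = n ((\<pi> @ [(a, i)]) @ fst x, snd x))"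
    using content.IH by blast
  then obtain f where f: "\<And>a i x. a \<in> boxes R \<Longrightarrow> x \<in> bangs (box_at R a) (f a i) \<Longrightarrow>
      ncopies (f a i) x = n ((\<pi> @ [(a, i)]) @ fst x, snd x)" unfolding choice_iff by blast
  define t where "t = Shape (\<lambda>a. map (f a) [0..<n (\<pi>, a)])"
  have "ncopies t x = n (\<pi> @ fst x, snd x)" if "x \<in> bangs R t" for x
    using that by (cases x rule: node_cases) (auto simp: t_def f)
  then show ?case by blast
qed

text \<open>The finite set must not depend on the shape, because the shape is chosen afterwards from
  a coding of these names.\<close>

lemma finite_port_names:
  assumes "wf_ps R"
  shows "\<exists>P. finite P \<and> (\<forall>t. \<forall>x\<in>nodes R t. fst ` set (fst x) \<subseteq> P \<and> snd x \<in> P)"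
  using assms
proof (induction rule: wf_ps_induct)
  case (content R)
  have "\<forall>a\<in>boxes R. \<exists>P. finite P \<and> (\<forall>t. \<forall>x\<in>nodes (box_at R a) t. fst ` set (fst x) \<subseteq> P \<and> snd x \<in> P)"
    using content.IH by blast
  from bchoice[OF this] obtain f where
    F: "\<forall>a\<in>boxes R. finite (f a) \<and> (\<forall>t. \<forall>x\<in>nodes (box_at R a) t. fst ` set (fst x) \<subseteq> f a \<and> snd x \<in> f a)" ..
  have f: "finite (f a)" "x \<in> nodes (box_at R a) t \<Longrightarrow> fst ` set (fst x) \<subseteq> f a \<and> snd x \<in> f a"
    if "a \<in> boxes R" for a t x
    using F that by simp_all
  let ?P = "ports (ground_of R) \<union> (\<Union>a\<in>boxes R. f a)"
  have "finite ?P" using ground_ofD(1)[OF content.hyps] finite_boxes[OF content.hyps] f(1) by auto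
  moreover have "fst ` set (fst x) \<subseteq> ?P \<and> snd x \<in> ?P" if "x \<in> nodes R t" for t x
  proof (cases x rule: node_cases)
    case (1 p)
    then show ?thesis using that by (auto simp: inner_ports_def)
  next
    case (2 a i y)
    then have a: "a \<in> boxes R" and y: "y \<in> nodes (box_at R a) (copies t a ! i)" using that by auto
    have "a \<in> ports (ground_of R)" using a by (simp add: boxes_def)
    then show ?thesis using f(2)[OF a y] a 2 by auto
  qed
  ultimately show ?case by (intro exI[of _ ?P]) simp
qed

lemma exists_distinct_expo:
  assumes R: "wf_ps R" and k: "prime k"
  shows "\<exists>t. distinct_expo k R t"
proof -
  obtain P where P: "finite P" "\<And>t x. x \<in> nodes R t \<Longrightarrow> fst ` set (fst x) \<subseteq> P \<and> snd x \<in> P"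
    using finite_port_names[OF R] by blast
  obtain c :: "'a \<Rightarrow> nat" where c: "inj_on c P"
    using finite_imp_inj_to_nat_seg[OF P(1)] by blast
  \<comment> \<open>Ports come from an arbitrary type, so they are first numbered by
    \<open>c\<close>. The code of a node becomes its rank; \<open>Suc\<close> makes it
    positive.\<close>
  define code where "code x = Suc (to_nat (map (map_prod c id) (fst x), c (snd x)))" for x :: "'a node"
  obtain t where t: "\<And>x. x \<in> bangs R t \<Longrightarrow> ncopies t x = k ^ code x"
    using exists_shape_ncopies[OF R, of "\<lambda>x. k ^ code x" "[]"] by auto
  have m: "multiplicity k (ncopies t x) = code x" if "x \<in> bangs R t" for x
    using t[OF that] k by (simp add: prime_multiplicity_other)
  have "inj_on code (bangs R t)"
  proof (rule inj_onI)
    fix x y assume xy: "x \<in> bangs R t" "y \<in> bangs R t" "code x = code y"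
    have Px: "fst ` set (fst x) \<subseteq> P" "snd x \<in> P" "fst ` set (fst y) \<subseteq> P" "snd y \<in> P"
      using P(2)[of x t] P(2)[of y t] xy(1,2) unfolding bangs_def by blast+
    have eq: "map (map_prod c id) (fst x) = map (map_prod c id) (fst y)" "c (snd x) = c (snd y)"
      using xy(3) by (auto simp: code_def)
    have "inj_on (map_prod c (id :: nat \<Rightarrow> nat)) (P \<times> UNIV)"
      using c by (intro map_prod_inj_on) auto
    moreover have "set (fst x) \<subseteq> P \<times> UNIV" "set (fst y) \<subseteq> P \<times> UNIV" using Px by force+
    ultimately have "inj_on (map_prod c (id :: nat \<Rightarrow> nat)) (set (fst x) \<union> set (fst y))"
      by (meson inj_on_subset Un_least)
    then have "fst x = fst y" using eq(1) by (simp only: inj_on_map_eq_map)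
    moreover have "snd x = snd y" using eq(2) c Px by (auto simp: inj_on_def)
    ultimately show "x = y" by (simp add: prod_eq_iff)
  qed
  then have "inj_on (\<lambda>x. multiplicity k (ncopies t x)) (bangs R t)"
    using m by (simp add: inj_on_def)
  then have "distinct_expo k R t"
    unfolding distinct_expo_iff[OF R] using m by (simp add: code_def)
  then show ?thesis ..
qed


subsection \<open>Closing boxes by decreasing rank\<close>

context gluing begin

text \<open>Brings the decompositions of two isomorphic stages onto the same vertex set, as
  \<open>cancel_copies\<close> requires.\<close>

lemma decomp_pullback:
  assumes G': "gluing V' B'" and D': "gluing.decomp V' E' L' B' n G' C'"
    and h: "bij_betw h V V'" "\<And>x. x \<in> V \<Longrightarrow> L' (h x) = L x"
      "\<And>e x y. x \<in> V \<Longrightarrow> y \<in> V \<Longrightarrow> E' e (h x) (h y) = E e x y"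
    and B: "\<And>x. x \<in> V \<Longrightarrow> h x \<in> B' \<longleftrightarrow> x \<in> B"
  shows "decomp n {x \<in> V. h x \<in> G'} (\<lambda>i. {x \<in> V. h x \<in> C' i})"
proof -
  interpret A': gluing V' E' L' B' by (rule G')
  note D = A'.decompD[OF D']
  have hV: "h x \<in> V'" if "x \<in> V" for x using bij_betw_apply[OF h(1) that] .
  define g where "g = inv_into V h"
  have g: "g x' \<in> V" "h (g x') = x'" if "x' \<in> V'" for x'
    using that h(1) bij_betw_apply[OF bij_betw_inv_into[OF h(1)] that] bij_betw_inv_into_right[OF h(1) that]
    by (simp_all add: g_def)
  have gh: "g (h x) = x" if "x \<in> V" for x using bij_betw_inv_into_left[OF h(1) that] by (simp add: g_def)
  show ?thesis
    unfolding decomp_def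
  proof (intro conjI allI impI ballI)
    show "B \<subseteq> {x \<in> V. h x \<in> G'}" using B_sub B D(1) by auto
    show "V = {x \<in> V. h x \<in> G'} \<union> (\<Union>i<n. {x \<in> V. h x \<in> C' i})" using hV D(2) by auto
    show "{x \<in> V. h x \<in> G'} \<inter> {x \<in> V. h x \<in> C' i} = {}" if "i < n" for i
      using D(3)[OF that] by auto
    show "{x \<in> V. h x \<in> C' i} \<inter> {x \<in> V. h x \<in> C' j} = {}" if "i < n" "j < n" "i \<noteq> j" for i j
      using D(4)[OF that] by auto
    have "h ` {x \<in> V. h x \<in> G'} \<subseteq> G'" by auto
    moreover have "inj_on h {x \<in> V. h x \<in> G'}" using h(1) by (auto simp: bij_betw_def inj_on_def)
    moreover have "finite G'" using A'.fin D(2) by auto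
    ultimately have "card {x \<in> V. h x \<in> G'} \<le> card G'" by (intro card_inj_on_le)
    then show "card {x \<in> V. h x \<in> G'} < n" using D(7) by simp
    show "y \<in> {x \<in> V. h x \<in> C' i} \<union> B"
      if "i < n" "x \<in> {x \<in> V. h x \<in> C' i}" "y \<in> V" "E e x y \<or> E e y x" for i e x y
      using D(5)[of i "h x" "h y" e] that h(3)[of x y e] h(3)[of y x e] hV[of y] B[of y] by auto
    fix i assume i: "i < n"
    have CV: "C' i \<subseteq> V'" "C' 0 \<subseteq> V'" using D(2) i by auto
    obtain f where f: "A'.rel_iso (C' 0) (C' i) f" using D(6)[OF i] by blast
    note f' = A'.rel_isoD[OF f]
    have fV: "f (h x) \<in> V'" "h x \<in> V'" "f (h x) \<in> C' i" if "x \<in> {x \<in> V. h x \<in> C' 0}" for x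
      using f'(2)[of "h x"] that CV by auto
    have sub: "E e (g (f (h x))) (g (f (h y))) = E e x y" if "x \<in> {x \<in> V. h x \<in> C' 0}" "y \<in> {x \<in> V. h x \<in> C' 0}" for e x y
      using h(3)[of "g (f (h x))" "g (f (h y))" e] h(3)[of x y e] f'(4)[of "h x" "h y" e] g fV[OF that(1)] fV[OF that(2)] that
      by simp
    have "rel_iso {x \<in> V. h x \<in> C' 0} {x \<in> V. h x \<in> C' i} (g \<circ> f \<circ> h)"
    proof (rule rel_isoI)
      have "bij_betw h {x \<in> V. h x \<in> C' 0} (C' 0)"
        using h(1) CV g by (intro bij_betw_byWitness[where f' = g]) (auto simp: gh)
      moreover have "bij_betw g (C' i) {x \<in> V. h x \<in> C' i}"
        using CV g hV by (intro bij_betw_byWitness[where f' = h]) (auto simp: gh)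
      ultimately show "bij_betw (g \<circ> f \<circ> h) {x \<in> V. h x \<in> C' 0} {x \<in> V. h x \<in> C' i}"
        using f'(1) by (intro bij_betw_trans)
      show "L ((g \<circ> f \<circ> h) x) = L x" if "x \<in> {x \<in> V. h x \<in> C' 0}" for x
        using h(2)[of "g (f (h x))"] h(2)[of x] f'(3)[of "h x"] g fV[OF that] that by simp
      show "E e ((g \<circ> f \<circ> h) x) ((g \<circ> f \<circ> h) y) = E e x y"
        if "x \<in> {x \<in> V. h x \<in> C' 0}" "y \<in> {x \<in> V. h x \<in> C' 0}" for e x y
        using sub[OF that] by simp
      show "E e ((g \<circ> f \<circ> h) x) b = E e x b" if "x \<in> {x \<in> V. h x \<in> C' 0}" "b \<in> B" for e x b
        using h(3)[of "g (f (h x))" b e] h(3)[of x b e] f'(5)[of "h x" "h b" e] g fV[OF that(1)] that B B_sub by auto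
      show "E e b ((g \<circ> f \<circ> h) x) = E e b x" if "x \<in> {x \<in> V. h x \<in> C' 0}" "b \<in> B" for e x b
        using h(3)[of b "g (f (h x))" e] h(3)[of b x e] f'(6)[of "h x" "h b" e] g fV[OF that(1)] that B B_sub by auto
    qed
    then show "\<exists>g. rel_iso {x \<in> V. h x \<in> C' 0} {x \<in> V. h x \<in> C' i} g" by blast
  qed
qed

end

section \<open>Paths, their prefixes, and positions\<close>

lemma at_append [simp]: "at R (\<pi> @ \<rho>) = at (at R \<pi>) \<rho>"
  by (induction R \<pi> rule: at.induct) auto

lemma shape_at_append [simp]: "shape_at t (\<pi> @ \<rho>) = shape_at (shape_at t \<pi>) \<rho>"
  by (induction t \<pi> rule: shape_at.induct) auto

lemma valid_path_append [simp]:
  "valid_path R t (\<pi> @ \<rho>) \<longleftrightarrow> valid_path R t \<pi> \<and> valid_path (at R \<pi>) (shape_at t \<pi>) \<rho>"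
  by (induction R t \<pi> rule: valid_path.induct) auto

lemma wf_at: "wf_ps R \<Longrightarrow> valid_path R t \<pi> \<Longrightarrow> wf_ps (at R \<pi>)"
  by (induction R t \<pi> rule: valid_path.induct) (auto dest: wf_psD(3))

lemma bangs_iff: "x \<in> bangs R t \<longleftrightarrow> valid_path R t (fst x) \<and> snd x \<in> boxes (at R (fst x))"
  by (cases x) (auto simp: bangs_def nodes_def node_lab_def boxes_def inner_ports_def circ_ports_def)

lemma nodes_iff: "x \<in> nodes R t \<longleftrightarrow> valid_path R t (fst x) \<and> snd x \<in> inner_ports (at R (fst x))"
  by (cases x) (simp add: nodes_def)

text \<open>Follows an edge that has left, through its conclusion \<open>q\<close>, the structure at
  the end of the path. With it, \<open>parent_append\<close> splits the computation of a parent at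
  any point of a path.\<close>

fun path_exit :: "'p cps \<Rightarrow> ('p \<times> nat) list \<Rightarrow> 'p \<Rightarrow> 'p node + 'p" where
  "path_exit R [] q = Inr q"
| "path_exit R ((a, i) # \<pi>) q =
     (case path_exit (box_at R a) \<pi> q of Inl y \<Rightarrow> Inl (shift a i y) | Inr r \<Rightarrow> exit R (box_map R a r))"

lemma parent_append:
  "parent R (\<rho> @ \<pi>, p) =
    (case parent (at R \<rho>) (\<pi>, p) of Inl y \<Rightarrow> Inl (\<rho> @ fst y, snd y) | Inr q \<Rightarrow> path_exit R \<rho> q)"
proof (induction R \<rho> rule: at.induct)
  case (2 R a i \<rho>)
  then show ?case by (auto simp: parent_def shift_def split: sum.splits)
qed (simp split: sum.splits)

lemma path_exit_prefix: "path_exit R \<rho> q = Inl y \<Longrightarrow> \<exists>\<sigma>. \<rho> = fst y @ \<sigma>"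
proof (induction R \<rho> q arbitrary: y rule: path_exit.induct)
  case (2 R a i \<rho> q)
  show ?case
  proof (cases "path_exit (box_at R a) \<rho> q")
    case (Inl z)
    then show ?thesis using 2 by auto
  next
    case (Inr r)
    then show ?thesis using 2 by auto
  qed
qed simp

text \<open>Edges only lead out of boxes, never into them. In particular all children of a node in a
  copy lie in the same copy.\<close>

lemma parent_prefix: "parent R x = Inl y \<Longrightarrow> \<exists>\<sigma>. fst x = fst y @ \<sigma>"
proof -
  assume y: "parent R x = Inl y"
  have "parent R (fst x @ [], snd x) = parent R x" by simp
  then show ?thesis
    using y path_exit_prefix[of R "fst x" _ y]
    unfolding parent_append by (auto simp: parent_def split: sum.splits if_splits)
qed

fun zero_path :: "'p cps \<Rightarrow> ('p \<times> nat) list \<Rightarrow> bool" where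
  "zero_path R [] \<longleftrightarrow> True"
| "zero_path R ((a, i) # \<pi>) \<longleftrightarrow> a \<in> boxes R \<and> i = 0 \<and> zero_path (box_at R a) \<pi>"

text \<open>One node for each port of \<open>R\<close>, at any depth, that is not a circle: the
  fully closed structure, encoded by the copies with index \<open>0\<close>. Its cardinality is the
  size that \<open>k\<close> has to exceed.\<close>

definition positions :: "'p cps \<Rightarrow> 'p node set" where
  "positions R = {x. zero_path R (fst x) \<and> snd x \<in> inner_ports (at R (fst x))}"

lemma positions_eq:
  "positions R = (\<lambda>p. ([], p)) ` inner_ports R \<union> (\<Union>a\<in>boxes R. shift a 0 ` positions (box_at R a))"
proof (rule set_eqI)
  fix x show "x \<in> positions R \<longleftrightarrow> x \<in> (\<lambda>p. ([], p)) ` inner_ports R \<union> (\<Union>a\<in>boxes R. shift a 0 ` positions (box_at R a))"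
    by (cases x rule: node_cases) (auto simp: positions_def)
qed

lemma finite_positions: "wf_ps R \<Longrightarrow> finite (positions R)"
proof (induction rule: wf_ps_induct)
  case (content R)
  have "finite (inner_ports R)" using ground_ofD(1)[OF content.hyps] by (simp add: inner_ports_def)
  then show ?case using content finite_boxes[OF content.hyps] by (subst positions_eq) auto
qed

lemma zero_path_append [simp]: "zero_path R (\<pi> @ \<rho>) \<longleftrightarrow> zero_path R \<pi> \<and> zero_path (at R \<pi>) \<rho>"
  by (induction R \<pi> rule: zero_path.induct) auto

lemma zero_path_valid:
  assumes "\<And>x. x \<in> bangs R t \<Longrightarrow> 0 < ncopies t x" "zero_path R \<pi>"
  shows "valid_path R t \<pi>"
  using assms
proof (induction R t \<pi> rule: valid_path.induct)
  case (2 R t a i \<pi>)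
  then have a: "a \<in> boxes R" "i = 0" "zero_path (box_at R a) \<pi>" by auto
  have len: "0 < length (copies t a)" using 2(2)[of "([], a)"] a by simp
  have "0 < ncopies (copies t a ! i) x" if "x \<in> bangs (box_at R a) (copies t a ! i)" for x
    using 2(2)[of "shift a i x"] that a len by simp
  then show ?case using 2(1) a len by simp
qed simp

definition zero_indices :: "('p \<times> nat) list \<Rightarrow> ('p \<times> nat) list" where
  "zero_indices \<pi> = map (\<lambda>(a, i). (a, 0)) \<pi>"

lemma at_zero_indices [simp]: "at R (zero_indices \<pi>) = at R \<pi>"
  by (induction R \<pi> rule: at.induct) (auto simp: zero_indices_def)

lemma zero_path_zero_indices: "valid_path R t \<pi> \<Longrightarrow> zero_path R (zero_indices \<pi>)"
  by (induction R t \<pi> rule: valid_path.induct) (auto simp: zero_indices_def)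

lemma card_positions_content:
  assumes "wf_ps R" "valid_path R t \<rho>" "a \<in> boxes (at R \<rho>)"
  shows "card (positions (box_at (at R \<rho>) a)) \<le> card (positions R)"
proof (rule card_inj_on_le)
  show "inj_on (\<lambda>x. (zero_indices \<rho> @ (a, 0) # fst x, snd x)) (positions (box_at (at R \<rho>) a))"
    by (auto simp: inj_on_def prod_eq_iff)
  show "(\<lambda>x. (zero_indices \<rho> @ (a, 0) # fst x, snd x)) ` positions (box_at (at R \<rho>) a) \<subseteq> positions R"
    using zero_path_zero_indices[OF assms(2)] assms(3) by (auto simp: positions_def)
qed (rule finite_positions[OF assms(1)])

section \<open>The children of a \<open>!\<close>-node\<close>

lemma children_root_bang:
  assumes R: "wf_ps R" and a: "a \<in> boxes R"
  shows "children R t ([], a) = (\<lambda>(i, q). ([(a, i)], q)) `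
    ({..<length (copies t a)} \<times> {q \<in> bullet_conclusions (box_at R a). box_map R a q = a})"
proof -
  have A: "a \<in> inner_ports R" "lab (ground_of R) a = LBang"
    using a by (auto simp: boxes_def inner_ports_def circ_ports_def)
  let ?Q = "{q \<in> bullet_conclusions (box_at R a). box_map R a q = a}"
  have doors: "y \<in> doors R t b i a \<longleftrightarrow> b = a \<and> (\<exists>q\<in>?Q. y = ([], q))" if b: "b \<in> boxes R" for b i y
  proof
    assume "y \<in> doors R t b i a"
    then obtain q where y: "y \<in> nodes (box_at R b) (copies t b ! i)" "parent (box_at R b) y = Inr q" "box_map R b q = a"
      by (auto simp: doors_def)
    note wf = wf_psD(3)[OF R b]
    have q: "q \<in> conclusions (box_at R b)" by (rule parent_Inr_conclusion[OF wf y(1,2)])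
    then have "b = a" using box_mapD(1)[OF R b q] y(3) A by auto
    moreover have "q \<notin> circ_ports (box_at R b)" using box_mapD(2)[OF R b, of q] y(3) A by auto
    ultimately show "b = a \<and> (\<exists>q\<in>?Q. y = ([], q))" using parent_Inr[OF wf y(1,2)] y(3) by auto
  next
    assume "b = a \<and> (\<exists>q\<in>?Q. y = ([], q))"
    then show "y \<in> doors R t b i a"
      using bullet_conclusions_eq[OF wf_psD(3)[OF R a]] by (auto simp: doors_def)
  qed
  have "children R t ([], a) = box_nodes R t a"
    unfolding children_root[OF R A(1)] using premises_empty[OF R, of a] A by simp
  moreover have "x \<in> box_nodes R t a \<longleftrightarrow> x \<in> (\<lambda>(i, q). ([(a, i)], q)) ` ({..<length (copies t a)} \<times> ?Q)" for x
  proof (cases x rule: node_cases)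
    case (2 b i y)
    have sh: "shift b i y = ([(a, j)], q) \<longleftrightarrow> b = a \<and> i = j \<and> y = ([], q)" for j q
      by (auto simp: shift_def prod_eq_iff)
    have im: "z \<in> (\<lambda>(i, q). ([(a, i)], q)) ` ({..<length (copies t a)} \<times> ?Q) \<longleftrightarrow>
        (\<exists>j<length (copies t a). \<exists>q\<in>?Q. z = ([(a, j)], q))" for z :: "'a node" by auto
    show ?thesis
    proof (cases "b = a")
      case True
      then show ?thesis using a doors[OF a] unfolding 2 im sh in_box_nodes_simps by auto
    next
      case False
      then show ?thesis using doors[of b] unfolding 2 im sh in_box_nodes_simps by auto
    qed
  qed auto
  ultimately show ?thesis by blast
qed

text \<open>Their number is the factor between copies and children. Circles cannot occur among them,
  because a box map never sends a circle to a \<open>!\<close>-port.\<close>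

definition principal_doors :: "'p cps \<Rightarrow> 'p node \<Rightarrow> 'p set" where
  "principal_doors R v = {q \<in> bullet_conclusions (box_at (at R (fst v)) (snd v)).
     box_map (at R (fst v)) (snd v) q = snd v}"

lemma children_bang:
  assumes "wf_ps R" "v \<in> bangs R t"
  shows "children R t v = (\<lambda>(i, q). (fst v @ [(snd v, i)], q)) ` ({..<ncopies t v} \<times> principal_doors R v)"
  using assms
proof (induction arbitrary: t v rule: wf_ps_induct)
  case (content R)
  show ?case
  proof (cases v rule: node_cases)
    case (1 a)
    then show ?thesis using children_root_bang[OF content.hyps, of a t] content.prems by (simp add: principal_doors_def)
  next
    case (2 a i w)
    then have a: "a \<in> boxes R" "i < length (copies t a)" "w \<in> bangs (box_at R a) (copies t a ! i)"
      using content.prems by auto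
    show ?thesis
      unfolding 2 ncopies_simps using content.IH[OF a(1,3)] children_shift[OF a(1,2), of w]
      by (simp add: principal_doors_def shift_def image_image case_prod_beta)
  qed
qed

lemma finite_principal_doors:
  assumes "wf_ps R" "v \<in> bangs R t"
  shows "finite (principal_doors R v)"
proof -
  have "wf_ps (box_at (at R (fst v)) (snd v))"
    using assms(2) wf_psD(3)[OF wf_at[OF assms(1), of t "fst v"], of "snd v"] by (simp add: bangs_iff)
  from ground_ofD(1)[OF this] show ?thesis
    by (simp add: principal_doors_def bullet_conclusions_def conclusions_def)
qed

lemma card_principal_doors:
  assumes R: "wf_ps R" and v: "v \<in> bangs R t"
  shows "1 \<le> card (principal_doors R v)" "card (principal_doors R v) \<le> card (positions R)"
proof -
  let ?S = "at R (fst v)" and ?B = "box_at (at R (fst v)) (snd v)"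
  have v': "valid_path R t (fst v)" "snd v \<in> boxes ?S" using v by (auto simp: bangs_iff)
  have S: "wf_ps ?S" by (rule wf_at[OF R v'(1)])
  have B: "wf_ps ?B" by (rule wf_psD(3)[OF S v'(2)])
  have "principal_doors R v \<noteq> {}" using box_mapD(3)[OF S v'(2)] by (auto simp: principal_doors_def)
  then show "1 \<le> card (principal_doors R v)" using finite_principal_doors[OF R v] by (simp add: Suc_le_eq card_gt_0_iff)
  have "principal_doors R v \<subseteq> inner_ports ?B"
    using bullet_conclusions_sub[OF B] by (auto simp: principal_doors_def)
  then have "(\<lambda>q. ([], q)) ` principal_doors R v \<subseteq> positions ?B" by (auto simp: positions_def)
  then have "card ((\<lambda>q. ([], q) :: 'a node) ` principal_doors R v) \<le> card (positions ?B)"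
    by (rule card_mono[OF finite_positions[OF B]])
  then have "card (principal_doors R v) \<le> card (positions ?B)" by (simp add: card_image inj_on_def)
  also have "\<dots> \<le> card (positions R)" by (rule card_positions_content[OF R v'])
  finally show "card (principal_doors R v) \<le> card (positions R)" .
qed

lemma card_children_bang:
  assumes "wf_ps R" "v \<in> bangs R t"
  shows "card (children R t v) = ncopies t v * card (principal_doors R v)"
  unfolding children_bang[OF assms]
  by (subst card_image) (auto simp: inj_on_def card_cartesian_product)

text \<open>The number of principal doors lies strictly between 0 and the prime \<open>k\<close>, so
  it contributes no factor \<open>k\<close>. This makes ranks visible on the forest, where only
  children can be counted.\<close>

lemma multiplicity_children_bang:
  assumes "wf_ps R" "v \<in> bangs R t" "prime k" "card (positions R) < k"
  shows "multiplicity k (card (children R t v)) = multiplicity k (ncopies t v)"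
proof (cases "ncopies t v = 0")
  case False
  have "\<not> k dvd card (principal_doors R v)"
    using card_principal_doors[OF assms(1,2)] assms(4) by (auto dest: dvd_imp_le)
  then have "multiplicity k (card (principal_doors R v)) = 0" by (rule not_dvd_imp_multiplicity_0)
  then show ?thesis
    using False card_principal_doors(1)[OF assms(1,2)] assms(3)
    by (simp add: card_children_bang[OF assms(1,2)] prime_elem_multiplicity_mult_distrib)
qed (simp add: card_children_bang[OF assms(1,2)])

section \<open>Nesting of boxes and partially closed unfoldings\<close>

definition in_box :: "'p node \<Rightarrow> 'p node \<Rightarrow> bool" where
  "in_box x v \<longleftrightarrow> (\<exists>i. fst x = fst v @ [(snd v, i)])"

definition through :: "'p node \<Rightarrow> nat \<Rightarrow> 'p node \<Rightarrow> bool" where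
  "through v i x \<longleftrightarrow> (\<exists>\<sigma>. fst x = fst v @ (snd v, i) # \<sigma>)"

lemma through_bang:
  assumes "x \<in> nodes R t" "through v i x"
  shows "v \<in> bangs R t" "i < ncopies t v"
  using assms by (auto simp: through_def bangs_iff nodes_iff ncopies_def)

lemma in_box_through: "in_box x v \<longleftrightarrow> (\<exists>i. through v i x \<and> length (fst x) = Suc (length (fst v)))"
  by (auto simp: in_box_def through_def)

text \<open>\<open>power\<close> and \<open>nested\<close> are what is extracted from minimality;
  \<open>minimal_expanded\<close> derives them. \<open>nested\<close> concerns immediate nesting and
  is extended to all depths by \<open>rank_through\<close>.\<close>

locale expanded =
  fixes R :: "'p cps" and t :: "'p shape" and k :: nat
  assumes wf: "wf_ps R" and k: "prime k" and small: "card (positions R) < k"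
    and distinct: "distinct_expo k R t"
    and power: "v \<in> bangs R t \<Longrightarrow> ncopies t v = k ^ multiplicity k (ncopies t v)"
    and nested: "v \<in> bangs R t \<Longrightarrow> w \<in> bangs R t \<Longrightarrow> in_box w v \<Longrightarrow>
      multiplicity k (ncopies t v) < multiplicity k (ncopies t w)"
begin

abbreviation "rank v \<equiv> multiplicity k (ncopies t v)"

text \<open>
  At stage \<open>j\<close> the boxes of rank greater than \<open>j\<close> are closed, which is encoded by keeping their copy
  with index \<open>0\<close> only and remembering, as \<open>link j False\<close>, the closed box around a node.
\<close>

definition stage :: "nat \<Rightarrow> 'p node set" where
  "stage j = {x \<in> nodes R t. \<forall>v i. through v i x \<longrightarrow> j < rank v \<longrightarrow> i = 0}"

definition link :: "nat \<Rightarrow> bool \<Rightarrow> 'p node \<Rightarrow> 'p node \<Rightarrow> bool" where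
  "link j e x y \<longleftrightarrow> (if e then parent R x = Inl y else in_box x y \<and> j < rank y)"

text \<open>The third component ties every root to its conclusion, so that isomorphisms of stages
  fix the conclusions. Port labels are absent because types determine them.\<close>

definition label :: "'p node \<Rightarrow> mell_type \<times> bool \<times> 'p option" where
  "label x = (node_type R x, is_left R x, case parent R x of Inl _ \<Rightarrow> None | Inr p \<Rightarrow> Some p)"

lemma k2: "2 \<le> k" using k by (rule prime_ge_2_nat)

lemma inj_rank: "v \<in> bangs R t \<Longrightarrow> w \<in> bangs R t \<Longrightarrow> rank v = rank w \<Longrightarrow> v = w"
  and rank_pos: "v \<in> bangs R t \<Longrightarrow> 0 < rank v"
  using distinct unfolding distinct_expo_iff[OF wf] by (auto simp: inj_on_def)

lemma ncopies_pos: "v \<in> bangs R t \<Longrightarrow> 0 < ncopies t v"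
  using power[of v] k2 by (metis gr0I power_not_zero not_numeral_le_zero)

lemma rank_through:
  assumes w: "w \<in> bangs R t" and v: "through v i w"
  shows "rank v < rank w"
proof -
  obtain \<sigma> where \<sigma>: "fst w = fst v @ (snd v, i) # \<sigma>" using v by (auto simp: through_def)
  from w \<sigma> show ?thesis
  proof (induction \<sigma> arbitrary: w rule: rev_induct)
    case Nil
    then have "through v i w" "in_box w v" by (auto simp: through_def in_box_def)
    then show ?case using nested[of v w] Nil through_bang(1)[of w R t v i] by (auto simp: bangs_def)
  next
    case (snoc s \<sigma>)
    define u where "u = (fst v @ (snd v, i) # \<sigma>, fst s)"
    have iw: "in_box w u" using snoc.prems by (auto simp: in_box_def u_def prod_eq_iff)
    then obtain i' where "through u i' w" by (auto simp: in_box_through)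
    then have u: "u \<in> bangs R t" using through_bang(1)[of w R t u i'] snoc.prems(1) by (simp add: bangs_def)
    have "rank v < rank u" by (rule snoc.IH[OF u]) (simp add: u_def)
    also have "rank u < rank w" by (rule nested[OF u snoc.prems(1) iw])
    finally show ?case .
  qed
qed

lemma stageD: "x \<in> stage j \<Longrightarrow> through v i x \<Longrightarrow> j < rank v \<Longrightarrow> i = 0"
  unfolding stage_def by blast

lemma stage_sub: "stage j \<subseteq> nodes R t" by (auto simp: stage_def)

lemma finite_stage: "finite (stage j)" using finite_subset[OF stage_sub finite_nodes[OF wf]] .

text \<open>All boxes around \<open>v\<close> have smaller rank, hence rank at most
  \<open>j\<close>, and are still open. In particular the node of the box of rank
  \<open>Suc j\<close> is present both before and after this box is closed.\<close>

lemma bang_in_stage: "v \<in> bangs R t \<Longrightarrow> rank v \<le> Suc j \<Longrightarrow> v \<in> stage j"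
  using rank_through[of v] by (fastforce simp: stage_def bangs_def)

lemma stage_prefix:
  assumes "x \<in> stage j" "y \<in> nodes R t" "fst x = fst y @ \<sigma>"
  shows "y \<in> stage j"
  using assms by (fastforce simp: stage_def through_def)

lemma parent_stage:
  assumes "x \<in> stage j" "parent R x = Inl y"
  shows "y \<in> stage j"
proof -
  have "y \<in> nodes R t" using parent_in_nodes[OF wf] assms stage_sub by blast
  then show ?thesis using stage_prefix[OF assms(1)] parent_prefix[OF assms(2)] by blast
qed

lemma in_box_stage:
  assumes "x \<in> stage j" "in_box x v"
  shows "v \<in> stage j" "v \<in> bangs R t"
proof -
  obtain i where "through v i x" using assms(2) by (auto simp: in_box_through)
  then show v: "v \<in> bangs R t" using through_bang(1)[of x R t v i] assms(1) stage_sub by blast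
  then have "v \<in> nodes R t" by (simp add: bangs_def)
  then show "v \<in> stage j" using stage_prefix[OF assms(1), of v] assms(2) by (auto simp only: in_box_def)
qed

lemma stage_children_bang:
  assumes v: "v \<in> bangs R t" "v \<in> stage j"
  shows "card {x \<in> stage j. parent R x = Inl v} = (if j < rank v then 1 else ncopies t v) * card (principal_doors R v)"
proof -
  let ?n = "if j < rank v then 1 else ncopies t v"
  have "{x \<in> stage j. parent R x = Inl v} = (\<lambda>(i, q). (fst v @ [(snd v, i)], q)) ` ({..<?n} \<times> principal_doors R v)"
  proof (intro set_eqI iffI)
    fix x assume x: "x \<in> {x \<in> stage j. parent R x = Inl v}"
    then have "x \<in> children R t v" using stage_sub by (auto simp: children_def)
    then obtain i q where iq: "x = (fst v @ [(snd v, i)], q)" "i < ncopies t v" "q \<in> principal_doors R v"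
      unfolding children_bang[OF wf v(1)] by auto
    then have "through v i x" by (simp add: through_def)
    then have "i < ?n" using stageD[of x j v i] x iq(2) by auto
    then show "x \<in> (\<lambda>(i, q). (fst v @ [(snd v, i)], q)) ` ({..<?n} \<times> principal_doors R v)" using iq by auto
  next
    fix x assume "x \<in> (\<lambda>(i, q). (fst v @ [(snd v, i)], q)) ` ({..<?n} \<times> principal_doors R v)"
    then obtain i q where iq: "x = (fst v @ [(snd v, i)], q)" "i < ?n" "q \<in> principal_doors R v" by auto
    then have "i < ncopies t v" using ncopies_pos[OF v(1)] by (auto split: if_splits)
    then have x: "x \<in> nodes R t" "parent R x = Inl v"
      using iq children_bang[OF wf v(1)] by (auto simp: children_def)
    have "i' = 0" if w: "through w i' x" "j < rank w" for w i'
    proof (cases "w = v \<and> i' = i")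
      case True
      then show ?thesis using iq w by auto
    next
      case False
      obtain \<sigma> where \<sigma>: "fst v @ [(snd v, i)] = fst w @ (snd w, i') # \<sigma>" using w iq by (auto simp: through_def)
      then have "through w i' v"
        using False by (cases \<sigma> rule: rev_cases) (auto simp: through_def prod_eq_iff)
      then show ?thesis using stageD[OF v(2)] w(2) by blast
    qed
    then show "x \<in> {x \<in> stage j. parent R x = Inl v}" using x by (auto simp: stage_def)
  qed
  then show ?thesis by (simp add: card_image inj_on_def card_cartesian_product)
qed

text \<open>A closed box shows a single copy of its principal doors, fewer than \<open>k\<close>,
  and an open box of rank below \<open>j\<close> shows fewer than \<open>k ^ j\<close> children. So
  the box of rank \<open>j\<close> is recognised by its number of children, which isomorphisms of
  stages preserve.\<close>

lemma rank_eq_iff_children: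
  assumes v: "v \<in> bangs R t" "v \<in> stage j" and j: "0 < j"
  shows "k ^ j \<le> card {x \<in> stage j. parent R x = Inl v} \<longleftrightarrow> rank v = j"
proof -
  let ?m = "card (principal_doors R v)"
  have m: "1 \<le> ?m" "?m < k" using card_principal_doors[OF wf v(1)] small by auto
  show ?thesis
  proof (cases "j < rank v")
    case True
    have "?m < k ^ j" using m(2) k2 j self_le_power[of k j] by linarith
    then show ?thesis using True stage_children_bang[OF v] by simp
  next
    case False
    have c: "card {x \<in> stage j. parent R x = Inl v} = k ^ rank v * ?m"
      using False stage_children_bang[OF v] power[OF v(1)] by simp
    show ?thesis
    proof (cases "rank v = j")
      case True
      then show ?thesis using c m(1) by simp
    next
      case False
      then have "Suc (rank v) \<le> j" using \<open>\<not> j < rank v\<close> by simp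
      then have "k ^ Suc (rank v) \<le> k ^ j" using k2 by (intro power_increasing) auto
      moreover have "k ^ rank v * ?m < k ^ Suc (rank v)" using m(2) k2 by simp
      ultimately have "k ^ rank v * ?m < k ^ j" by (rule less_le_trans[rotated])
      then show ?thesis using c False by simp
    qed
  qed
qed

end

section \<open>A single copy of the content of a box\<close>

definition embed :: "'p node \<Rightarrow> nat \<Rightarrow> 'p node \<Rightarrow> 'p node" where
  "embed v i y = (fst v @ (snd v, i) # fst y, snd y)"

definition content :: "'p cps \<Rightarrow> 'p node \<Rightarrow> 'p cps" where
  "content R v = box_at (at R (fst v)) (snd v)"

text \<open>The copy index does not occur: an edge that leaves the content arrives at the same place
  from every copy. Hence the target of such an edge has many children.\<close>

definition outer :: "'p cps \<Rightarrow> 'p node \<Rightarrow> 'p \<Rightarrow> 'p node + 'p" where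
  "outer R v q = (case exit (at R (fst v)) (box_map (at R (fst v)) (snd v) q) of
     Inl z \<Rightarrow> Inl (fst v @ fst z, snd z) | Inr r \<Rightarrow> path_exit R (fst v) r)"

lemma embed_eq_iff [simp]: "embed v i y = embed v i' y' \<longleftrightarrow> i = i' \<and> y = y'"
  by (auto simp: embed_def prod_eq_iff)

lemma parent_embed:
  "parent R (embed v i y) =
    (case parent (content R v) y of Inl z \<Rightarrow> Inl (embed v i z) | Inr q \<Rightarrow> outer R v q)"
proof -
  have "parent R (embed v i y) = (case parent (at R (fst v)) (shift (snd v) i y) of
      Inl z \<Rightarrow> Inl (fst v @ fst z, snd z) | Inr q \<Rightarrow> path_exit R (fst v) q)"
    unfolding embed_def parent_append by (simp only: shift_def)
  then show ?thesis
    by (simp add: content_def outer_def embed_def exit_def split: sum.splits)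
qed

lemma outer_prefix:
  assumes "outer R v q = Inl z" shows "\<exists>\<sigma>. fst v = fst z @ \<sigma>"
proof (cases "exit (at R (fst v)) (box_map (at R (fst v)) (snd v) q)")
  case (Inl y)
  then have "fst y = []" by simp
  moreover have "z = (fst v @ fst y, snd y)" using assms unfolding outer_def Inl by simp
  ultimately show ?thesis by simp
next
  case (Inr r)
  have "path_exit R (fst v) r = Inl z" using assms unfolding outer_def Inr by simp
  then show ?thesis by (rule path_exit_prefix)
qed

lemma through_embed_self: "through v i (embed v i' y) \<longleftrightarrow> i = i'"
  by (auto simp: through_def embed_def)

lemma through_unique: "through v i x \<Longrightarrow> through v i' x \<Longrightarrow> i = i'"
  by (auto simp: through_def)

lemma through_eq_embed: "through v i x \<longleftrightarrow> (\<exists>y. x = embed v i y)"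
proof
  assume "through v i x"
  then obtain \<sigma> where "fst x = fst v @ (snd v, i) # \<sigma>" by (auto simp: through_def)
  then have "x = embed v i (\<sigma>, snd x)" by (simp add: embed_def prod_eq_iff)
  then show "\<exists>y. x = embed v i y" ..
qed (auto simp: through_def embed_def)

lemma outer_not_through: "outer R v q = Inl z \<Longrightarrow> \<not> through v i z"
  using outer_prefix[of R v q z] by (auto simp: through_def)

lemma through_prefix: "through v i y \<Longrightarrow> fst x = fst y @ \<sigma> \<Longrightarrow> through v i x"
  by (auto simp: through_def)

text \<open>The box \<open>w\<close> lies around \<open>v\<close>, is \<open>v\<close> itself, or
  lies inside the copy, according to which of the two decompositions of the path is cut
  first.\<close>

lemma through_embed_cases:
  assumes "through w i' (embed v i y)"
  obtains "through w i' v" | "w = v" "i' = i" | \<sigma> where "fst w = fst v @ (snd v, i) # \<sigma>" "through (\<sigma>, snd w) i' y"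
proof -
  obtain \<tau> where \<tau>: "fst v @ (snd v, i) # fst y = fst w @ (snd w, i') # \<tau>"
    using assms by (auto simp: through_def embed_def)
  from \<tau>[unfolded append_eq_append_conv2] obtain us where
    "fst v = fst w @ us \<and> us @ (snd v, i) # fst y = (snd w, i') # \<tau> \<or>
     fst v @ us = fst w \<and> (snd v, i) # fst y = us @ (snd w, i') # \<tau>" by blast
  then show ?thesis
  proof
    assume us: "fst v = fst w @ us \<and> us @ (snd v, i) # fst y = (snd w, i') # \<tau>"
    show ?thesis
    proof (cases us)
      case Nil
      then show ?thesis using us that(2) by (auto simp: prod_eq_iff)
    next
      case (Cons s us')
      then have "through w i' v" using us by (auto simp: through_def)
      then show ?thesis by (rule that(1))
    qed
  next
    assume us: "fst v @ us = fst w \<and> (snd v, i) # fst y = us @ (snd w, i') # \<tau>"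
    show ?thesis
    proof (cases us)
      case Nil
      then show ?thesis using us that(2) by (auto simp: prod_eq_iff)
    next
      case (Cons s us')
      then have "fst w = fst v @ (snd v, i) # us'" "through (us', snd w) i' y"
        using us by (auto simp: through_def)
      then show ?thesis by (rule that(3))
    qed
  qed
qed

lemma zero_pathI:
  assumes "valid_path S s \<sigma>" "\<And>\<sigma>1 a i \<sigma>2. \<sigma> = \<sigma>1 @ (a, i) # \<sigma>2 \<Longrightarrow> i = 0"
  shows "zero_path S \<sigma>"
  using assms
proof (induction S s \<sigma> rule: valid_path.induct)
  case (2 R t a i \<pi>)
  have "i = 0" using "2.prems"(2)[of "[]"] by simp
  moreover have "zero_path (box_at R a) \<pi>"
    using 2 by (metis append_Cons valid_path.simps(2))
  ultimately show ?case using 2 by simp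
qed simp

lemma in_box_embed: "in_box y y' \<Longrightarrow> in_box (embed v i y) (embed v i y')"
  by (auto simp: in_box_def embed_def)

lemma in_box_embed_cases:
  assumes "in_box (embed v i y) z"
  shows "(fst y = [] \<and> z = v) \<or> (\<exists>y'. in_box y y' \<and> z = embed v i y')"
proof -
  obtain i' where i': "fst v @ (snd v, i) # fst y = fst z @ [(snd z, i')]"
    using assms by (auto simp: in_box_def embed_def)
  show ?thesis
  proof (cases "fst y" rule: rev_cases)
    case Nil
    then show ?thesis using i' by (auto simp: prod_eq_iff)
  next
    case (snoc \<sigma> s)
    then have "in_box y (\<sigma>, snd z)" "z = embed v i (\<sigma>, snd z)"
      using i' by (auto simp: in_box_def embed_def prod_eq_iff)
    then show ?thesis by blast
  qed
qed

section \<open>Copies and rest at the stage where a box is due\<close>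

context expanded begin

definition copy_nodes :: "nat \<Rightarrow> 'p node \<Rightarrow> nat \<Rightarrow> 'p node set" where
  "copy_nodes j v i = {x \<in> stage j. through v i x}"

definition rest :: "nat \<Rightarrow> 'p node \<Rightarrow> 'p node set" where
  "rest j v = {x \<in> stage j. \<forall>i. \<not> through v i x}"

text \<open>The boundary for closing the box of rank \<open>j\<close>. The threshold is reached by
  this box and by every node to which its copies attach, but by no node inside a copy.\<close>

definition crit :: "nat \<Rightarrow> 'p node set" where
  "crit j = {x \<in> stage j. k ^ j \<le> card {y \<in> stage j. parent R y = Inl x}}"

text \<open>All ranks are positive, so at stage 0 every box is closed.\<close>

lemma stage_0: "stage 0 = positions R"
proof (intro set_eqI iffI)
  fix x assume x: "x \<in> stage 0"
  then have n: "x \<in> nodes R t" using stage_sub by blast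
  have "zero_path R (fst x)"
  proof (rule zero_pathI)
    show "valid_path R t (fst x)" using n by (simp add: nodes_iff)
    fix \<sigma>1 a i \<sigma>2 assume "fst x = \<sigma>1 @ (a, i) # \<sigma>2"
    then have th: "through (\<sigma>1, a) i x" by (simp add: through_def)
    then show "i = 0" using stageD[OF x th] rank_pos[OF through_bang(1)[OF n th]] by blast
  qed
  then show "x \<in> positions R" using n by (simp add: positions_def nodes_iff)
next
  fix x assume x: "x \<in> positions R"
  then have "x \<in> nodes R t"
    using zero_path_valid[of R t "fst x"] ncopies_pos by (simp add: positions_def nodes_iff)
  moreover have "i = 0" if "through v i x" for v i
    using that x by (auto simp: through_def positions_def)
  ultimately show "x \<in> stage 0" by (simp add: stage_def)
qed

text \<open>Boxes inside \<open>v\<close> have larger rank and are closed by now, so each copy of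
  the content is folded up completely.\<close>

lemma copy_nodes_eq:
  assumes v: "v \<in> bangs R t" and i: "i < k ^ rank v"
  shows "copy_nodes (rank v) v i = embed v i ` positions (content R v)"
proof (intro set_eqI iffI)
  fix x assume "x \<in> copy_nodes (rank v) v i"
  then have x: "x \<in> stage (rank v)" "through v i x" by (auto simp: copy_nodes_def)
  then obtain y where y: "x = embed v i y" by (auto simp: through_eq_embed)
  have n: "x \<in> nodes R t" using x(1) stage_sub by blast
  have "zero_path (content R v) (fst y)"
  proof (rule zero_pathI)
    show "valid_path (content R v) (copies (shape_at t (fst v)) (snd v) ! i) (fst y)"
      using n by (simp add: nodes_iff y embed_def content_def)
    fix \<sigma>1 a i' \<sigma>2 assume s: "fst y = \<sigma>1 @ (a, i') # \<sigma>2"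
    let ?w = "(fst v @ (snd v, i) # \<sigma>1, a)"
    have th: "through ?w i' x" using s by (simp add: through_def y embed_def)
    have "through v i ?w" by (simp add: through_def)
    then have "rank v < rank ?w" using rank_through through_bang(1)[OF n th] by blast
    then show "i' = 0" using stageD[OF x(1) th] by blast
  qed
  then have "y \<in> positions (content R v)"
    using n by (simp add: positions_def nodes_iff y embed_def content_def)
  then show "x \<in> embed v i ` positions (content R v)" using y by blast
next
  fix x assume "x \<in> embed v i ` positions (content R v)"
  then obtain y where y: "x = embed v i y" "y \<in> positions (content R v)" by blast
  let ?s = "copies (shape_at t (fst v)) (snd v) ! i"
  have vv: "valid_path R t (fst v)" "snd v \<in> boxes (at R (fst v))" using v by (auto simp: bangs_iff)
  have i': "i < length (copies (shape_at t (fst v)) (snd v))" using i power[OF v] by (simp add: ncopies_def)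
  have "0 < ncopies ?s u" if "u \<in> bangs (content R v) ?s" for u
  proof -
    have "embed v i u \<in> bangs R t" using that vv i' by (simp add: bangs_iff embed_def content_def)
    then show ?thesis using ncopies_pos[of "embed v i u"] by (simp add: ncopies_def embed_def)
  qed
  then have "valid_path (content R v) ?s (fst y)"
    using y(2) by (intro zero_path_valid) (auto simp: positions_def)
  then have n: "x \<in> nodes R t" using y vv i' by (simp add: nodes_iff embed_def content_def positions_def)
  have "i' = 0" if w: "through w i' x" "rank v < rank w" for w i'
  proof -
    have wb: "w \<in> bangs R t" by (rule through_bang(1)[OF n w(1)])
    from w(1)[unfolded y(1)] show ?thesis
    proof (cases rule: through_embed_cases)
      case 1
      then show ?thesis using rank_through[OF v] w(2) by fastforce
    next
      case 2
      then show ?thesis using w(2) by simp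
    next
      case (3 \<sigma>)
      then show ?thesis using y(2) by (auto simp: through_def positions_def)
    qed
  qed
  then show "x \<in> copy_nodes (rank v) v i"
    using n y(1) by (auto simp: copy_nodes_def stage_def through_embed_self)
qed

lemma stage_split:
  assumes v: "v \<in> bangs R t"
  shows "stage (rank v) = rest (rank v) v \<union> (\<Union>i<k ^ rank v. copy_nodes (rank v) v i)"
proof -
  have "i < k ^ rank v" if "x \<in> stage (rank v)" "through v i x" for x i
    using through_bang(2)[of x R t v i] that stage_sub power[OF v] by auto
  then show ?thesis by (auto simp: rest_def copy_nodes_def)
qed

text \<open>Closing \<open>v\<close> keeps its copy \<open>0\<close>. As ranks are distinct, no
  other box has rank \<open>Suc j\<close>, and nothing else changes between the two stages.\<close>

lemma stage_pred:
  assumes v: "v \<in> bangs R t" and j: "rank v = Suc j"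
  shows "stage j = rest (Suc j) v \<union> copy_nodes (Suc j) v 0"
proof (intro set_eqI iffI)
  fix x assume x: "x \<in> stage j"
  then have "x \<in> stage (Suc j)" unfolding stage_def by auto
  moreover have "i = 0" if "through v i x" for i using stageD[OF x that] j by simp
  ultimately show "x \<in> rest (Suc j) v \<union> copy_nodes (Suc j) v 0"
    by (auto simp: rest_def copy_nodes_def)
next
  fix x assume "x \<in> rest (Suc j) v \<union> copy_nodes (Suc j) v 0"
  then have x: "x \<in> stage (Suc j)" "\<And>i. through v i x \<Longrightarrow> i = 0"
    using through_unique[of v _ x 0] by (auto simp: rest_def copy_nodes_def)
  have n: "x \<in> nodes R t" using x(1) stage_sub by blast
  have "i = 0" if w: "through w i x" "j < rank w" for w i
  proof (cases "rank w = Suc j")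
    case True
    then have "w = v" using inj_rank[OF through_bang(1)[OF n w(1)] v] j by simp
    then show ?thesis using x(2) w(1) by simp
  next
    case False
    then show ?thesis using stageD[OF x(1) w(1)] w(2) by simp
  qed
  then show "x \<in> stage j" using n by (simp add: stage_def)
qed

lemma no_rank:
  assumes "\<And>v. v \<in> bangs R t \<Longrightarrow> rank v \<noteq> Suc j"
  shows "stage j = stage (Suc j)" and "x \<in> nodes R t \<Longrightarrow> link j e x y \<longleftrightarrow> link (Suc j) e x y"
proof -
  have r: "j < rank w \<longleftrightarrow> Suc j < rank w" if "x \<in> nodes R t" "through w i x" for x w i
    using assms[OF through_bang(1)[OF that]] by linarith
  show "stage j = stage (Suc j)" unfolding stage_def using r by blast
  show "link j e x y \<longleftrightarrow> link (Suc j) e x y" if "x \<in> nodes R t"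
    unfolding link_def in_box_through using r[OF that] by (cases e) (simp_all, blast)
qed

lemma card_content_less: "v \<in> bangs R t \<Longrightarrow> card (positions (content R v)) < k"
  using card_positions_content[OF wf, of t "fst v" "snd v"] small by (simp add: bangs_iff content_def)

lemma finite_content_positions: "v \<in> bangs R t \<Longrightarrow> finite (positions (content R v))"
  using finite_positions[OF wf_psD(3)[OF wf_at[OF wf, of t "fst v"], of "snd v"]] by (simp add: bangs_iff content_def)

lemma card_stage: "card (stage j) < k ^ Suc j"
proof (induction j)
  case 0
  then show ?case using small by (simp add: stage_0)
next
  case (Suc j)
  show ?case
  proof (cases "\<exists>v\<in>bangs R t. rank v = Suc j")
    case False
    then have "stage j = stage (Suc j)" using no_rank(1)[of j] by blast
    then have "card (stage (Suc j)) < k ^ Suc j" using Suc.IH by simp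
    also have "\<dots> \<le> k ^ Suc (Suc j)" using k2 by (intro power_increasing) auto
    finally show ?thesis .
  next
    case True
    then obtain v where v: "v \<in> bangs R t" "rank v = Suc j" by blast
    have fin: "finite (copy_nodes (Suc j) v i)" "finite (rest (Suc j) v)" for i
      using finite_stage by (auto simp: copy_nodes_def rest_def)
    have "card (copy_nodes (Suc j) v i) \<le> k - 1" if "i < k ^ Suc j" for i
    proof -
      have "card (copy_nodes (Suc j) v i) \<le> card (positions (content R v))"
        using copy_nodes_eq[OF v(1), of i] that v(2) by (simp add: card_image_le finite_content_positions[OF v(1)])
      then show ?thesis using card_content_less[OF v(1)] by simp
    qed
    then have "(\<Sum>i<k ^ Suc j. card (copy_nodes (Suc j) v i)) \<le> (\<Sum>i<k ^ Suc j. k - 1)"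
      by (intro sum_mono) auto
    moreover have "card (\<Union>i<k ^ Suc j. copy_nodes (Suc j) v i) \<le> (\<Sum>i<k ^ Suc j. card (copy_nodes (Suc j) v i))"
      by (rule card_UN_le) simp
    moreover have "card (rest (Suc j) v) < k ^ Suc j"
      using Suc.IH card_mono[OF finite_stage[of j], of "rest (Suc j) v"] stage_pred[OF v] by simp
    moreover have "card (stage (Suc j)) \<le> card (rest (Suc j) v) + card (\<Union>i<k ^ Suc j. copy_nodes (Suc j) v i)"
      using stage_split[OF v(1)] v(2) card_Un_le by metis
    \<comment> \<open>The rest is part of \<open>stage j\<close>, which the induction hypothesis
      bounds by \<open>k ^ Suc j\<close>; together with \<open>k ^ Suc j\<close> copies of at most
      \<open>k - 1\<close> nodes this gives exactly the factor \<open>k\<close>.\<close>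
    ultimately have "card (stage (Suc j)) < k ^ Suc j + k ^ Suc j * (k - 1)" by simp
    also have "\<dots> = k ^ Suc j * Suc (k - 1)" by (simp only: mult_Suc_right)
    also have "Suc (k - 1) = k" using k2 by simp
    finally show ?thesis by (simp add: mult.commute)
  qed
qed

text \<open>The description mentions the copy index only through \<open>embed\<close>, so all copies
  have the same links up to renaming. No link leads from the content to \<open>v\<close>, since
  \<open>v\<close> is still open at this stage.\<close>

lemma link_embed:
  assumes v: "v \<in> bangs R t" and y: "embed v i y \<in> nodes R t"
  shows "link (rank v) e (embed v i y) z \<longleftrightarrow>
    (if e then (\<exists>y'. parent (content R v) y = Inl y' \<and> z = embed v i y') \<or>
          (\<exists>q. parent (content R v) y = Inr q \<and> outer R v q = Inl z)
     else (\<exists>y'. in_box y y' \<and> z = embed v i y'))"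
proof (cases e)
  case True
  then show ?thesis by (auto simp: link_def parent_embed split: sum.splits)
next
  case False
  have "rank v < rank z" if ib: "in_box (embed v i y) z" and z: "z = embed v i y'" for y'
  proof -
    obtain i' where "through z i' (embed v i y)" using ib by (auto simp: in_box_through)
    then have "z \<in> bangs R t" using through_bang(1)[OF y] by blast
    then show ?thesis using rank_through[of z v i] z by (simp add: through_embed_self)
  qed
  then show ?thesis
    using False in_box_embed[of y _ v i] in_box_embed_cases[of v i y z] unfolding link_def by auto
qed

lemma label_embed: "label (embed v i y) = label (embed v 0 y)"
proof -
  have "node_type R (embed v i y) = node_type R (embed v 0 y)" "is_left R (embed v i y) = is_left R (embed v 0 y)"
    by (simp_all add: node_type_def is_left_def embed_def)
  then show ?thesis by (cases "parent (content R v) y") (simp_all add: label_def parent_embed)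
qed

lemma link_prefix: "link j e x y \<Longrightarrow> \<exists>\<sigma>. fst x = fst y @ \<sigma>"
  using parent_prefix[of R x y] by (cases e) (auto simp: link_def in_box_def)

lemma gluing_stage: "gluing (stage j) (crit j)"
  by unfold_locales (auto simp: finite_stage crit_def)

theorem decomp_stage:
  assumes v: "v \<in> bangs R t" and j: "rank v = Suc j"
  shows "gluing.decomp (stage (Suc j)) (link (Suc j)) label (crit (Suc j)) (k ^ Suc j)
    (rest (Suc j) v) (copy_nodes (Suc j) v)"
proof -
  let ?j = "Suc j" and ?n = "k ^ Suc j"
  let ?P = "positions (content R v)"
  interpret gluing "stage ?j" "link ?j" label "crit ?j" by (rule gluing_stage)
  have C: "copy_nodes ?j v i = embed v i ` ?P" if "i < ?n" for i
    using copy_nodes_eq[OF v] that j by simp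
  have Cn: "embed v i y \<in> nodes R t" "embed v i y \<in> stage ?j" if "i < ?n" "y \<in> ?P" for i y
    using C[OF that(1)] that(2) stage_sub by (auto simp: copy_nodes_def)
  have link_emb: "link ?j e (embed v i y) z \<longleftrightarrow>
    (if e then (\<exists>y'. parent (content R v) y = Inl y' \<and> z = embed v i y') \<or>
          (\<exists>q. parent (content R v) y = Inr q \<and> outer R v q = Inl z)
     else (\<exists>y'. in_box y y' \<and> z = embed v i y'))" if "i < ?n" "y \<in> ?P" for e i y z
    using link_embed[OF v Cn(1)[OF that]] j by simp
  have n0: "0 < ?n" using k2 by simp
  \<comment> \<open>The children of a node in a copy lie in the same copy, which has fewer than
    \<open>k\<close> nodes.\<close>
  have crit_rest: "\<not> through v i x" if x: "x \<in> crit ?j" for x i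
  proof
    assume th: "through v i x"
    have xs: "x \<in> stage ?j" using x by (simp add: crit_def)
    then have i: "i < ?n" using through_bang(2)[of x R t v i] th stage_sub power[OF v] j by auto
    have "through v i y" if "parent R y = Inl x" for y
      using parent_prefix[OF that] through_prefix[OF th] by blast
    then have "{y \<in> stage ?j. parent R y = Inl x} \<subseteq> copy_nodes ?j v i"
      by (auto simp: copy_nodes_def)
    then have "card {y \<in> stage ?j. parent R y = Inl x} \<le> card (copy_nodes ?j v i)"
      using finite_stage by (intro card_mono) (auto simp: copy_nodes_def)
    also have "\<dots> \<le> card ?P" using C[OF i] by (simp add: card_image_le finite_content_positions[OF v])
    also have "\<dots> < k" by (rule card_content_less[OF v])
    also have "k \<le> ?n" using k2 by (simp add: self_le_power)
    finally show False using x by (simp add: crit_def)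
  qed
  \<comment> \<open>The \<open>k ^ Suc j\<close> versions of \<open>y\<close>, one in each copy, are
    all children of \<open>z\<close>.\<close>
  have outer_crit: "z \<in> crit ?j" if i: "i < ?n" and y: "y \<in> ?P" and q: "parent (content R v) y = Inr q" "outer R v q = Inl z" for i y q z
  proof -
    have p: "parent R (embed v i' y) = Inl z" for i' using q by (simp add: parent_embed)
    have "(\<lambda>i. embed v i y) ` {..<?n} \<subseteq> {x \<in> stage ?j. parent R x = Inl z}" using Cn(2)[OF _ y] p by auto
    moreover have "inj_on (\<lambda>i. embed v i y) {..<?n}" by (auto simp: inj_on_def)
    moreover have "finite {x \<in> stage ?j. parent R x = Inl z}" using finite_stage by simp
    ultimately have "card {..<?n} \<le> card {x \<in> stage ?j. parent R x = Inl z}"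
      by (intro card_inj_on_le)
    moreover have "z \<in> stage ?j" using parent_stage[OF Cn(2)[OF i y] p] .
    ultimately show ?thesis by (simp add: crit_def)
  qed
  show ?thesis
    unfolding decomp_def
  proof (intro conjI allI impI ballI)
    show "crit ?j \<subseteq> rest ?j v" using crit_rest by (auto simp: rest_def crit_def)
    show "stage ?j = rest ?j v \<union> (\<Union>i<?n. copy_nodes ?j v i)" using stage_split[OF v] j by simp
    show "rest ?j v \<inter> copy_nodes ?j v i = {}" for i by (auto simp: rest_def copy_nodes_def)
    show "copy_nodes ?j v i \<inter> copy_nodes ?j v i' = {}" if "i \<noteq> i'" for i i'
      using that through_unique[of v i _ i'] unfolding copy_nodes_def by blast
    show "card (rest ?j v) < ?n"
      using card_stage[of j] card_mono[OF finite_stage[of j], of "rest ?j v"] stage_pred[OF v j] by simp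
    show "z \<in> copy_nodes ?j v i \<union> crit ?j"
      if i: "i < ?n" and x: "x \<in> copy_nodes ?j v i" and z: "z \<in> stage ?j"
        and l: "link ?j e x z \<or> link ?j e z x" for i e x z
    proof -
      obtain y where y: "x = embed v i y" "y \<in> ?P" using x unfolding C[OF i] by blast
      from l show ?thesis
      proof
        assume "link ?j e x z"
        then have "(\<exists>y'. z = embed v i y') \<or> (\<exists>q. parent (content R v) y = Inr q \<and> outer R v q = Inl z)"
          unfolding y(1) link_emb[OF i y(2)] by (auto split: if_splits)
        then show ?thesis
          using outer_crit[OF i y(2), of _ z] z through_embed_self[of v i i] unfolding copy_nodes_def by blast
      next
        assume "link ?j e z x"
        then have "through v i z"
          using link_prefix[of ?j e z x] through_prefix[of v i x z] y(1) by (auto simp: through_embed_self)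
        then show ?thesis using z by (simp add: copy_nodes_def)
      qed
    qed
    fix i assume i: "i < ?n"
    \<comment> \<open>Undoes the embedding for all copy indices at once, so that
      \<open>embed v i \<circ> un\<close> moves copy \<open>0\<close> to copy
      \<open>i\<close>.\<close>
    define un where "un x = (drop (Suc (length (fst v))) (fst x), snd x)" for x :: "'p node"
    have un: "un (embed v i' y) = y" for i' y by (simp add: un_def embed_def)
    have "rel_iso (copy_nodes ?j v 0) (copy_nodes ?j v i) (embed v i \<circ> un)"
    proof (rule rel_isoI)
      show "bij_betw (embed v i \<circ> un) (copy_nodes ?j v 0) (copy_nodes ?j v i)"
        unfolding C[OF i] C[OF n0] by (rule bij_betw_byWitness[where f' = "embed v 0 \<circ> un"]) (auto simp: un)
      show "label ((embed v i \<circ> un) x) = label x" if "x \<in> copy_nodes ?j v 0" for x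
        using that label_embed[of v i] unfolding C[OF n0] by (auto simp: un)
      show "link ?j e ((embed v i \<circ> un) x) ((embed v i \<circ> un) y) = link ?j e x y"
        if xy: "x \<in> copy_nodes ?j v 0" "y \<in> copy_nodes ?j v 0" for e x y
      proof -
        obtain x' y' where e: "x = embed v 0 x'" "x' \<in> ?P" "y = embed v 0 y'" "y' \<in> ?P"
          using xy unfolding C[OF n0] by auto
        have "outer R v q \<noteq> Inl (embed v i' y')" for q i'
          using outer_not_through[of R v q "embed v i' y'" i'] by (auto simp: through_embed_self)
        then show ?thesis
          using link_emb[OF i e(2)] link_emb[OF n0 e(2)] by (simp add: e un)
      qed
      show "link ?j e ((embed v i \<circ> un) x) b = link ?j e x b" if xb: "x \<in> copy_nodes ?j v 0" "b \<in> crit ?j" for e x b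
      proof -
        obtain x' where e: "x = embed v 0 x'" "x' \<in> ?P" using xb unfolding C[OF n0] by auto
        have "b \<noteq> embed v i' y'" for i' y' using crit_rest[OF xb(2), of i'] by (auto simp: through_embed_self)
        then show ?thesis using link_emb[OF i e(2)] link_emb[OF n0 e(2)] by (simp add: e un)
      qed
      show "link ?j e b ((embed v i \<circ> un) x) = link ?j e b x" if xb: "x \<in> copy_nodes ?j v 0" "b \<in> crit ?j" for e x b
      proof -
        obtain x' where e: "x = embed v 0 x'" using xb unfolding C[OF n0] by auto
        have "\<not> link ?j e b (embed v i' x')" for i'
          using link_prefix[of ?j e b "embed v i' x'"] through_prefix[of v i' "embed v i' x'" b] crit_rest[OF xb(2), of i']
          by (auto simp: through_embed_self)
        then show ?thesis by (simp add: e un)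
      qed
    qed
    then show "\<exists>g. rel_iso (copy_nodes ?j v 0) (copy_nodes ?j v i) g" by blast
  qed
qed

end

section \<open>Closing a box in two structures simultaneously\<close>

lemma in_box_unique: "in_box x v \<Longrightarrow> in_box x w \<Longrightarrow> v = w"
  by (auto simp: in_box_def prod_eq_iff)

context expanded begin

text \<open>At stage \<open>Suc j\<close> the links to \<open>v\<close> are not recorded, but they
  can be reconstructed: a node in copy \<open>0\<close> of \<open>v\<close> lies either in a further
  box, which is closed and shown by its link, or directly in \<open>v\<close>. The right-hand side
  is preserved by the isomorphism constructed in \<open>stage_iso_step\<close>.\<close>

lemma in_box_critical:
  assumes v: "v \<in> bangs R t" "rank v = Suc j" and x: "x \<in> stage j"
  shows "in_box x v \<longleftrightarrow> through v 0 x \<and> \<not> (\<exists>z\<in>stage j. link (Suc j) False x z)"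
proof
  assume ib: "in_box x v"
  then obtain i where "through v i x" by (auto simp: in_box_through)
  moreover from this have "i = 0" using stageD[OF x] v(2) by simp
  moreover have "\<not> link (Suc j) False x z" for z
    using in_box_unique[OF ib, of z] v(2) by (auto simp: link_def)
  ultimately show "through v 0 x \<and> \<not> (\<exists>z\<in>stage j. link (Suc j) False x z)" by auto
next
  assume r: "through v 0 x \<and> \<not> (\<exists>z\<in>stage j. link (Suc j) False x z)"
  then obtain y where y: "x = embed v 0 y" by (auto simp: through_eq_embed)
  show "in_box x v"
  proof (cases "fst y" rule: rev_cases)
    case Nil
    then show ?thesis by (simp add: y embed_def in_box_def)
  next
    case (snoc \<sigma> s)
    let ?z = "embed v 0 (\<sigma>, fst s)"
    have ib: "in_box x ?z" using snoc by (auto simp: y embed_def in_box_def prod_eq_iff)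
    have z: "?z \<in> stage j" "?z \<in> bangs R t" using in_box_stage[OF x ib] by auto
    have "rank v < rank ?z" by (rule rank_through[OF z(2), of v 0]) (simp add: through_embed_self)
    then have "link (Suc j) False x ?z" using ib v(2) by (simp add: link_def)
    then show ?thesis using r z(1) by blast
  qed
qed

lemma link_pred_False:
  assumes v: "v \<in> bangs R t" "rank v = Suc j" and x: "x \<in> stage j"
  shows "link j False x y \<longleftrightarrow> link (Suc j) False x y \<or> (y = v \<and> in_box x v)"
proof -
  have "rank y = Suc j \<longleftrightarrow> y = v" if "in_box x y"
    using inj_rank[OF in_box_stage(2)[OF x that] v(1)] v(2) by auto
  then show ?thesis using v(2) by (auto simp: link_def Suc_lessI)
qed

lemma stage_mono: "stage j \<subseteq> stage (Suc j)"
  by (auto simp: stage_def)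

end

locale two_expanded = A: expanded R t k + A': expanded R' t' k
  for R :: "'p cps" and t :: "'p shape" and R' :: "'p cps" and t' :: "'p shape" and k :: nat
begin

definition stage_iso :: "nat \<Rightarrow> ('p node \<Rightarrow> 'p node) \<Rightarrow> bool" where
  "stage_iso j h \<longleftrightarrow> bij_betw h (A.stage j) (A'.stage j) \<and> (\<forall>x\<in>A.stage j. A'.label (h x) = A.label x) \<and>
     (\<forall>e. \<forall>x\<in>A.stage j. \<forall>y\<in>A.stage j. A'.link j e (h x) (h y) = A.link j e x y)"

context
  fixes j :: nat and h :: "'p node \<Rightarrow> 'p node"
  assumes h: "stage_iso j h"
begin

lemma h_bij: "bij_betw h (A.stage j) (A'.stage j)"
  and h_label: "x \<in> A.stage j \<Longrightarrow> A'.label (h x) = A.label x"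
  and h_link: "x \<in> A.stage j \<Longrightarrow> y \<in> A.stage j \<Longrightarrow> A'.link j e (h x) (h y) = A.link j e x y"
  using h unfolding stage_iso_def by blast+

lemma h_in: "x \<in> A.stage j \<Longrightarrow> h x \<in> A'.stage j"
  using h_bij by (rule bij_betw_apply)

lemma h_bangs:
  assumes "x \<in> A.stage j"
  shows "h x \<in> bangs R' t' \<longleftrightarrow> x \<in> bangs R t"
proof -
  have n: "x \<in> nodes R t" "h x \<in> nodes R' t'" using assms h_in A.stage_sub A'.stage_sub by blast+
  have "node_type R' (h x) = node_type R x" using h_label[OF assms] by (simp add: A.label_def A'.label_def)
  then show ?thesis using n node_lab_type[OF A.wf n(1)] node_lab_type[OF A'.wf n(2)] by (simp add: bangs_def)
qed

lemma h_children:
  assumes "x \<in> A.stage j"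
  shows "card {y \<in> A'.stage j. parent R' y = Inl (h x)} = card {y \<in> A.stage j. parent R y = Inl x}"
proof -
  have iff: "parent R' (h y) = Inl (h x) \<longleftrightarrow> parent R y = Inl x" if "y \<in> A.stage j" for y
    using h_link[OF that assms, of True] by (simp add: A.link_def A'.link_def)
  have "{y \<in> A'.stage j. parent R' y = Inl (h x)} = h ` {y \<in> A.stage j. parent R y = Inl x}"
    unfolding bij_betw_imp_surj_on[OF h_bij, symmetric] using iff by auto
  moreover have "inj_on h {y \<in> A.stage j. parent R y = Inl x}"
    using h_bij by (auto simp: bij_betw_def inj_on_def)
  ultimately show ?thesis by (simp add: card_image)
qed

lemma h_rank:
  assumes "0 < j" "v \<in> A.stage j" "v \<in> bangs R t"
  shows "A'.rank (h v) = j \<longleftrightarrow> A.rank v = j"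
proof -
  have "h v \<in> bangs R' t'" using h_bangs[OF assms(2)] assms(3) by blast
  from A'.rank_eq_iff_children[OF this h_in[OF assms(2)] assms(1)] show ?thesis
    unfolding h_children[OF assms(2)] A.rank_eq_iff_children[OF assms(3,2,1)] by blast
qed

end

text \<open>\<open>h\<close> may mix the copies of a box with the rest; only the counts of
  components agree. Therefore the decomposition on the right is pulled back along \<open>h\<close>,
  and \<open>cancel_copies\<close> provides a map \<open>f\<close> on the smaller stage that
  corrects \<open>h\<close>.\<close>

lemma stage_iso_step:
  assumes h: "stage_iso (Suc j) h"
  shows "\<exists>h'. stage_iso j h'"
proof (cases "\<exists>v\<in>bangs R t. A.rank v = Suc j")
  case False
  \<comment> \<open>A box of this rank on the right would belong to the stage, and \<open>h\<close>
    would bring it back to one on the left.\<close>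
  have "A'.rank v' \<noteq> Suc j" if v': "v' \<in> bangs R' t'" for v'
  proof
    assume r: "A'.rank v' = Suc j"
    have "v' \<in> A'.stage (Suc j)" by (rule A'.bang_in_stage[OF v']) (simp add: r)
    then have "v' \<in> h ` A.stage (Suc j)" using bij_betw_imp_surj_on[OF h_bij[OF h]] by simp
    then obtain v where v: "v \<in> A.stage (Suc j)" "h v = v'" by auto
    then have "v \<in> bangs R t" using h_bangs[OF h v(1)] v' by simp
    moreover from this have "A.rank v = Suc j" using h_rank[OF h _ v(1)] r v(2) by simp
    ultimately show False using False by blast
  qed
  note no' = A'.no_rank[OF this]
  have "A.rank v \<noteq> Suc j" if "v \<in> bangs R t" for v using False that by blast
  note no = A.no_rank[OF this]
  have "stage_iso j h"
    unfolding stage_iso_def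
  proof (intro conjI allI ballI)
    show "bij_betw h (A.stage j) (A'.stage j)" using h_bij[OF h] no(1) no'(1) by simp
    fix x assume "x \<in> A.stage j"
    then have x: "x \<in> A.stage (Suc j)" using no(1) by simp
    then show "A'.label (h x) = A.label x" by (rule h_label[OF h])
    fix e y assume "y \<in> A.stage j"
    then have y: "y \<in> A.stage (Suc j)" using no(1) by simp
    have "x \<in> nodes R t" "h x \<in> nodes R' t'" using x h_in[OF h x] A.stage_sub A'.stage_sub by blast+
    then show "A'.link j e (h x) (h y) = A.link j e x y"
      using h_link[OF h x y] no(2) no'(2) by blast
  qed
  then show ?thesis by (rule exI[of _ h])
next
  case True
  then obtain v where v: "v \<in> bangs R t" "A.rank v = Suc j" by blast
  let ?J = "Suc j"
  have vs: "v \<in> A.stage ?J" by (rule A.bang_in_stage[OF v(1)]) (simp add: v(2))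
  define v' where "v' = h v"
  have v': "v' \<in> bangs R' t'" "A'.rank v' = ?J"
    using h_bangs[OF h vs] h_rank[OF h _ vs v(1)] v by (simp_all add: v'_def)
  interpret G: gluing "A.stage ?J" "A.link ?J" A.label "A.crit ?J" by (rule A.gluing_stage)
  note D = A.decomp_stage[OF v] and D' = A'.decomp_stage[OF v']
  have crit: "h x \<in> A'.crit ?J \<longleftrightarrow> x \<in> A.crit ?J" if "x \<in> A.stage ?J" for x
    using that h_in[OF h that] h_children[OF h that] by (simp add: A.crit_def A'.crit_def)
  let ?G = "{x \<in> A.stage ?J. h x \<in> A'.rest ?J v'}"
  let ?C = "{x \<in> A.stage ?J. h x \<in> A'.copy_nodes ?J v' 0}"
  have pull: "G.decomp (k ^ ?J) ?G (\<lambda>i. {x \<in> A.stage ?J. h x \<in> A'.copy_nodes ?J v' i})"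
    by (rule G.decomp_pullback[OF A'.gluing_stage D' h_bij[OF h] h_label[OF h] h_link[OF h] crit])
  obtain f where f: "bij_betw f (A.rest ?J v \<union> A.copy_nodes ?J v 0) (?G \<union> ?C)"
    "f ` A.rest ?J v = ?G" "f ` A.copy_nodes ?J v 0 = ?C" "\<forall>b\<in>A.crit ?J. f b = b"
    "\<forall>x\<in>A.rest ?J v \<union> A.copy_nodes ?J v 0. A.label (f x) = A.label x"
    "\<forall>e. \<forall>x\<in>A.rest ?J v \<union> A.copy_nodes ?J v 0. \<forall>y\<in>A.rest ?J v \<union> A.copy_nodes ?J v 0.
       A.link ?J e (f x) (f y) = A.link ?J e x y"
    using G.cancel_copies[OF D pull] by (elim exE conjE) (rule that; assumption)
  have W: "A.rest ?J v \<union> A.copy_nodes ?J v 0 = A.stage j" using A.stage_pred[OF v] by simp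
  have W': "A'.rest ?J v' \<union> A'.copy_nodes ?J v' 0 = A'.stage j" using A'.stage_pred[OF v'] by simp
  note f = f[unfolded W]
  have hf: "f x \<in> A.stage ?J" if "x \<in> A.stage j" for x using bij_betw_apply[OF f(1) that] by blast
  have "bij_betw h (?G \<union> ?C) (A'.stage j)"
  proof -
    have "inj_on h (?G \<union> ?C)" using h_bij[OF h] by (auto simp: bij_betw_def inj_on_def)
    moreover have "h ` (?G \<union> ?C) = A'.stage j"
    proof -
      have "?G \<union> ?C = {x \<in> A.stage ?J. h x \<in> A'.stage j}" unfolding W'[symmetric] by blast
      moreover have "A'.stage j \<subseteq> h ` A.stage ?J"
        using A'.stage_mono[of j] bij_betw_imp_surj_on[OF h_bij[OF h]] by simp
      ultimately show ?thesis by auto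
    qed
    ultimately show ?thesis by (simp add: bij_betw_def)
  qed
  then have bij: "bij_betw (h \<circ> f) (A.stage j) (A'.stage j)" by (rule bij_betw_trans[OF f(1)])
  have lab: "A'.label ((h \<circ> f) x) = A.label x" if "x \<in> A.stage j" for x
    using h_label[OF h hf[OF that]] f(5) that by simp
  have lnk: "A'.link ?J e ((h \<circ> f) x) ((h \<circ> f) y) = A.link ?J e x y" if "x \<in> A.stage j" "y \<in> A.stage j" for e x y
    using h_link[OF h hf[OF that(1)] hf[OF that(2)]] f(6) that by simp
  have vW: "v \<in> A.stage j" by (rule A.bang_in_stage[OF v(1)]) (simp add: v(2))
  \<comment> \<open>Having at least \<open>k ^ Suc j\<close> children, \<open>v\<close> belongs to
    the boundary that \<open>f\<close> fixes, so the corrected map still sends \<open>v\<close> to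
    \<open>v'\<close>.\<close>
  have "v \<in> A.crit ?J" using vs A.rank_eq_iff_children[OF v(1) vs] v(2) by (simp add: A.crit_def)
  then have fv: "(h \<circ> f) v = v'" using f(4) by (simp add: v'_def)
  have eq_v: "(h \<circ> f) y = v' \<longleftrightarrow> y = v" if "y \<in> A.stage j" for y
    using bij that vW fv unfolding bij_betw_def inj_on_def by metis
  have thr: "through v' 0 ((h \<circ> f) x) \<longleftrightarrow> through v 0 x" if x: "x \<in> A.stage j" for x
  proof -
    have "through v 0 x \<longleftrightarrow> x \<in> A.copy_nodes ?J v 0" using x A.stage_mono by (auto simp: A.copy_nodes_def)
    also have "\<dots> \<longleftrightarrow> f x \<in> ?C"
    proof
      assume "x \<in> A.copy_nodes ?J v 0"
      then show "f x \<in> ?C" using f(3) by blast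
    next
      assume fx: "f x \<in> ?C"
      show "x \<in> A.copy_nodes ?J v 0"
      proof (rule ccontr)
        assume "x \<notin> A.copy_nodes ?J v 0"
        then have "x \<in> A.rest ?J v" using x W by blast
        then have "f x \<in> ?G" using f(2) by blast
        then show False using fx by (auto simp: A'.rest_def A'.copy_nodes_def)
      qed
    qed
    also have "\<dots> \<longleftrightarrow> through v' 0 ((h \<circ> f) x)"
      using hf[OF x] h_in[OF h hf[OF x]] by (auto simp: A'.copy_nodes_def)
    finally show ?thesis by simp
  qed
  have ib: "in_box ((h \<circ> f) x) v' \<longleftrightarrow> in_box x v" if x: "x \<in> A.stage j" for x
  proof -
    have hx: "(h \<circ> f) x \<in> A'.stage j" using bij_betw_apply[OF bij x] .
    have "(\<exists>z\<in>A'.stage j. A'.link ?J False ((h \<circ> f) x) z) \<longleftrightarrow> (\<exists>z\<in>A.stage j. A.link ?J False x z)"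
      unfolding bij_betw_imp_surj_on[OF bij, symmetric] bex_simps(7) using lnk[OF x, of _ False] by blast
    then show ?thesis
      using A.in_box_critical[OF v x] A'.in_box_critical[OF v' hx] thr[OF x] by simp
  qed
  have "A'.link j e ((h \<circ> f) x) ((h \<circ> f) y) = A.link j e x y" if x: "x \<in> A.stage j" and y: "y \<in> A.stage j" for e x y
  proof (cases e)
    case True
    then show ?thesis using lnk[OF x y, of True] by (simp add: A.link_def A'.link_def)
  next
    case False
    have hx: "(h \<circ> f) x \<in> A'.stage j" using bij_betw_apply[OF bij x] .
    show ?thesis
      using False lnk[OF x y, of False] A.link_pred_False[OF v x, of y] A'.link_pred_False[OF v' hx, of "(h \<circ> f) y"]
        eq_v[OF y] ib[OF x] by simp
  qed
  then have "stage_iso j (h \<circ> f)" using bij lab unfolding stage_iso_def by blast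
  then show ?thesis by (rule exI[of _ "h \<circ> f"])
qed

lemma stage_iso_0: "stage_iso j h \<Longrightarrow> \<exists>h'. stage_iso 0 h'"
proof (induction j arbitrary: h)
  case (Suc j)
  then show ?case using stage_iso_step by blast
qed blast

lemma exists_stage_iso_0:
  assumes h: "bij_betw h (nodes R t) (nodes R' t')"
    and iso: "\<And>x. x \<in> nodes R t \<Longrightarrow> node_type R' (h x) = node_type R x \<and> is_left R' (h x) = is_left R x \<and>
      parent R' (h x) = map_sum h id (parent R x)"
  shows "\<exists>h'. stage_iso 0 h'"
proof -
  \<comment> \<open>At the maximal rank no box is closed yet: the stage is the whole unfolding and
    the only links are parents. Inserting \<open>0\<close> covers structures without boxes.\<close>
  define j where "j = Max (insert 0 (A.rank ` bangs R t \<union> A'.rank ` bangs R' t'))"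
  have fin: "finite (insert 0 (A.rank ` bangs R t \<union> A'.rank ` bangs R' t'))"
    using finite_bangs[OF A.wf] finite_bangs[OF A'.wf] by simp
  have j: "A.rank v \<le> j" if "v \<in> bangs R t" for v using fin that by (simp add: j_def)
  have j': "A'.rank v \<le> j" if "v \<in> bangs R' t'" for v using fin that by (simp add: j_def)
  have s: "A.stage j = nodes R t"
    using j through_bang(1)[where R = R and t = t] unfolding A.stage_def by (blast dest: leD)
  have s': "A'.stage j = nodes R' t'"
    using j' through_bang(1)[where R = R' and t = t'] unfolding A'.stage_def by (blast dest: leD)
  have l: "A.link j e x y \<longleftrightarrow> e \<and> parent R x = Inl y" if "x \<in> nodes R t" for e x y
    using that A.in_box_stage(2)[of x j y] j[of y] unfolding A.link_def s by (cases e) auto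
  have l': "A'.link j e x y \<longleftrightarrow> e \<and> parent R' x = Inl y" if "x \<in> nodes R' t'" for e x y
    using that A'.in_box_stage(2)[of x j y] j'[of y] unfolding A'.link_def s' by (cases e) auto
  have "stage_iso j h"
    unfolding stage_iso_def s s'
  proof (intro conjI allI ballI h)
    fix x assume x: "x \<in> nodes R t"
    show "A'.label (h x) = A.label x"
      using iso[OF x] by (cases "parent R x") (auto simp: A.label_def A'.label_def)
    fix e y assume y: "y \<in> nodes R t"
    have "parent R' (h x) = Inl (h y) \<longleftrightarrow> parent R x = Inl y"
    proof (cases "parent R x")
      case (Inl z)
      then have "z \<in> nodes R t" using parent_in_nodes[OF A.wf x] by blast
      then show ?thesis using iso[OF x] Inl y h by (auto simp: bij_betw_def inj_on_def)
    qed (use iso[OF x] in auto)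
    then show "A'.link j e (h x) (h y) = A.link j e x y"
      using l[OF x] l'[OF bij_betw_apply[OF h x]] by simp
  qed
  then show ?thesis by (rule stage_iso_0)
qed

end


subsection \<open>From positions to proof-structures\<close>

text \<open>Taking one copy of every content yields an unfolding that contains all positions; facts
  about unfoldings carry over to positions in this way.\<close>

lemma positions_nodes:
  assumes "wf_ps R" shows "\<exists>t. positions R \<subseteq> nodes R t"
proof -
  obtain t where t: "\<forall>x\<in>bangs R t. ncopies t x = 1"
    using exists_shape_ncopies[OF assms, of "\<lambda>_. 1" "[]"] by blast
  then have "valid_path R t \<pi>" if "zero_path R \<pi>" for \<pi>
    using zero_path_valid[of R t \<pi>] that by simp
  then have "positions R \<subseteq> nodes R t" by (auto simp: positions_def nodes_def)
  then show ?thesis ..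
qed

lemma parent_positions:
  assumes "wf_ps R" "x \<in> positions R" "parent R x = Inl y"
  shows "y \<in> positions R"
proof -
  obtain t where t: "positions R \<subseteq> nodes R t" using positions_nodes[OF assms(1)] by blast
  then have "y \<in> nodes R t" using parent_in_nodes[OF assms(1) _ assms(3)] assms(2) by blast
  moreover have "zero_path R (fst y)"
    using parent_prefix[OF assms(3)] assms(2) by (auto simp: positions_def)
  ultimately show ?thesis by (simp add: positions_def nodes_iff)
qed

lemma positions_parent_Inr:
  assumes "wf_ps R" "x \<in> positions R" "parent R x = Inr q"
  shows "(x = ([], q) \<and> q \<in> bullet_conclusions R) \<or> (fst x \<noteq> [] \<and> q \<in> circ_ports R)"
  using positions_nodes[OF assms(1)] parent_Inr[OF assms(1) _ assms(3)] assms(2) by blast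

lemma positions_simps [simp]:
  "([], p) \<in> positions R \<longleftrightarrow> p \<in> inner_ports R"
  "shift a i x \<in> positions R \<longleftrightarrow> a \<in> boxes R \<and> i = 0 \<and> x \<in> positions (box_at R a)"
  by (auto simp: positions_def)

text \<open>Circles are not positions. They are recovered as the exits of edges, which works because
  each of them is the image of some conclusion further inside.\<close>

lemma circ_port_position:
  assumes "wf_ps R" "q \<in> circ_ports R"
  shows "\<exists>x\<in>positions R. parent R x = Inr q \<and> fst x \<noteq> []"
  using assms
proof (induction arbitrary: q rule: wf_ps_induct)
  case (content R)
  obtain a q' where a: "a \<in> boxes R" "q' \<in> conclusions (box_at R a)" "box_map R a q' = q"
    using circ_port_source[OF content.hyps content.prems] by blast
  note wf = wf_psD(3)[OF content.hyps a(1)]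
  have "\<exists>y\<in>positions (box_at R a). parent (box_at R a) y = Inr q'"
  proof (cases "q' \<in> circ_ports (box_at R a)")
    case True
    then show ?thesis using content.IH[OF a(1) True] by blast
  next
    case False
    then have "q' \<in> bullet_conclusions (box_at R a)" using a(2) by (simp add: bullet_conclusions_def)
    then have "([], q') \<in> positions (box_at R a)" "parent (box_at R a) ([], q') = Inr q'"
      using bullet_conclusions_eq[OF wf] by auto
    then show ?thesis by blast
  qed
  then obtain y where y: "y \<in> positions (box_at R a)" "parent (box_at R a) y = Inr q'" by blast
  then have "shift a 0 y \<in> positions R" "parent R (shift a 0 y) = Inr q"
    using a content.prems by (auto simp: circ_ports_def)
  then show ?case by (intro bexI[of _ "shift a 0 y"]) simp_all
qed

lemma ports_eq: "ports (ground_of R) = inner_ports R \<union> circ_ports R"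
  by (auto simp: inner_ports_def circ_ports_def)

lemma inner_circ_disjoint: "inner_ports R \<inter> circ_ports R = {}"
  by (auto simp: inner_ports_def)

lemma boxes_inner: "boxes R \<subseteq> inner_ports R"
  by (auto simp: boxes_def inner_ports_def circ_ports_def)

lemma exit_inj: "exit R q = exit R q' \<longleftrightarrow> q = q'"
  by (auto simp: exit_def)

lemma in_box_shift_iff [simp]:
  "in_box (shift a i x) (shift a i y) \<longleftrightarrow> in_box x y"
  "\<not> in_box ([], p) y"
  "in_box (shift a i x) ([], b) \<longleftrightarrow> a = b \<and> fst x = []"
  by (auto simp: in_box_def)

text \<open>Since circles are not nodes, two maps are carried: \<open>h\<close> acts on positions
  and \<open>g\<close> on the ports at depth 0, circles included; in \<open>par\<close>,
  \<open>g\<close> renames the exits. The outermost structure has no circles, but the induction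
  passes to contents, which may have them.\<close>

locale position_iso =
  fixes R R' :: "'p cps" and h :: "'p node \<Rightarrow> 'p node" and g :: "'p \<Rightarrow> 'p"
  assumes wf: "wf_ps R" and wf': "wf_ps R'"
    and h: "bij_betw h (positions R) (positions R')"
    and type: "x \<in> positions R \<Longrightarrow> node_type R' (h x) = node_type R x"
    and left: "x \<in> positions R \<Longrightarrow> is_left R' (h x) = is_left R x"
    and root: "p \<in> inner_ports R \<Longrightarrow> h ([], p) = ([], g p)"
    and circ: "bij_betw g (circ_ports R) (circ_ports R')"
    and circ_type: "q \<in> circ_ports R \<Longrightarrow> ptype (ground_of R') (g q) = ptype (ground_of R) q"
    and par: "x \<in> positions R \<Longrightarrow> parent R' (h x) = map_sum h g (parent R x)"
    and box: "x \<in> positions R \<Longrightarrow> y \<in> positions R \<Longrightarrow> in_box (h x) (h y) \<longleftrightarrow> in_box x y"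
begin

lemma h_in: "x \<in> positions R \<Longrightarrow> h x \<in> positions R'"
  using bij_betw_apply[OF h] .

lemma h_surj: "x' \<in> positions R' \<Longrightarrow> \<exists>x\<in>positions R. h x = x'"
  unfolding bij_betw_imp_surj_on[OF h, symmetric] by auto

lemma h_inj: "x \<in> positions R \<Longrightarrow> y \<in> positions R \<Longrightarrow> h x = h y \<Longrightarrow> x = y"
  using h by (auto simp: bij_betw_def inj_on_def)

lemma g_inner_in: "p \<in> inner_ports R \<Longrightarrow> g p \<in> inner_ports R'"
  using h_in[of "([], p)"] root[of p] by simp

lemma lab_inner: "p \<in> inner_ports R \<Longrightarrow> lab (ground_of R') (g p) = lab (ground_of R) p"
  using type[of "([], p)"] root[of p] lab_eq_type_lab[OF wf, of p] lab_eq_type_lab[OF wf' g_inner_in, of p] by simp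

lemma g_boxes: "a \<in> boxes R \<Longrightarrow> g a \<in> boxes R'"
  using lab_inner[of a] g_inner_in[of a] boxes_inner[of R] by (auto simp: boxes_def inner_ports_def)

text \<open>Induction along the path: \<open>in_box\<close> is preserved, so a position directly
  inside \<open>a\<close>, or inside a box already located, goes to the corresponding box. Indices
  stay \<open>0\<close> because the images are positions.\<close>

lemma h_content:
  assumes "a \<in> boxes R" "y \<in> positions (box_at R a)"
  shows "\<exists>y'. h (shift a 0 y) = shift (g a) 0 y' \<and> y' \<in> positions (box_at R' (g a)) \<and> (fst y' = [] \<longleftrightarrow> fst y = [])"
proof -
  have "\<exists>y'. h (shift a 0 y) = shift (g a) 0 y' \<and> (fst y' = [] \<longleftrightarrow> fst y = [])"
    using assms(2)
  proof (induction "fst y" arbitrary: y rule: rev_induct)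
    case Nil
    have a: "([], a) \<in> positions R" "h ([], a) = ([], g a)" using assms(1) boxes_inner[of R] root[of a] by auto
    have x: "shift a 0 y \<in> positions R" using Nil assms(1) by simp
    have "in_box (h (shift a 0 y)) ([], g a)" using box[OF x a(1)] a(2) Nil by simp
    then obtain i where i: "fst (h (shift a 0 y)) = [(g a, i)]" by (auto simp: in_box_def)
    then have "h (shift a 0 y) = shift (g a) i ([], snd (h (shift a 0 y)))"
      by (simp add: shift_def prod_eq_iff)
    moreover from this have "i = 0" using h_in[OF x] by (metis positions_simps(2))
    ultimately show ?case using Nil by (metis fst_conv)
  next
    case (snoc s \<sigma>)
    let ?z = "(\<sigma>, fst s)"
    have zp: "zero_path (box_at R a) (\<sigma> @ [s])" using snoc by (simp add: positions_def)
    have z: "?z \<in> positions (box_at R a)"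
      using zp boxes_inner[of "at (box_at R a) \<sigma>"] by (cases s) (auto simp: positions_def)
    obtain z' where z': "h (shift a 0 ?z) = shift (g a) 0 z'" using snoc.hyps(1)[of ?z] z by auto
    have ib: "in_box (shift a 0 y) (shift a 0 ?z)"
      using snoc(2) by (cases s) (simp add: in_box_def flip: snoc(2))
    have "in_box (h (shift a 0 y)) (shift (g a) 0 z')"
      using box[of "shift a 0 y" "shift a 0 ?z"] z z' ib snoc.prems assms(1) by simp
    then obtain i where "fst (h (shift a 0 y)) = (g a, 0) # fst z' @ [(snd z', i)]" by (auto simp: in_box_def)
    then have "h (shift a 0 y) = shift (g a) 0 (fst z' @ [(snd z', i)], snd (h (shift a 0 y)))"
      by (simp add: shift_def prod_eq_iff)
    then show ?case using snoc(2) by (metis append_is_Nil_conv fst_conv not_Cons_self2)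
  qed
  then obtain y' where y': "h (shift a 0 y) = shift (g a) 0 y'" "fst y' = [] \<longleftrightarrow> fst y = []" by blast
  have "shift (g a) 0 y' \<in> positions R'" using h_in[of "shift a 0 y"] assms y'(1) by simp
  then show ?thesis using y' by auto
qed

lemma h_level_0:
  assumes x: "x \<in> positions R" and hx: "fst (h x) = []"
  shows "fst x = []"
proof (cases x rule: node_cases)
  case (2 a i y)
  then have "a \<in> boxes R" "i = 0" "y \<in> positions (box_at R a)" using x by auto
  then show ?thesis using h_content[of a y] 2 hx by auto
qed simp

lemma g_inner: "bij_betw g (inner_ports R) (inner_ports R')"
proof -
  have "inj_on g (inner_ports R)"
  proof (rule inj_onI)
    fix p q assume "p \<in> inner_ports R" "q \<in> inner_ports R" "g p = g q"
    then show "p = q" using h_inj[of "([], p)" "([], q)"] root by simp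
  qed
  moreover have "p' \<in> g ` inner_ports R" if p': "p' \<in> inner_ports R'" for p'
  proof -
    obtain x where x: "x \<in> positions R" "h x = ([], p')" using h_surj[of "([], p')"] p' by auto
    then have "fst x = []" using h_level_0[OF x(1)] by simp
    then obtain p where "x = ([], p)" by (cases x) auto
    then show ?thesis using x root[of p] by auto
  qed
  moreover have "g ` inner_ports R \<subseteq> inner_ports R'" using g_inner_in by (rule image_subsetI)
  ultimately show ?thesis by (simp add: bij_betw_def subset_antisym subsetI)
qed

lemma g_ports: "bij_betw g (ports (ground_of R)) (ports (ground_of R'))"
  unfolding ports_eq by (rule bij_betw_combine[OF g_inner circ inner_circ_disjoint])

lemma g_lab: "p \<in> ports (ground_of R) \<Longrightarrow> lab (ground_of R') (g p) = lab (ground_of R) p"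
  using lab_inner[of p] bij_betw_apply[OF circ, of p] unfolding ports_eq by (auto simp: circ_ports_def)

lemma g_ptype: "p \<in> ports (ground_of R) \<Longrightarrow> ptype (ground_of R') (g p) = ptype (ground_of R) p"
  using circ_type[of p] type[of "([], p)"] root[of p] unfolding ports_eq by auto

lemma wires_inner: "wf_ps S \<Longrightarrow> wires (ground_of S) \<subseteq> inner_ports S"
  using ground_ofD(2)[of S] by (auto simp: inner_ports_def circ_ports_def)

lemma g_ground_iso: "ground_iso g (ground_of R) (ground_of R')"
proof -
  have wire: "g p \<in> wires (ground_of R') \<longleftrightarrow> p \<in> wires (ground_of R)" if p: "p \<in> ports (ground_of R)" for p
  proof (cases "p \<in> inner_ports R")
    case True
    then show ?thesis using par[of "([], p)"] root[of p] by (auto split: if_splits)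
  next
    case False
    then have "p \<in> circ_ports R" using p unfolding ports_eq by simp
    then have "g p \<in> circ_ports R'" by (rule bij_betw_apply[OF circ])
    then show ?thesis using False wires_inner[OF wf] wires_inner[OF wf'] inner_circ_disjoint[of R'] by blast
  qed
  have tgt: "tgt (ground_of R') (g w) = g (tgt (ground_of R) w)" if w: "w \<in> wires (ground_of R)" for w
  proof -
    have wi: "w \<in> inner_ports R" "([], w) \<in> positions R" using w wires_inner[OF wf] by auto
    have p: "parent R ([], w) = Inl ([], tgt (ground_of R) w)" using w by simp
    have t: "tgt (ground_of R) w \<in> inner_ports R" using parent_positions[OF wf wi(2) p] by simp
    have "g w \<in> wires (ground_of R')" using wire[of w] w wi by (auto simp: inner_ports_def)
    then show ?thesis using par[OF wi(2)] p root[OF wi(1)] root[OF t] by simp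
  qed
  have "g p \<in> lefts (ground_of R') \<longleftrightarrow> p \<in> lefts (ground_of R)" if p: "p \<in> ports (ground_of R)" for p
  proof (cases "p \<in> inner_ports R")
    case True
    then show ?thesis using left[of "([], p)"] root[of p] by auto
  next
    case False
    then have "p \<notin> wires (ground_of R)" using wires_inner[OF wf] by blast
    then show ?thesis using wire[OF p] ground_ofD(4)[OF wf, of p] ground_ofD(4)[OF wf', of "g p"] by blast
  qed
  then show ?thesis using g_ports g_lab g_ptype wire tgt by (simp add: ground_iso_def)
qed

lemma g_image_boxes: "g ` boxes R = boxes R'"
proof
  show "g ` boxes R \<subseteq> boxes R'" using g_boxes by blast
  show "boxes R' \<subseteq> g ` boxes R"
  proof
    fix a' assume a': "a' \<in> boxes R'"
    then have "a' \<in> g ` inner_ports R" using boxes_inner[of R'] bij_betw_imp_surj_on[OF g_inner] by blast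
    then obtain a where a: "a \<in> inner_ports R" "a' = g a" by auto
    then have "a \<in> boxes R" using lab_inner[OF a(1)] a' by (simp add: boxes_def inner_ports_def)
    then show "a' \<in> g ` boxes R" using a(2) by blast
  qed
qed

definition content_map :: "'p \<Rightarrow> 'p node \<Rightarrow> 'p node" where
  "content_map a y = (tl (fst (h (shift a 0 y))), snd (h (shift a 0 y)))"

text \<open>An ordinary conclusion follows its position. A circle keeps its name when it leaves the
  box, so it follows the outer port map.\<close>

definition content_ports :: "'p \<Rightarrow> 'p \<Rightarrow> 'p" where
  "content_ports a q = (if q \<in> circ_ports (box_at R a) then g q else snd (content_map a ([], q)))"

context
  fixes a assumes a: "a \<in> boxes R"
begin

lemma content_map:
  assumes "y \<in> positions (box_at R a)"
  shows "h (shift a 0 y) = shift (g a) 0 (content_map a y)"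
    and "content_map a y \<in> positions (box_at R' (g a))" and "fst (content_map a y) = [] \<longleftrightarrow> fst y = []"
  using h_content[OF a assms] by (auto simp: content_map_def)

lemma wf_content: "wf_ps (box_at R a)" "wf_ps (box_at R' (g a))"
  using wf_psD(3)[OF wf a] wf_psD(3)[OF wf' g_boxes[OF a]] .

lemma content_parent_Inl:
  assumes y: "y \<in> positions (box_at R a)" and p: "parent (box_at R a) y = Inl z"
  shows "parent (box_at R' (g a)) (content_map a y) = Inl (content_map a z)"
proof -
  have z: "z \<in> positions (box_at R a)" by (rule parent_positions[OF wf_content(1) y p])
  have "parent R' (shift (g a) 0 (content_map a y)) = Inl (shift (g a) 0 (content_map a z))"
    using par[of "shift a 0 y"] a y p content_map(1)[OF y] content_map(1)[OF z] by simp
  then show ?thesis by (auto split: sum.splits)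
qed

text \<open>In the outer structures both edges arrive at corresponding ports. The exit from the
  content is recovered from this: at a circle the box map is the identity, and otherwise the node is
  itself the conclusion.\<close>

lemma content_parent_Inr:
  assumes y: "y \<in> positions (box_at R a)" and p: "parent (box_at R a) y = Inr q"
  shows "parent (box_at R' (g a)) (content_map a y) = Inr (content_ports a q)"
    and "box_map R' (g a) (content_ports a q) = g (box_map R a q)"
proof -
  let ?b = "box_map R a q"
  have b: "?b \<in> ports (ground_of R)"
  proof -
    have "q \<in> conclusions (box_at R a)"
      using positions_parent_Inr[OF wf_content(1) y p] circ_ports_sub[OF wf_content(1)]
      by (auto simp: bullet_conclusions_def)
    then show ?thesis using box_mapD(1)[OF wf a] by blast
  qed
  have "map_sum h g (exit R ?b) = exit R' (g ?b)"
    using g_lab[OF b] root[of ?b] b unfolding exit_def ports_eq by (auto simp: circ_ports_def)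
  then have e: "parent R' (shift (g a) 0 (content_map a y)) = exit R' (g ?b)"
    using par[of "shift a 0 y"] a y p content_map(1)[OF y] by simp
  then obtain q' where q': "parent (box_at R' (g a)) (content_map a y) = Inr q'"
      "exit R' (box_map R' (g a) q') = exit R' (g ?b)"
    by (cases "parent (box_at R' (g a)) (content_map a y)") (auto simp: exit_def split: if_splits)
  then have bq': "box_map R' (g a) q' = g ?b" by (simp add: exit_inj)
  have "q' = content_ports a q"
  proof (cases "q \<in> circ_ports (box_at R a)")
    case True
    then have "fst y \<noteq> []"
      using positions_parent_Inr[OF wf_content(1) y p] by (auto simp: bullet_conclusions_def)
    then have "q' \<in> circ_ports (box_at R' (g a))"
      using positions_parent_Inr[OF wf_content(2) content_map(2)[OF y] q'(1)] content_map(3)[OF y] by auto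
    then show ?thesis
      using bq' box_mapD(2)[OF wf a True] box_mapD(2)[OF wf' g_boxes[OF a], of q'] True
      by (simp add: content_ports_def)
  next
    case False
    then have "y = ([], q)" using positions_parent_Inr[OF wf_content(1) y p] by auto
    then show ?thesis
      using positions_parent_Inr[OF wf_content(2) content_map(2)[OF y] q'(1)] content_map(3)[OF y] False
      by (auto simp: content_ports_def)
  qed
  then show "parent (box_at R' (g a)) (content_map a y) = Inr (content_ports a q)"
    and "box_map R' (g a) (content_ports a q) = g ?b" using q' bq' by simp_all
qed

lemma content_map_surj:
  assumes y': "y' \<in> positions (box_at R' (g a))"
  shows "\<exists>y\<in>positions (box_at R a). content_map a y = y'"
proof -
  obtain x where x: "x \<in> positions R" "h x = shift (g a) 0 y'"
    using h_surj[of "shift (g a) 0 y'"] y' g_boxes[OF a] by auto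
  show ?thesis
  proof (cases x rule: node_cases)
    case (1 p)
    then show ?thesis using x root[of p] by simp
  next
    case (2 b i y)
    then have b: "b \<in> boxes R" "i = 0" "y \<in> positions (box_at R b)" using x by auto
    then obtain z where "h x = shift (g b) 0 z" using h_content[OF b(1,3)] 2 by auto
    then have "g b = g a" using x by simp
    then have "b = a" using b(1) a boxes_inner[of R] g_inner by (auto simp: bij_betw_def inj_on_def)
    then have "y \<in> positions (box_at R a)" "x = shift a 0 y" using b 2 by auto
    then show ?thesis using content_map(1)[of y] x(2) by auto
  qed
qed

lemma content_iso: "position_iso (box_at R a) (box_at R' (g a)) (content_map a) (content_ports a)"
proof
  show "wf_ps (box_at R a)" "wf_ps (box_at R' (g a))" by (rule wf_content)+
  show "bij_betw (content_map a) (positions (box_at R a)) (positions (box_at R' (g a)))"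
    unfolding bij_betw_def
  proof (intro conjI inj_onI set_eqI iffI)
    fix x y assume "x \<in> positions (box_at R a)" "y \<in> positions (box_at R a)" "content_map a x = content_map a y"
    then show "x = y" using h_inj[of "shift a 0 x" "shift a 0 y"] content_map(1)[of x] content_map(1)[of y] a by simp
  next
    fix y' assume "y' \<in> content_map a ` positions (box_at R a)"
    then show "y' \<in> positions (box_at R' (g a))" using content_map(2) by auto
  next
    fix y' assume y': "y' \<in> positions (box_at R' (g a))"
    then show "y' \<in> content_map a ` positions (box_at R a)" using content_map_surj by blast
  qed
  show "node_type (box_at R' (g a)) (content_map a x) = node_type (box_at R a) x"
    "is_left (box_at R' (g a)) (content_map a x) = is_left (box_at R a) x" if "x \<in> positions (box_at R a)" for x
    using type[of "shift a 0 x"] left[of "shift a 0 x"] content_map(1)[OF that] a that by simp_all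
  show "content_map a ([], p) = ([], content_ports a p)" if "p \<in> inner_ports (box_at R a)" for p
    using content_map(3)[of "([], p)"] that inner_circ_disjoint[of "box_at R a"]
    by (auto simp: content_ports_def prod_eq_iff)
  show "in_box (content_map a x) (content_map a y) = in_box x y"
    if "x \<in> positions (box_at R a)" "y \<in> positions (box_at R a)" for x y
    using box[of "shift a 0 x" "shift a 0 y"] content_map(1)[OF that(1)] content_map(1)[OF that(2)] a that by simp
  show par': "parent (box_at R' (g a)) (content_map a x) = map_sum (content_map a) (content_ports a) (parent (box_at R a) x)"
    if "x \<in> positions (box_at R a)" for x
    using content_parent_Inl[OF that] content_parent_Inr(1)[OF that] by (cases "parent (box_at R a) x") auto
  have circ_in: "g q \<in> circ_ports (box_at R' (g a))" if q: "q \<in> circ_ports (box_at R a)" for q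
  proof -
    obtain x where x: "x \<in> positions (box_at R a)" "parent (box_at R a) x = Inr q" "fst x \<noteq> []"
      using circ_port_position[OF wf_content(1) q] by blast
    then show ?thesis
      using positions_parent_Inr[OF wf_content(2) content_map(2)[OF x(1)] content_parent_Inr(1)[OF x(1,2)]]
        content_map(3)[OF x(1)] q by (auto simp: content_ports_def)
  qed
  have circ_sub: "circ_ports (box_at R a) \<subseteq> ports (ground_of R)" using box_mapD(2)[OF wf a] by blast
  show "bij_betw (content_ports a) (circ_ports (box_at R a)) (circ_ports (box_at R' (g a)))"
    unfolding bij_betw_def
  proof (intro conjI set_eqI iffI)
    have "inj_on g (circ_ports (box_at R a))"
      using g_ports circ_sub by (auto simp: bij_betw_def intro: inj_on_subset)
    then show "inj_on (content_ports a) (circ_ports (box_at R a))"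
      by (simp add: content_ports_def inj_on_def)
  next
    fix q' assume "q' \<in> content_ports a ` circ_ports (box_at R a)"
    then show "q' \<in> circ_ports (box_at R' (g a))" using circ_in by (auto simp: content_ports_def)
  next
    fix q' assume q': "q' \<in> circ_ports (box_at R' (g a))"
    obtain x' where x': "x' \<in> positions (box_at R' (g a))" "parent (box_at R' (g a)) x' = Inr q'" "fst x' \<noteq> []"
      using circ_port_position[OF wf_content(2) q'] by blast
    obtain y where y: "y \<in> positions (box_at R a)" "content_map a y = x'"
      using content_map_surj[OF x'(1)] by blast
    have ny: "fst y \<noteq> []" using content_map(3)[OF y(1)] y(2) x'(3) by simp
    obtain q where q: "parent (box_at R a) y = Inr q"
      using content_parent_Inl[OF y(1)] y(2) x'(2) by (cases "parent (box_at R a) y") auto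
    have "q \<in> circ_ports (box_at R a)" using positions_parent_Inr[OF wf_content(1) y(1) q] ny by auto
    moreover have "content_ports a q = q'" using content_parent_Inr(1)[OF y(1) q] y(2) x'(2) by simp
    ultimately show "q' \<in> content_ports a ` circ_ports (box_at R a)" by blast
  qed
  show "ptype (ground_of (box_at R' (g a))) (content_ports a q) = ptype (ground_of (box_at R a)) q"
    if q: "q \<in> circ_ports (box_at R a)" for q
    using box_mapD(2)[OF wf a q] box_mapD(2)[OF wf' g_boxes[OF a] circ_in[OF q]] g_ptype[of q] q
    by (simp add: content_ports_def)
qed

lemma content_box_map:
  assumes "q \<in> conclusions (box_at R a)"
  shows "box_map R' (g a) (content_ports a q) = g (box_map R a q)"
proof -
  have "\<exists>y\<in>positions (box_at R a). parent (box_at R a) y = Inr q"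
  proof (cases "q \<in> circ_ports (box_at R a)")
    case True
    then show ?thesis using circ_port_position[OF wf_content(1)] by blast
  next
    case False
    then have "q \<in> bullet_conclusions (box_at R a)" using assms by (simp add: bullet_conclusions_def)
    then show ?thesis using bullet_conclusions_eq[OF wf_content(1)] by (intro bexI[of _ "([], q)"]) auto
  qed
  then show ?thesis using content_parent_Inr(2) by blast
qed

end

end

text \<open>The port map is part of the induction, since compatibility with the box maps of
  \<open>R\<close> involves the port maps of the contents.\<close>

theorem position_iso_is_iso:
  assumes "position_iso R R' h g"
  shows "\<exists>\<phi>. is_iso \<phi> R R' \<and> ground_map \<phi> = g"
proof -
  have "wf_ps R" using assms by (rule position_iso.wf)
  then show ?thesis using assms
  proof (induction arbitrary: R' h g rule: wf_ps_induct)
    case (content R)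
    interpret position_iso R R' h g by (rule content.prems)
    have "\<forall>a\<in>boxes R. \<exists>\<phi>. is_iso \<phi> (box_at R a) (box_at R' (g a)) \<and> ground_map \<phi> = content_ports a"
      using content.IH content_iso by blast
    from bchoice[OF this] obtain f where
      f: "\<And>a. a \<in> boxes R \<Longrightarrow> is_iso (f a) (box_at R a) (box_at R' (g a)) \<and> ground_map (f a) = content_ports a"
      by blast
    let ?\<phi> = "PS_Iso g (\<lambda>a. if a \<in> boxes R then Some (f a) else None)"
    have "is_iso ?\<phi> R R'"
    proof
      show "ground_iso (ground_map ?\<phi>) (ground_of R) (ground_of R')" using g_ground_iso by simp
      show "ground_map ?\<phi> ` boxes R = boxes R'" using g_image_boxes by simp
      show "dom (box_iso ?\<phi>) = boxes R" by (auto split: if_splits)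
      show "is_iso (the (box_iso ?\<phi> a)) (box_at R a) (box_at R' (ground_map ?\<phi> a))" if "a \<in> boxes R" for a
        using f[OF that] that by simp
      show "box_map R' (ground_map ?\<phi> a) (ground_map (the (box_iso ?\<phi> a)) q) = ground_map ?\<phi> (box_map R a q)"
        if "a \<in> boxes R" "q \<in> conclusions (box_at R a)" for a q
        using f[OF that(1)] content_box_map[OF that] that by simp
    qed
    then show ?case by (intro exI[of _ ?\<phi>]) simp
  qed
qed


subsection \<open>Injectivity of the interpretation\<close>

definition nodes_iso :: "'p cps \<Rightarrow> 'p shape \<Rightarrow> 'p cps \<Rightarrow> 'p shape \<Rightarrow> ('p node \<Rightarrow> 'p node) \<Rightarrow> bool" where
  "nodes_iso R t R' t' h \<longleftrightarrow> bij_betw h (nodes R t) (nodes R' t') \<and>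
     (\<forall>x\<in>nodes R t. node_type R' (h x) = node_type R x \<and> is_left R' (h x) = is_left R x \<and>
        parent R' (h x) = map_sum h id (parent R x))"

lemma PS_wf: "PS R \<Longrightarrow> wf_ps R" and PS_circ: "PS R \<Longrightarrow> circ_ports R = {}"
  by (auto simp: PS_def wf_ps_def)

text \<open>An unfolding of \<open>R\<close> gives a point of \<open>interp R\<close>, hence of
  \<open>interp R'\<close>, hence an unfolding of \<open>R'\<close> with the same values at its
  roots. Equality of types at the conclusions is the part that values do not provide.\<close>

lemma interp_nodes_iso:
  assumes R: "PS R" and R': "PS R'" and c: "conclusions R = conclusions R'"
    and ty: "\<forall>p\<in>conclusions R. ptype (ground_of R) p = ptype (ground_of R') p"
    and sub: "interp R \<subseteq> interp R'"
  shows "\<exists>t' h. nodes_iso R t R' t' h"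
proof -
  note wf = PS_wf[OF R] PS_wf[OF R'] and circ = PS_circ[OF R] PS_circ[OF R']
  have "restrict (\<lambda>p. node_val R t ([], p)) (conclusions R) \<in> interp R'"
    using sub interp_eq[OF wf(1) circ(1)] by blast
  then obtain t' where t': "restrict (\<lambda>p. node_val R t ([], p)) (conclusions R) =
      restrict (\<lambda>p. node_val R' t' ([], p)) (conclusions R')"
    using interp_eq[OF wf(2) circ(2)] by blast
  have val: "node_val R t ([], p) = node_val R' t' ([], p)" if "p \<in> conclusions R" for p
    using fun_cong[OF t', of p] that c by simp
  have concl: "p \<in> conclusions S \<longleftrightarrow> p \<in> inner_ports S \<and> p \<notin> wires (ground_of S)" if "circ_ports S = {}" for S :: "'a cps" and p
    using that by (auto simp: conclusions_def inner_ports_def)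
  have root: "x = ([], r) \<and> r \<in> conclusions S" if "wf_ps S" "circ_ports S = {}" "x \<in> nodes S u" "parent S x = Inr r"
    for S :: "'a cps" and u x r
    using parent_Inr[OF that(1,3,4)] that(2) by (auto simp: bullet_conclusions_def)
  interpret two_typed_forests "nodes R t" "parent R" "node_type R" "is_left R"
    "nodes R' t'" "parent R'" "node_type R'" "is_left R'"
  proof (rule two_typed_forests.intro[OF typed_forest_nodes[OF wf(1)] typed_forest_nodes[OF wf(2)]], unfold_locales)
    fix x r assume "x \<in> nodes R t" "parent R x = Inr r"
    then have x: "x = ([], r)" "r \<in> conclusions R" using root[OF wf(1) circ(1)] by blast+
    then show "\<exists>x'\<in>nodes R' t'. parent R' x' = Inr r \<and> node_type R' x' = node_type R x \<and>
        typed_forest.nval (nodes R' t') (parent R') (node_type R') (is_left R') x' =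
        typed_forest.nval (nodes R t) (parent R) (node_type R) (is_left R) x"
      using val[OF x(2)] ty c concl[OF circ(2), of r] unfolding nval_eq[OF wf(1)] nval_eq[OF wf(2)]
      by (intro bexI[of _ "([], r)"]) auto
  next
    fix x' r assume "x' \<in> nodes R' t'" "parent R' x' = Inr r"
    then have "r \<in> conclusions R" using root[OF wf(2) circ(2)] c by blast
    then show "\<exists>x\<in>nodes R t. parent R x = Inr r"
      using concl[OF circ(1), of r] by (intro bexI[of _ "([], r)"]) auto
  next
    fix x y r assume "x \<in> nodes R t" "y \<in> nodes R t" "parent R x = Inr r" "parent R y = Inr r"
    then show "x = y" using root[OF wf(1) circ(1)] by blast
  next
    fix x y r assume "x \<in> nodes R' t'" "y \<in> nodes R' t'" "parent R' x = Inr r" "parent R' y = Inr r"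
    then show "x = y" using root[OF wf(2) circ(2)] by blast
  qed
  show ?thesis using forest_iso unfolding nodes_iso_def by blast
qed

section \<open>Transport of sizes and ranks, and the consequences of minimality\<close>

lemma nodes_iso_weight:
  assumes "wf_ps R" "wf_ps R'" "nodes_iso R t R' t' h"
  shows "weight t' R' = weight t R"
  using assms bij_betw_same_card[of h "nodes R t" "nodes R' t'"] by (simp add: weight_card nodes_iso_def)

text \<open>As \<open>k\<close> exceeds the sizes of both structures, ranks can be computed from
  numbers of children on either side, and these numbers are preserved.\<close>

lemma nodes_iso_distinct_expo:
  assumes wf: "wf_ps R" "wf_ps R'" and iso: "nodes_iso R t R' t' h"
    and k: "prime k" "card (positions R) < k" "card (positions R') < k"
    and d: "distinct_expo k R t"
  shows "distinct_expo k R' t'"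
proof -
  have h: "bij_betw h (nodes R t) (nodes R' t')"
    and ty: "\<And>x. x \<in> nodes R t \<Longrightarrow> node_type R' (h x) = node_type R x"
    and par: "\<And>x. x \<in> nodes R t \<Longrightarrow> parent R' (h x) = map_sum h id (parent R x)"
    using iso by (auto simp: nodes_iso_def)
  have h_in: "h x \<in> nodes R' t'" if "x \<in> nodes R t" for x using bij_betw_apply[OF h that] .
  have bang: "h x \<in> bangs R' t' \<longleftrightarrow> x \<in> bangs R t" if "x \<in> nodes R t" for x
    using that h_in[OF that] ty[OF that] node_lab_type[OF wf(1) that] node_lab_type[OF wf(2) h_in[OF that]]
    by (simp add: bangs_def)
  have bangs': "bangs R' t' = h ` bangs R t"
  proof
    show "h ` bangs R t \<subseteq> bangs R' t'"
    proof (rule image_subsetI)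
      fix v assume v: "v \<in> bangs R t"
      then have "v \<in> nodes R t" by (simp add: bangs_def)
      then show "h v \<in> bangs R' t'" using bang v by blast
    qed
    show "bangs R' t' \<subseteq> h ` bangs R t"
    proof
      fix v' assume v': "v' \<in> bangs R' t'"
      then have "v' \<in> h ` nodes R t" using bij_betw_imp_surj_on[OF h] by (simp add: bangs_def)
      then show "v' \<in> h ` bangs R t" using v' bang by auto
    qed
  qed
  have "children R' t' (h x) = h ` children R t x" if x: "x \<in> nodes R t" for x
  proof -
    have "parent R' (h y) = Inl (h x) \<longleftrightarrow> parent R y = Inl x" if y: "y \<in> nodes R t" for y
    proof (cases "parent R y")
      case (Inl z)
      then have "z \<in> nodes R t" using parent_in_nodes[OF wf(1) y] by blast
      then show ?thesis using par[OF y] Inl x h by (auto simp: bij_betw_def inj_on_def)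
    qed (use par[OF y] in auto)
    then show ?thesis unfolding children_def bij_betw_imp_surj_on[OF h, symmetric] by auto
  qed
  moreover have "inj_on h (children R t x)" for x
    using h by (auto simp: bij_betw_def children_def inj_on_def)
  ultimately have card: "card (children R' t' (h x)) = card (children R t x)" if "x \<in> nodes R t" for x
    using that by (simp add: card_image)
  have X: "multiplicity k (ncopies t' (h x)) = multiplicity k (ncopies t x)" if x: "x \<in> bangs R t" for x
  proof -
    have n: "x \<in> nodes R t" using x by (simp add: bangs_def)
    have "h x \<in> bangs R' t'" using bang[OF n] x by simp
    then show ?thesis
      using multiplicity_children_bang[OF wf(1) x k(1,2)] multiplicity_children_bang[OF wf(2) _ k(1,3), of "h x" t'] card[OF n]
      by simp
  qed
  have "inj_on h (bangs R t)" using h by (auto simp: bij_betw_def bangs_def inj_on_def)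
  then show ?thesis
    using d X unfolding distinct_expo_iff[OF wf(1)] distinct_expo_iff[OF wf(2)] bangs'
    by (auto simp: inj_on_def)
qed

lemma minimal_at:
  assumes "wf_ps R" "locally_minimal k R t" "distinct_expo k R t" "valid_path R t \<pi>"
  shows "locally_minimal k (at R \<pi>) (shape_at t \<pi>) \<and> distinct_expo k (at R \<pi>) (shape_at t \<pi>)"
  using assms
proof (induction R t \<pi> rule: valid_path.induct)
  case (2 R t a i \<pi>)
  then have a: "a \<in> boxes R" "copies t a ! i \<in> set (copies t a)" by auto
  show ?case
    using "2.IH"[OF wf_psD(3)[OF 2(2) a(1)] locally_minimal_copy[OF 2(2,3) a]
      distinct_expo_mono[OF 2(4) copy_expo_sub[OF 2(2) a]]] "2.prems"(4) by simp
qed simp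

lemma minimal_expanded:
  assumes R: "wf_ps R" and k: "prime k" "card (positions R) < k"
    and d: "distinct_expo k R t" and m: "locally_minimal k R t"
  shows "expanded R t k"
proof
  show "wf_ps R" "prime k" "card (positions R) < k" "distinct_expo k R t" by fact+
  show pow: "ncopies t v = k ^ multiplicity k (ncopies t v)" if v: "v \<in> bangs R t" for v
  proof -
    have p: "valid_path R t (fst v)" "snd v \<in> boxes (at R (fst v))" using v by (auto simp: bangs_iff)
    show ?thesis
      using minimal_copies_power[OF wf_at[OF R p(1)] _ _ k(1) p(2)] minimal_at[OF R m d p(1)]
      by (simp add: ncopies_def)
  qed
  fix v w assume v: "v \<in> bangs R t" and w: "w \<in> bangs R t" and ib: "in_box w v"
  obtain i where i: "fst w = fst v @ [(snd v, i)]" using ib by (auto simp: in_box_def)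
  have p: "valid_path R t (fst v)" "snd v \<in> boxes (at R (fst v))" using v by (auto simp: bangs_iff)
  let ?s = "copies (shape_at t (fst v)) (snd v) ! i"
  have s: "?s \<in> set (copies (shape_at t (fst v)) (snd v))" "snd w \<in> boxes (box_at (at R (fst v)) (snd v))"
    using w i by (auto simp: bangs_iff)
  have "ncopies t v \<le> ncopies t w"
    using minimal_copies_nested[OF wf_at[OF R p(1)] conjunct1[OF minimal_at[OF R m d p(1)]]
        conjunct2[OF minimal_at[OF R m d p(1)]] p(2) s] i
    by (simp add: ncopies_def)
  then have "k ^ multiplicity k (ncopies t v) \<le> k ^ multiplicity k (ncopies t w)"
    using pow[OF v] pow[OF w] by simp
  then have "multiplicity k (ncopies t v) \<le> multiplicity k (ncopies t w)"
    using prime_gt_1_nat[OF k(1)] by (simp add: power_increasing_iff)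
  \<comment> \<open>The exchange argument gives only a weak inequality; distinctness of the ranks
    makes it strict.\<close>
  moreover have "v \<noteq> w" using i by auto
  then have "multiplicity k (ncopies t v) \<noteq> multiplicity k (ncopies t w)"
    using d v w unfolding distinct_expo_iff[OF R] by (auto simp: inj_on_def)
  ultimately show "multiplicity k (ncopies t v) < multiplicity k (ncopies t w)" by simp
qed

lemma (in expanded) link_0_False: "x \<in> stage 0 \<Longrightarrow> link 0 False x y \<longleftrightarrow> in_box x y"
  using in_box_stage(2)[of x 0 y] rank_pos[of y] by (auto simp: link_def)

lemma (in two_expanded) stage_iso_is_iso:
  assumes circ: "circ_ports R = {}" "circ_ports R' = {}" and h: "stage_iso 0 h"
  shows "\<exists>\<phi>. is_iso \<phi> R R' \<and> (\<forall>p\<in>conclusions R. ground_map \<phi> p = p)"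
proof -
  define g where "g p = snd (h ([], p))" for p
  note bij = h_bij[OF h, unfolded A.stage_0 A'.stage_0]
    and label = h_label[OF h, unfolded A.stage_0] and link = h_link[OF h, unfolded A.stage_0]
  note link' = A.link_0_False[unfolded A.stage_0] A'.link_0_False[unfolded A'.stage_0]
  have h_in: "h x \<in> positions R'" if "x \<in> positions R" for x using bij_betw_apply[OF bij that] .
  have box: "in_box (h x) (h y) \<longleftrightarrow> in_box x y" if "x \<in> positions R" "y \<in> positions R" for x y
    using link[OF that, of False] link'(1)[OF that(1)] link'(2)[OF h_in[OF that(1)]] by simp
  \<comment> \<open>A position at depth 0 is one that lies in no box, and \<open>h\<close> reflects
    \<open>in_box\<close>.\<close>
  have root: "h ([], p) = ([], g p)" if p: "p \<in> inner_ports R" for p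
  proof -
    have "fst (h ([], p)) = []"
    proof (rule ccontr)
      assume "fst (h ([], p)) \<noteq> []"
      then obtain \<sigma> s where \<sigma>: "fst (h ([], p)) = \<sigma> @ [s]" by (cases "fst (h ([], p))" rule: rev_cases) auto
      let ?v = "(\<sigma>, fst s)"
      have ib: "in_box (h ([], p)) ?v" using \<sigma> by (auto simp: in_box_def prod_eq_iff)
      have "h ([], p) \<in> A'.stage 0" using h_in[of "([], p)"] p A'.stage_0 by simp
      then have "?v \<in> positions R'" using A'.in_box_stage(1)[OF _ ib, of 0] A'.stage_0 by simp
      then have "?v \<in> h ` positions R" using bij_betw_imp_surj_on[OF bij] by simp
      then obtain y where "y \<in> positions R" "?v = h y" by auto
      then show False using box[of "([], p)" y] ib p by simp
    qed
    then show ?thesis by (simp add: g_def prod_eq_iff)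
  qed
  \<comment> \<open>The label of a root contains its conclusion, and without circles the only node
    with that exit is the conclusion itself.\<close>
  have par_root: "g r = r \<and> parent R' (h x) = Inr r" if x: "x \<in> positions R" "parent R x = Inr r" for x r
  proof -
    have xr: "x = ([], r)" using positions_parent_Inr[OF A.wf x] circ by simp
    have p: "parent R' (h x) = Inr r"
      using label[OF x(1)] x(2) by (cases "parent R' (h x)") (auto simp: A.label_def A'.label_def)
    then have "h x = ([], r)" using positions_parent_Inr[OF A'.wf h_in[OF x(1)]] circ by simp
    then show ?thesis using p xr by (simp add: g_def)
  qed
  have "position_iso R R' h g"
  proof
    show "wf_ps R" "wf_ps R'" by (fact A.wf, fact A'.wf)
    show "bij_betw h (positions R) (positions R')" by (rule bij)
    show "node_type R' (h x) = node_type R x" "is_left R' (h x) = is_left R x" if "x \<in> positions R" for x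
      using label[OF that] by (auto simp: A.label_def A'.label_def)
    show "h ([], p) = ([], g p)" if "p \<in> inner_ports R" for p by (rule root[OF that])
    show "bij_betw g (circ_ports R) (circ_ports R')" using circ by (simp add: bij_betw_def)
    show "ptype (ground_of R') (g q) = ptype (ground_of R) q" if "q \<in> circ_ports R" for q using that circ by simp
    show "in_box (h x) (h y) \<longleftrightarrow> in_box x y" if "x \<in> positions R" "y \<in> positions R" for x y by (rule box[OF that])
    show "parent R' (h x) = map_sum h g (parent R x)" if x: "x \<in> positions R" for x
    proof (cases "parent R x")
      case (Inl y)
      have "y \<in> positions R" by (rule parent_positions[OF A.wf x Inl])
      then show ?thesis using link[OF x, of y True] Inl by (simp add: A.link_def A'.link_def)
    next
      case (Inr r)
      then show ?thesis using par_root[OF x Inr] by simp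
    qed
  qed
  then obtain \<phi> where \<phi>: "is_iso \<phi> R R'" "ground_map \<phi> = g" using position_iso_is_iso by blast
  moreover have "g p = p" if p: "p \<in> conclusions R" for p
  proof -
    have "p \<in> inner_ports R" "p \<notin> wires (ground_of R)" using p circ by (auto simp: conclusions_def inner_ports_def)
    then show ?thesis using par_root[of "([], p)" p] by simp
  qed
  ultimately show ?thesis by blast
qed

theorem theorem9:
  fixes R R' :: "'p cps"
  assumes "PS R" and "PS R'"
    and "conclusions R = conclusions R'"
    and "\<forall>p\<in>conclusions R. ptype (ground_of R) p = ptype (ground_of R') p"
    and "interp R = interp R'"
  shows "R \<equiv>\<^sub>P\<^sub>S R'"
proof -
  note wf = PS_wf[OF assms(1)] PS_wf[OF assms(2)]
  have transfer: "\<exists>t' h. nodes_iso R t R' t' h" and transfer': "\<exists>u h. nodes_iso R' u' R u h" for t u'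
    using interp_nodes_iso[OF assms(1-4)] interp_nodes_iso[OF assms(2,1)] assms(3-5) by simp_all
  obtain k where k: "prime k" "card (positions R) + card (positions R') < k" using bigger_prime by blast
  then have K: "card (positions R) < k" "card (positions R') < k" by simp_all
  have "\<exists>t. distinct_expo k R t" by (rule exists_distinct_expo[OF wf(1) k(1)])
  then obtain t where t: "distinct_expo k R t" "\<And>u. distinct_expo k R u \<Longrightarrow> weight t R \<le> weight u R"
    using ex_has_least_nat[of "distinct_expo k R" _ "\<lambda>t. weight t R"] by blast
  obtain t' h where h: "nodes_iso R t R' t' h" using transfer by blast
  have t': "distinct_expo k R' t'" by (rule nodes_iso_distinct_expo[OF wf h k(1) K t(1)])
  \<comment> \<open>A competitor on the right transfers back to an unfolding of \<open>R\<close>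
    with the same number of nodes and again with distinct positive ranks.\<close>
  have min': "weight t' R' \<le> weight u' R'" if u': "distinct_expo k R' u'" for u'
  proof -
    obtain u f where f: "nodes_iso R' u' R u f" using transfer' by blast
    have "distinct_expo k R u" by (rule nodes_iso_distinct_expo[OF wf(2,1) f k(1) K(2,1) u'])
    then have "weight t R \<le> weight u R" by (rule t(2))
    then show ?thesis using nodes_iso_weight[OF wf h] nodes_iso_weight[OF wf(2,1) f] by simp
  qed
  \<comment> \<open>Competitors whose ranks form part of those of \<open>t\<close> again have
    distinct positive ranks, so the global minimum covers them.\<close>
  have "locally_minimal k R t"
    unfolding locally_minimal_def using t(2) distinct_expo_mono[OF t(1)] by blast
  moreover have "locally_minimal k R' t'"
    unfolding locally_minimal_def using min' distinct_expo_mono[OF t'] by blast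
  ultimately interpret two_expanded R t R' t' k
    using minimal_expanded[OF wf(1) k(1) K(1) t(1)] minimal_expanded[OF wf(2) k(1) K(2) t']
    by (intro two_expanded.intro)
  obtain f where "stage_iso 0 f"
    using exists_stage_iso_0[of h] h unfolding nodes_iso_def by blast
  then show ?thesis
    using stage_iso_is_iso[OF PS_circ[OF assms(1)] PS_circ[OF assms(2)]] by (simp add: ps_equiv_def)
qed

end
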